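(* Let $k\ge4$ be even. If $\mathcal{O}(\mathbb{C},k)\neq\emptyset$, then $6\mid k$. Moreover, $\mathcal{O}(\mathbb{C},k)$ is exactly the union of the $\mathcal{G}_0$-orbits of the quadruples $(i,j\mid s,t)$ listed below (each family being present only when its divisibility condition holds); each listed quadruple lies in $\mathcal{O}(\mathbb{C},k)$ and satisfies $\phi^{\omega}\frac{\phi^j-1}{\phi^i-1}=\frac{\phi^t-1}{\phi^s-1}$ with the stated $\omega$ (in all cases $\omega=\frac{(t+i)-(s+j)}{2}$). (1) If $k=6\ell$: $(u,\ell\mid 2u,3\ell-u)$ for every integer $u$ with $1\le u\le\lfloor k/4\rfloor$ and $u\ne\ell$; $\omega=\ell-u$. (2) If $k=30m$: $(m,3m\mid3m,11m)$, $\omega=3m$; $(3m,5m\mid5m,9m)$, $\omega=m$; $(7m,9m\mid9m,13m)$, $\omega=m$; $(m,2m\mid4m,9m)$, $\omega=2m$; $(2m,3m\mid5m,8m)$, $\omega=m$; $(8m,9m\mid11m,14m)$, $\omega=m$; $(2m,3m\mid7m,14m)$, $\omega=3m$; $(3m,4m\mid8m,13m)$, $\omega=2m$; $(4m,5m\mid9m,14m)$, $\omega=2m$. (3) If $k=42m$: $(2m,3m\mid9m,16m)$, $\omega=3m$; $(3m,4m\mid10m,15m)$, $\omega=2m$; $(8m,9m\mid15m,20m)$, $\omega=2m$. (4) If $k=60m$: $(3m,4m\mid16m,27m)$, $\omega=5m$; $(5m,6m\mid18m,25m)$, $\omega=3m$; $(8m,9m\mid21m,28m)$, $\omega=3m$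.
   Context: $\phi=\exp(2\pi\mathrm{i}/k)$, $\mathbf{k}=\{1,\dots,k-1\}$, $\mathbf{k}_0=\{0,\dots,k-1\}$. A quadruple $(i,j\mid s,t)\in\mathbf{k}^4$ with $i\ne s$ is an overlap if $\phi^\omega(\phi^j-1)(\phi^s-1)=(\phi^i-1)(\phi^t-1)$ for some $\omega\in\mathbf{k}_0$; it is trivial if one of $i\equiv\pm j$, $j\equiv\pm t$, $t\equiv\pm s$, $s\equiv\pm i\pmod k$ holds, nontrivial otherwise. $\mathcal{O}(\mathbb{C},k)$ is the set of nontrivial overlaps. $\mathcal{G}_0$ is the group of maps on $\mathbf{k}^4$ generated by $\kappa_1,\dots,\kappa_4$ (where $\kappa_m$ replaces the $m$-th entry $u$ of $(i,j\mid s,t)$ by $k-u$) and the coordinate permutations $(i,t)$, $(j,s)$, $(i,j)(s,t)$. *)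

theory Defs
  imports Complex_Main
begin

type_synonym quad = "nat \<times> nat \<times> nat \<times> nat"

definition phi :: "nat \<Rightarrow> complex" where
  "phi k = exp (2 * of_real pi * \<i> / of_nat k)"

definition kset :: "nat \<Rightarrow> nat set" where
  "kset k = {1..k-1}"

definition is_overlap :: "nat \<Rightarrow> quad \<Rightarrow> bool" where
  "is_overlap k q = (case q of (i, j, s, t) \<Rightarrow>
     i \<in> kset k \<and> j \<in> kset k \<and> s \<in> kset k \<and> t \<in> kset k \<and> i \<noteq> s \<and>
     (\<exists>\<omega>\<in>{0..<k}. phi k ^ \<omega> * (phi k ^ j - 1) * (phi k ^ s - 1)
                   = (phi k ^ i - 1) * (phi k ^ t - 1)))"

definition congpm :: "nat \<Rightarrow> nat \<Rightarrow> nat \<Rightarrow> bool" where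
  "congpm k a b = (a mod k = b mod k \<or> (a + b) mod k = 0)"

definition is_trivial :: "nat \<Rightarrow> quad \<Rightarrow> bool" where
  "is_trivial k q = (case q of (i, j, s, t) \<Rightarrow>
     congpm k i j \<or> congpm k j t \<or> congpm k t s \<or> congpm k s i)"

definition Ovl :: "nat \<Rightarrow> quad set" where
  "Ovl k = {q. is_overlap k q \<and> \<not> is_trivial k q}"

definition G0_gens :: "nat \<Rightarrow> (quad \<Rightarrow> quad) set" where
  "G0_gens k = {
     (\<lambda>(i, j, s, t). (k - i, j, s, t)),
     (\<lambda>(i, j, s, t). (i, k - j, s, t)),
     (\<lambda>(i, j, s, t). (i, j, k - s, t)),
     (\<lambda>(i, j, s, t). (i, j, s, k - t)),
     (\<lambda>(i, j, s, t). (t, j, s, i)),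
     (\<lambda>(i, j, s, t). (i, s, j, t)),
     (\<lambda>(i, j, s, t). (j, i, t, s))}"

text \<open>The group generated (all generators are involutions, so the generated
  monoid under composition is the generated group).\<close>
inductive_set G0 :: "nat \<Rightarrow> (quad \<Rightarrow> quad) set" for k where
  G0_id: "id \<in> G0 k"
| G0_step: "g \<in> G0_gens k \<Longrightarrow> f \<in> G0 k \<Longrightarrow> g \<circ> f \<in> G0 k"

definition G0_orbit :: "nat \<Rightarrow> quad \<Rightarrow> quad set" where
  "G0_orbit k q = {g q | g. g \<in> G0 k}"

definition listed :: "nat \<Rightarrow> (quad \<times> int) set" where
  "listed k =
    {((u, l, 2*u, 3*l - u), int l - int u) | u l. k = 6*l \<and> 1 \<le> u \<and> u \<le> k div 4 \<and> u \<noteq> l}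
  \<union> (\<Union>m\<in>{m. k = 30*m}.
       {((m, 3*m, 3*m, 11*m), int (3*m)), ((3*m, 5*m, 5*m, 9*m), int m),
        ((7*m, 9*m, 9*m, 13*m), int m), ((m, 2*m, 4*m, 9*m), int (2*m)),
        ((2*m, 3*m, 5*m, 8*m), int m), ((8*m, 9*m, 11*m, 14*m), int m),
        ((2*m, 3*m, 7*m, 14*m), int (3*m)), ((3*m, 4*m, 8*m, 13*m), int (2*m)),
        ((4*m, 5*m, 9*m, 14*m), int (2*m))})
  \<union> (\<Union>m\<in>{m. k = 42*m}.
       {((2*m, 3*m, 9*m, 16*m), int (3*m)), ((3*m, 4*m, 10*m, 15*m), int (2*m)),
        ((8*m, 9*m, 15*m, 20*m), int (2*m))})
  \<union> (\<Union>m\<in>{m. k = 60*m}.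
       {((3*m, 4*m, 16*m, 27*m), int (5*m)), ((5*m, 6*m, 18*m, 25*m), int (3*m)),
        ((8*m, 9*m, 21*m, 28*m), int (3*m))})"

end

(*
  Since phi^n - 1 = 2 i sin(pi n/k) exp(pi i n/k), an overlap is, up to a parity condition on
  i + j + s + t, the equation sin(pi i/k) sin(pi t/k) = sin(pi j/k) sin(pi s/k). Expanding the
  products turns it into the vanishing of a sum of four cosines of rational multiples of pi, that
  is, of a sum of eight roots of unity closed under conjugation.

  Such sums are classified by Mann's method. Let the angles be multiples of 2 pi/M, and let p be a
  prime dividing M. Galois conjugation shows: if p^2 divides M, or if some residue class of
  exponents modulo p is empty, then the subsum over every residue class modulo p vanishes. The
  classes then contain at most four roots up to conjugation, and short vanishing sums of unit
  complex numbers are pairs x, -x or equilateral triangles; these give the trivial overlaps and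
  the one-parameter family. Otherwise M can be reduced to a divisor of 420, all classes modulo 7
  (or else modulo 5) are occupied by the eight exponents, and the only remaining freedom gives the
  five sporadic sums of four cosines. Each of these yields three listed quadruples, one for each
  way of splitting its four angles into two pairs.
*)
theory Submission
  imports Defs "HOL-Computational_Algebra.Computational_Algebra" "HOL-Library.Multiset"
begin

section \<open>Galois conjugation of vanishing sums of roots of unity\<close>

text \<open>Parity is set aside and recovered at the end. Norms turn a nontrivial overlap into
  \<open>sine_quad\<close>, which is solved without regard to parity. Every listed quadruple has an
  even entry sum, and for even \<open>k\<close> the generators of \<open>G0\<close> preserve that
  parity, so every solution is an overlap after all. Field automorphisms never appear: a conjugation
  is the substitution of a power of a root of unity into an integer polynomial. The bounds in 420 =
  4 * 3 * 5 * 7 have different causes. Eight exponents cannot occupy all classes of a prime from 11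
  on. The prime 2 is the obstacle: its classes are closed under negation, so a class sum does not
  separate a root from its conjugate; once 8 divides the modulus, a further conjugation separates
  the odd exponents modulo 4. A single factor 3 needs no class argument: at modulus 12 the cosines
  involve only \<open>sqrt 3\<close>, and a finite table suffices. The prime 7 yields one sporadic
  sum, the prime 5 the other four.\<close>

lemma prime_dvd_add_power_diff:
  fixes a b :: "'a::comm_ring_1"
  assumes "prime q"
  shows "of_nat q dvd (a + b) ^ q - (a ^ q + b ^ q)"
proof -
  obtain n where q: "q = Suc n" using assms by (metis not0_implies_Suc not_prime_0)
  have "n > 0" using assms q by (cases n) auto
  have "(a + b) ^ q = (\<Sum>k\<le>q. of_nat (q choose k) * a ^ k * b ^ (q - k))"
    by (rule binomial_ring)
  also have "{..q} = insert 0 (insert q {0<..<q})" using q by auto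
  also have "(\<Sum>k\<in>\<dots>. of_nat (q choose k) * a ^ k * b ^ (q - k)) =
      b ^ q + (a ^ q + (\<Sum>k\<in>{0<..<q}. of_nat (q choose k) * a ^ k * b ^ (q - k)))"
    using q by simp
  finally have *: "(a + b) ^ q - (a ^ q + b ^ q) =
      (\<Sum>k\<in>{0<..<q}. of_nat (q choose k) * a ^ k * b ^ (q - k))" by simp
  have "(of_nat q :: 'a) dvd of_nat (q choose k)" if "k \<in> {0<..<q}" for k
  proof -
    have "q dvd q choose k" using that assms by (intro dvd_choose_prime) auto
    thus ?thesis by (metis dvd_def of_nat_mult)
  qed
  thus ?thesis unfolding * by (intro dvd_sum) (simp add: mult.assoc)
qed

lemma prime_dvd_diff_power:
  fixes a :: int
  assumes "prime q"
  shows "int q dvd a - a ^ q"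
proof (induction a rule: int_induct[where k = 0])
  case base
  thus ?case using assms by (simp add: power_0_left)
next
  case (step1 a)
  have "(a + 1) - (a + 1) ^ q = (a - a ^ q) - ((a + 1) ^ q - (a ^ q + 1 ^ q))" by simp
  thus ?case using step1 prime_dvd_add_power_diff[OF assms, of a 1] by (metis dvd_diff of_nat_id)
next
  case (step2 a)
  have "(a - 1) - (a - 1) ^ q = (a - a ^ q) + ((a - 1 + 1) ^ q - ((a - 1) ^ q + 1 ^ q))" by simp
  thus ?case using step2 prime_dvd_add_power_diff[OF assms, of "a - 1" 1] by (metis dvd_add)
qed

text \<open>Frobenius modulo \<open>q\<close>: taking \<open>q\<close>-th powers is additive there,
  and by Fermat it fixes the integer coefficients.\<close>

lemma prime_dvd_pcompose_monom_diff:
  fixes h :: "int poly"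
  assumes "prime q"
  shows "of_nat q dvd pcompose h (monom 1 q) - h ^ q"
proof (induction h)
  case 0
  have "q > 0" using assms prime_gt_0_nat by blast
  thus ?case by (simp add: power_0_left)
next
  case (pCons a h)
  let ?X = "[:0, 1:] :: int poly"
  have X: "monom 1 q = ?X ^ q" by (simp add: monom_altdef)
  have "int q dvd a - a ^ q"
    using assms by (rule prime_dvd_diff_power)
  hence 1: "(of_nat q :: int poly) dvd [:a:] - [:a:] ^ q"
    by (metis (no_types, lifting) const_poly_dvd_const_poly_iff of_nat_poly diff_pCons diff_zero poly_const_pow)
  have h: "pCons a h = [:a:] + ?X * h" by simp
  have "pcompose (pCons a h) (monom 1 q) - pCons a h ^ q =
      ([:a:] - [:a:] ^ q) + ?X ^ q * (pcompose h (monom 1 q) - h ^ q)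
        - (([:a:] + ?X * h) ^ q - ([:a:] ^ q + (?X * h) ^ q))"
    unfolding h pcompose_add pcompose_mult
    by (simp only: X pcompose_pCons pcompose_const pcompose_0 algebra_simps power_mult_distrib) (simp add: algebra_simps)
  thus ?case
    using 1 pCons prime_dvd_add_power_diff[OF assms] by (metis dvd_add dvd_diff dvd_mult)
qed

section \<open>Integer polynomials vanishing at a root of unity\<close>

definition ev :: "int poly \<Rightarrow> complex \<Rightarrow> complex" where
  "ev P z = poly (map_poly of_int P) z"

lemma ev_0 [simp]: "ev 0 z = 0" by (simp add: ev_def)

lemma ev_add [simp]: "ev (P + Q) z = ev P z + ev Q z"
proof -
  have "map_poly of_int (P + Q) = (map_poly of_int P + map_poly of_int Q :: complex poly)"
    by (intro poly_eqI) (simp add: coeff_map_poly)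
  thus ?thesis by (simp add: ev_def)
qed

lemma ev_mult [simp]: "ev (P * Q) z = ev P z * ev Q z"
proof -
  have "map_poly of_int (P * Q) = (map_poly of_int P * map_poly of_int Q :: complex poly)"
    by (intro poly_eqI) (simp add: coeff_map_poly coeff_mult)
  thus ?thesis by (simp add: ev_def)
qed

lemma ev_pCons [simp]: "ev (pCons a P) z = of_int a + z * ev P z"
proof -
  have "map_poly of_int (pCons a P) = (pCons (of_int a) (map_poly of_int P) :: complex poly)"
    by (intro poly_eqI) (simp add: coeff_map_poly coeff_pCons split: nat.split)
  thus ?thesis by (simp add: ev_def)
qed

lemma ev_minus [simp]: "ev (- P) z = - ev P z"
  by (metis ev_0 ev_add add.right_inverse add_eq_0_iff)

lemma ev_diff [simp]: "ev (P - Q) z = ev P z - ev Q z"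
  by (simp only: diff_conv_add_uminus ev_add ev_minus)

lemma ev_1 [simp]: "ev 1 z = 1"
  by (simp add: one_pCons)

lemma ev_smult [simp]: "ev (smult c P) z = of_int c * ev P z"
  by (induction P) (simp_all add: algebra_simps)

lemma ev_monom [simp]: "ev (monom c n) z = of_int c * z ^ n"
  by (induction n) (simp_all add: monom_0 monom_Suc)

lemma ev_pcompose [simp]: "ev (pcompose P Q) z = ev P (ev Q z)"
  by (induction P) (simp_all add: pcompose_pCons)

lemma ev_sum_list: "ev (\<Sum>x\<leftarrow>xs. f x) z = (\<Sum>x\<leftarrow>xs. ev (f x) z)"
  by (induction xs) simp_all

text \<open>An integral minimal polynomial. Divisibility has to hold over the integers, since
  everything is reduced modulo a prime later; a primitive polynomial of least degree achieves this,
  being irreducible and hence prime.\<close>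

lemma minimal_int_poly:
  assumes "P \<noteq> 0" "ev P z = 0"
  obtains f where "degree f > 0" "ev f z = 0" "\<And>Q. ev Q z = 0 \<Longrightarrow> f dvd Q"
proof -
  define A where "A = {Q. Q \<noteq> 0 \<and> ev Q z = 0}"
  obtain g where g: "g \<in> A" "\<And>Q. Q \<in> A \<Longrightarrow> degree g \<le> degree Q"
    using assms arg_min_nat_lemma[of "\<lambda>Q. Q \<in> A" P degree] unfolding A_def by blast
  define f where "f = primitive_part g"
  have g0: "g \<noteq> 0" using g A_def by simp
  have gf: "g = smult (content g) f" by (simp add: f_def)
  have f0: "f \<noteq> 0" using g0 gf by auto
  have fz: "ev f z = 0"
  proof -
    have "of_int (content g) * ev f z = 0"
      using g(1) unfolding A_def by (subst ev_smult [symmetric], subst gf [symmetric]) simp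
    thus ?thesis using g0 by simp
  qed
  have cf: "content f = 1" using g0 by (simp add: f_def)
  have df: "degree f = degree g" by (simp add: f_def)
  have d0: "degree f > 0"
  proof (rule ccontr)
    assume "\<not> degree f > 0"
    then obtain c where "f = [:c:]" by (metis degree_eq_zeroE neq0_conv)
    thus False using fz f0 by simp
  qed
  have irr: "irreducible f"
  proof (rule irreducibleI)
    show "\<not> is_unit f" using d0 by (auto simp: is_unit_poly_iff)
    fix a b assume ab: "f = a * b"
    have a0: "a \<noteq> 0" "b \<noteq> 0" using f0 ab by auto
    have deg: "degree f = degree a + degree b" using a0 ab by (simp add: degree_mult_eq)
    have unit: "is_unit a" if "degree a = 0" "a dvd f" for a
    proof -
      obtain c where c: "a = [:c:]" using \<open>degree a = 0\<close> by (rule degree_eq_zeroE)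
      hence "c dvd content f" using that by (simp add: const_poly_dvd_iff_dvd_content)
      thus ?thesis using cf c by (simp add: is_unit_poly_iff)
    qed
    have "ev a z = 0 \<or> ev b z = 0" using fz ab by simp
    thus "is_unit a \<or> is_unit b"
    proof
      assume "ev a z = 0"
      hence "degree f \<le> degree a" using g(2) a0 df by (simp add: A_def)
      thus ?thesis using deg unit[of b] ab by simp
    next
      assume "ev b z = 0"
      hence "degree f \<le> degree b" using g(2) a0 df by (simp add: A_def)
      thus ?thesis using deg unit[of a] ab by simp
    qed
  qed (use f0 in auto)
  hence prime: "prime_elem f" by (rule irreducible_imp_prime_elem)
  \<comment> \<open>The pseudo-remainder has smaller degree and vanishes at \<open>z\<close>, so it
    is zero. The price is a constant factor \<open>a\<close>, which \<open>f\<close>, of positive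
    degree, does not divide; being prime, \<open>f\<close> divides \<open>Q\<close>.\<close>
  have "f dvd Q" if "ev Q z = 0" for Q
  proof -
    obtain a q where aq: "a \<noteq> 0" "smult a Q = f * q + pseudo_mod Q f"
      using pseudo_mod(1)[OF f0] by blast
    have "ev (smult a Q) z = 0" using that by simp
    hence "ev (pseudo_mod Q f) z = 0" using aq fz by simp
    hence "pseudo_mod Q f = 0"
      using pseudo_mod(2)[OF f0, of Q] g(2)[of "pseudo_mod Q f"] df by (force simp: A_def)
    hence "f dvd [:a:] * Q" using aq by simp
    moreover have "\<not> f dvd [:a:]"
      using d0 aq(1) dvd_imp_degree_le[of f "[:a:]"] by auto
    ultimately show ?thesis using prime prime_elem_dvd_multD by blast
  qed
  thus ?thesis using that d0 fz by blast
qed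

text \<open>Modulo \<open>q\<close> the polynomial \<open>f\<close> keeps its positive degree, so it
  cannot divide a nonzero constant there. If \<open>W\<close> is nonzero modulo \<open>q\<close>, of
  degree \<open>d\<close> there, the coefficient of \<open>f * W\<close> at
  \<open>degree f + d\<close> gives the contradiction.\<close>

lemma unit_leading_coeff_not_dvd_const_mod_prime:
  fixes f W G :: "int poly"
  assumes q: "prime q" and f: "is_unit (lead_coeff f)" "degree f > 0"
    and eq: "f * W = [:c:] + smult (int q) G"
  shows "int q dvd c"
proof (cases "\<exists>n. \<not> int q dvd coeff W n")
  case False
  have "int q dvd coeff (f * W) 0" using False by (simp add: coeff_mult)
  thus ?thesis unfolding eq by (simp add: dvd_add_left_iff)
next
  case True
  define S where "S = {n. \<not> int q dvd coeff W n}"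
  have "S \<subseteq> {..degree W}" unfolding S_def
    by (auto intro: ccontr simp: coeff_eq_0)
  hence fin: "finite S" by (rule finite_subset) simp
  define d where "d = Max S"
  have d: "d \<in> S" unfolding d_def using fin True by (intro Max_in) (auto simp: S_def)
  have d2: "int q dvd coeff W n" if "n > d" for n
    using that fin Max_ge[of S n] unfolding d_def S_def by (metis mem_Collect_eq leD)
  let ?m = "degree f"
  have "coeff (f * W) (?m + d) = (\<Sum>i\<le>?m + d. coeff f i * coeff W (?m + d - i))"
    by (simp add: coeff_mult)
  also have "\<dots> = coeff f ?m * coeff W d + (\<Sum>i\<in>{..?m + d} - {?m}. coeff f i * coeff W (?m + d - i))"
    by (subst sum.remove[of _ ?m]) auto
  finally have 1: "coeff (f * W) (?m + d) = \<dots>" .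
  have "int q dvd coeff f i * coeff W (?m + d - i)" if "i \<in> {..?m + d} - {?m}" for i
  proof (cases "i < ?m")
    case True
    thus ?thesis by (intro dvd_mult d2) simp
  next
    case False
    thus ?thesis using that by (simp add: coeff_eq_0)
  qed
  hence 2: "int q dvd (\<Sum>i\<in>{..?m + d} - {?m}. coeff f i * coeff W (?m + d - i))"
    by (rule dvd_sum)
  have "coeff [:c:] (?m + d) = 0" using f(2) by (simp add: coeff_eq_0)
  hence "int q dvd coeff (f * W) (?m + d)" unfolding eq by simp
  hence "int q dvd coeff f ?m * coeff W d" using 1 2 by (simp add: dvd_add_left_iff)
  hence "int q dvd coeff W d"
    using f(1) by (metis dvd_mult_unit_iff mult.commute)
  thus ?thesis using d by (simp add: S_def)
qed

text \<open>
  This is the irreducibility of the cyclotomic polynomials in disguise. Write \<open>x ^ N - 1 = f * h\<close>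
  with \<open>f\<close> the minimal polynomial of \<open>z\<close>. If \<open>z ^ q\<close> were not a root of \<open>f\<close>, then \<open>f\<close> would divide
  \<open>h (x ^ q)\<close>, which is \<open>h ^ q\<close> modulo \<open>q\<close>; differentiating \<open>x ^ N - 1\<close> then puts \<open>N ^ q\<close> into the ideal
  generated by \<open>f\<close> and \<open>q\<close>.
\<close>

lemma ev_root_power_prime:
  assumes z: "z ^ N = 1" "N > 0" and q: "prime q" "\<not> q dvd N" and P: "ev P z = 0"
  shows "ev P (z ^ q) = 0"
proof -
  define F :: "int poly" where "F = monom 1 N - 1"
  have Fz: "ev F w = w ^ N - 1" for w by (simp add: F_def)
  have F0: "F \<noteq> 0"
  proof
    assume "F = 0"
    hence "coeff F N = 0" by simp
    thus False using z(2) by (simp add: F_def)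
  qed
  obtain f where f: "degree f > 0" "ev f z = 0" "\<And>Q. ev Q z = 0 \<Longrightarrow> f dvd Q"
    using minimal_int_poly[OF F0, of z] Fz z by auto
  obtain h where h: "F = f * h" using f(3)[of F] Fz z by auto
  have "ev f (z ^ q) = 0"
  proof (rule ccontr)
    assume *: "ev f (z ^ q) \<noteq> 0"
    have "ev F (z ^ q) = 0" using z by (simp add: Fz flip: power_mult) (simp add: mult.commute power_mult)
    hence "ev h (z ^ q) = 0" using * h by simp
    hence "ev (pcompose h (monom 1 q)) z = 0" by simp
    then obtain a where a: "pcompose h (monom 1 q) = f * a" by (metis f(3) dvdE)
    obtain g where g: "pcompose h (monom 1 q) - h ^ q = of_nat q * g"
      using prime_dvd_pcompose_monom_diff[OF q(1), of h] by (auto elim: dvdE)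
    let ?X = "[:0, 1:] :: int poly"
    have "lead_coeff F = 1"
    proof -
      have "degree F = N"
      proof (rule antisym)
        show "degree F \<le> N" unfolding F_def
          by (intro degree_diff_le) (auto simp: degree_monom_le)
        show "N \<le> degree F" by (rule le_degree) (use z in \<open>simp add: F_def\<close>)
      qed
      thus ?thesis using z by (simp add: F_def)
    qed
    hence "lead_coeff f * lead_coeff h = 1" by (simp add: h lead_coeff_mult)
    hence lc: "is_unit (lead_coeff f)" by (metis dvdI)
    \<comment> \<open>As \<open>x\<close> times the derivative of \<open>x ^ N\<close> is
      \<open>N * x ^ N\<close>, this writes \<open>N\<close> as \<open>U * h\<close> modulo
      \<open>f\<close>. After raising to the power \<open>q\<close>, the factor \<open>h ^ q\<close>
      is a multiple of \<open>q\<close> modulo \<open>f\<close>.\<close>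
    have "?X * pderiv F = of_nat N * (F + 1)"
    proof -
      obtain n where n: "N = Suc n" using z(2) gr0_implies_Suc by blast
      have "?X * pderiv F = smult (of_nat N) (monom 1 N)"
        unfolding F_def pderiv_diff pderiv_monom n
        by (simp add: smult_monom flip: monom_Suc)
      also have "\<dots> = of_nat N * monom 1 N" by (simp add: of_nat_poly)
      finally show ?thesis by (simp add: F_def)
    qed
    hence N: "of_nat N = ?X * pderiv f * h + f * (?X * pderiv h - of_nat N * h)"
      by (simp add: h pderiv_mult algebra_simps)
    define U where "U = ?X * pderiv f"
    have "of_nat N - U * h = f * (?X * pderiv h - of_nat N * h)"
      unfolding U_def by (subst N) (rule add_diff_cancel_left')
    hence "f dvd of_nat N - U * h" by (metis dvd_triv_left)
    moreover have "of_nat N - U * h dvd of_nat N ^ q - (U * h) ^ q"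
      by (metis power_diff_sumr2 dvd_triv_left)
    ultimately obtain w where w: "of_nat N ^ q - (U * h) ^ q = f * w" by (meson dvdE dvd_trans)
    have hq: "h ^ q = f * a - of_nat q * g" using a g by (simp add: algebra_simps)
    have "f * (w + U ^ q * a) = of_nat N ^ q + of_nat q * (g * U ^ q)"
      using w unfolding power_mult_distrib hq by (simp add: algebra_simps)
    also have "\<dots> = [:of_nat N ^ q:] + smult (int q) (g * U ^ q)"
      by (simp add: of_nat_poly poly_const_pow)
    finally have "int q dvd int N ^ q"
      using unit_leading_coeff_not_dvd_const_mod_prime[OF q(1) lc f(1)] by simp
    thus False using q by (metis of_nat_dvd_iff of_nat_power prime_dvd_power)
  qed
  moreover obtain b where "P = f * b" using f(3)[OF P] by auto
  ultimately show ?thesis by simp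
qed

text \<open>The prime factors of \<open>m\<close> are applied one after the other; \<open>z\<close>
  varies in the induction because \<open>z ^ q\<close> is the next root of unity.\<close>

lemma ev_root_power_coprime:
  assumes "z ^ N = 1" "N > 0" "coprime m N" "ev P z = 0"
  shows "ev P (z ^ m) = 0"
  using assms
proof (induction m arbitrary: z rule: prime_divisors_induct)
  case zero
  thus ?case by simp
next
  case (unit m)
  thus ?case by simp
next
  case (factor q m)
  have "\<not> q dvd N"
    using factor by (metis coprime_mult_left_iff coprime_absorb_left not_prime_unit)
  hence "ev P (z ^ q) = 0" using ev_root_power_prime factor by blast
  moreover have "(z ^ q) ^ N = 1" using factor(3) by (metis mult.commute power_mult power_one)
  ultimately have "ev P ((z ^ q) ^ m) = 0" using factor by simp
  thus ?case by (simp add: power_mult)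
qed

section \<open>Sums over residue classes of exponents\<close>

definition rt :: "nat \<Rightarrow> int \<Rightarrow> complex" where
  "rt M x = cis (2 * pi * of_int x / of_nat M)"

lemma rt_0 [simp]: "rt M 0 = 1"
  by (simp add: rt_def)

lemma rt_add: "rt M (x + y) = rt M x * rt M y"
  by (simp add: rt_def cis_mult ring_distribs add_divide_distrib)

lemma rt_minus: "rt M (- x) = cnj (rt M x)"
  by (simp add: rt_def cis_cnj)

lemma rt_diff: "rt M (x - y) = rt M x * rt M (- y)"
  using rt_add[of M x "- y"] by simp

lemma norm_rt [simp]: "norm (rt M x) = 1"
  by (simp add: rt_def)

lemma rt_nonzero [simp]: "rt M x \<noteq> 0"
  by (simp add: rt_def)

lemma Re_rt: "Re (rt M x) = cos (2 * pi * of_int x / of_nat M)"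
  by (simp add: rt_def)

lemma rt_power: "rt M x ^ n = rt M (int n * x)"
  by (simp add: rt_def Complex.DeMoivre mult_ac)

lemma rt_cong:
  assumes "M > 0" "int M dvd x - y"
  shows "rt M x = rt M y"
proof -
  obtain z where "x - y = int M * z" using assms(2) by auto
  hence x: "x = y + int M * z" by simp
  have "rt M (int M * z) = cis (2 * pi * of_int z)"
    using assms(1) by (simp add: rt_def mult.assoc)
  also have "\<dots> = 1" by (rule cis_multiple_2pi) simp
  finally show ?thesis by (simp add: x rt_add)
qed

lemma rt_mult_cancel: "d > 0 \<Longrightarrow> rt (d * M) (int d * x) = rt M x"
  by (simp add: rt_def mult.assoc)

lemma rt_eq_1_imp_dvd:
  assumes "M > 0" "rt M x = 1"
  shows "int M dvd x"
proof -
  have "cos (2 * pi * of_int x / of_nat M) = 1"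
    using assms(2) by (metis Re_rt one_complex.sel(1))
  then obtain n :: int where n: "2 * pi * of_int x / of_nat M = of_int n * 2 * pi"
    unfolding cos_one_2pi_int by blast
  hence "(of_int x :: real) = of_int (int M * n)"
    using assms(1) by (simp add: field_simps)
  thus ?thesis by (metis of_int_eq_iff dvd_triv_left)
qed

text \<open>The list is read as the exponents of an integer polynomial evaluated at
  \<open>rt M 1\<close>, and a multiplier coprime to \<open>M\<close> amounts to a coprime power of
  that root. Lists let repeated exponents count with multiplicity.\<close>

lemma sum_rt_conjugate:
  assumes M: "M > 0" and m: "coprime m (int M)" and xs: "(\<Sum>x\<leftarrow>xs. rt M x) = 0"
  shows "(\<Sum>x\<leftarrow>xs. rt M (m * x)) = 0"
proof -
  define P :: "int poly" where "P = (\<Sum>x\<leftarrow>xs. monom 1 (nat (x mod int M)))"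
  have pow: "rt M y ^ nat (x mod int M) = rt M (y * x)" for x y
  proof -
    have "rt M y ^ nat (x mod int M) = rt M ((x mod int M) * y)"
      using M by (simp add: rt_power)
    also have "\<dots> = rt M (y * x)"
    proof (rule rt_cong[OF M])
      have "(x mod int M) * y - y * x = - (int M * (x div int M) * y)"
        by (simp add: algebra_simps flip: minus_mult_div_eq_mod)
      thus "int M dvd (x mod int M) * y - y * x" by (metis dvd_minus_iff dvd_triv_left mult.assoc)
    qed
    finally show ?thesis .
  qed
  have ev: "ev P (rt M y) = (\<Sum>x\<leftarrow>xs. rt M (y * x))" for y
    by (simp add: P_def ev_sum_list pow)
  define n where "n = nat (m mod int M)"
  have "int n = m mod int M" using M by (simp add: n_def)
  hence "coprime (int n) (int M)" using m M by simp
  hence n: "coprime n M" by simp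
  have "ev P (rt M 1 ^ n) = 0"
    by (rule ev_root_power_coprime[OF _ M n])
       (use M xs in \<open>simp_all add: ev rt_power\<close>, use rt_cong[of M "int M" 0] in simp)
  moreover have "rt M 1 ^ n = rt M m" unfolding n_def pow by simp
  ultimately show ?thesis by (simp add: ev)
qed

lemma sum_sum_list_swap:
  "(\<Sum>c\<in>A. \<Sum>x\<leftarrow>xs. f c x) = (\<Sum>x\<leftarrow>xs. \<Sum>c\<in>A. f c x :: 'a::comm_monoid_add)"
  by (induction xs) (simp_all add: sum.distrib)

lemma sum_list_filter_if:
  "(\<Sum>x\<leftarrow>filter P xs. f x) = (\<Sum>x\<leftarrow>xs. if P x then f x else 0)"
  by (induction xs) simp_all

lemma sum_list_eq_filter_cong:
  "(\<And>x. P x \<longleftrightarrow> Q x) \<Longrightarrow> (\<And>x. P x \<Longrightarrow> f x = g x) \<Longrightarrow>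
    (\<Sum>x\<leftarrow>filter P xs. f x) = (\<Sum>x\<leftarrow>filter Q xs. g x)"
  by (induction xs) simp_all

lemma sum_rt_prime:
  assumes p: "prime p"
  shows "(\<Sum>c<p. rt p (int c * x)) = (if int p dvd x then of_nat p else 0)"
proof (cases "int p dvd x")
  case True
  have "rt p (int c * x) = 1" for c
    using rt_cong[of p "int c * x" 0] True p by (simp add: prime_gt_0_nat)
  thus ?thesis using True by simp
next
  case False
  have "rt p x \<noteq> 1" using False rt_eq_1_imp_dvd p prime_gt_0_nat by blast
  moreover have "rt p x ^ p = 1"
    using rt_cong[of p "int p * x" 0] p by (simp add: rt_power prime_gt_0_nat)
  moreover have "(\<Sum>c<p. rt p (int c * x)) = (\<Sum>c<p. rt p x ^ c)"
    by (simp add: rt_power)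
  ultimately show ?thesis using False by (simp add: sum_gp_strict)
qed

text \<open>The multiplier \<open>1 + c * M'\<close> changes \<open>rt M x\<close> by the factor
  \<open>rt p (c * x)\<close>. Averaging over \<open>c\<close> therefore projects onto the exponents
  divisible by \<open>p\<close>.\<close>

lemma sum_rt_average:
  assumes p: "prime p" and M: "M = p * M'" "M' > 0"
  shows "(\<Sum>c<p. \<Sum>x\<leftarrow>xs. rt M ((1 + int c * int M') * x)) =
    of_nat p * (\<Sum>x\<leftarrow>filter (\<lambda>x. int p dvd x) xs. rt M x)"
proof -
  have "(\<Sum>c<p. rt M ((1 + int c * int M') * x)) = (if int p dvd x then of_nat p * rt M x else 0)" for x
  proof -
    have "rt M ((1 + int c * int M') * x) = rt M x * rt p (int c * x)" for c
    proof -
      have "rt M ((1 + int c * int M') * x) = rt M x * rt (M' * p) (int M' * (int c * x))"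
        by (simp add: M algebra_simps flip: rt_add)
      thus ?thesis using M by (simp only: rt_mult_cancel)
    qed
    hence "(\<Sum>c<p. rt M ((1 + int c * int M') * x)) = rt M x * (\<Sum>c<p. rt p (int c * x))"
      by (simp add: sum_distrib_left)
    thus ?thesis using sum_rt_prime[OF p] by simp
  qed
  thus ?thesis
    by (simp add: sum_sum_list_swap sum_list_filter_if flip: sum_list_const_mult)
       (simp only: if_distrib[of "(*) (complex_of_nat p)"] mult_zero_right)
qed

text \<open>When \<open>p\<close> still divides \<open>M'\<close>, all multipliers
  \<open>1 + c * M'\<close> are coprime to \<open>M\<close>, so every summand of the average
  vanishes. Subtracting \<open>r\<close> from all exponents moves the class of \<open>r\<close> to
  0.\<close>

lemma class_sum_prime_square:
  assumes p: "prime p" and M: "M = p * M'" "M' > 0" "p dvd M'" and xs: "(\<Sum>x\<leftarrow>xs. rt M x) = 0"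
  shows "(\<Sum>x\<leftarrow>filter (\<lambda>x. int p dvd x - r) xs. rt M x) = 0"
proof -
  have M0: "M > 0" using M p prime_gt_0_nat by simp
  define ys where "ys = map (\<lambda>x. x - r) xs"
  have ys: "(\<Sum>x\<leftarrow>ys. rt M x) = 0"
    using xs by (simp add: ys_def o_def rt_diff sum_list_mult_const)
  have "coprime (1 + int c * int M') (int M)" for c
  proof -
    have "coprime (1 + int c * int M') (int M')" 
      by (rule coprimeI) (metis dvd_add_left_iff dvd_mult)
    moreover from this have "coprime (1 + int c * int M') (int p)"
      using M(3) by (meson coprime_divisors dvd_refl of_nat_dvd_iff)
    ultimately show ?thesis using M by simp
  qed
  hence "of_nat p * (\<Sum>x\<leftarrow>filter (\<lambda>x. int p dvd x) ys. rt M x) = 0"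
    using sum_rt_conjugate[OF M0 _ ys] by (simp flip: sum_rt_average[OF p M(1,2)])
  hence "(\<Sum>x\<leftarrow>filter (\<lambda>x. int p dvd x) ys. rt M x) = 0"
    using p by (auto simp: prime_gt_0_nat)
  thus ?thesis by (simp add: ys_def filter_map o_def rt_diff sum_list_mult_const)
qed

text \<open>
  Here \<open>x \<mapsto> w * x\<close> is the projection of the exponents onto the \<open>M'\<close>-part. Among the \<open>p\<close> exponent
  multipliers \<open>1 + c * M'\<close> all but this one are Galois conjugations.
\<close>

lemma class_sum_prime_0:
  assumes p: "prime p" and M: "M = p * M'" "M' > 0" "coprime p M'"
    and xs: "(\<Sum>x\<leftarrow>xs. rt M x) = 0"
    and w: "int M' dvd w - 1" "int p dvd w"
  shows "of_nat p * (\<Sum>x\<leftarrow>filter (\<lambda>x. int p dvd x) xs. rt M x) = (\<Sum>x\<leftarrow>xs. rt M (w * x))"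
proof -
  have M0: "M > 0" using M p prime_gt_0_nat by simp
  have p0: "p > 0" using p prime_gt_0_nat by blast
  obtain d where d: "w = 1 + int M' * d" using w(1) by (metis dvdE add.commute diff_add_cancel)
  \<comment> \<open>\<open>c0\<close> is the only \<open>c < p\<close> for which \<open>p\<close>
    divides \<open>1 + c * M'\<close>, and that multiplier is \<open>w\<close> modulo
    \<open>M\<close>.\<close>
  define c0 where "c0 = nat (d mod int p)"
  have c0: "int c0 = d mod int p" "c0 < p" using p0 by (simp_all add: c0_def nat_less_iff)
  have cop: "coprime (int p) (int M')" using M(3) by simp
  have wc: "int M dvd (1 + int c0 * int M') - w"
  proof -
    have "(1 + int c0 * int M') - w = int M' * (d mod int p - d)" using c0 d by (simp add: algebra_simps)
    moreover have "int p dvd d mod int p - d" by (metis mod_eq_dvd_iff mod_mod_trivial)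
    ultimately show ?thesis using M(1) by (simp add: mult.commute mult_dvd_mono)
  qed
  hence pc0: "int p dvd 1 + int c0 * int M'"
  proof -
    have "int p dvd (1 + int c0 * int M') - w" using wc M(1) by (metis dvd_trans dvd_triv_left of_nat_mult)
    from dvd_add[OF this w(2)] show ?thesis by simp
  qed
  have other: "(\<Sum>x\<leftarrow>xs. rt M ((1 + int c * int M') * x)) = 0" if c: "c < p" "c \<noteq> c0" for c
  proof (rule sum_rt_conjugate[OF M0 _ xs])
    have "coprime (1 + int c * int M') (int M')" 
      by (rule coprimeI) (metis dvd_add_left_iff dvd_mult)
    moreover have "\<not> int p dvd 1 + int c * int M'"
    proof
      assume "int p dvd 1 + int c * int M'"
      hence "int p dvd (int c - int c0) * int M'"
        using pc0 dvd_diff[of "int p" "1 + int c * int M'" "1 + int c0 * int M'"]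
        by (simp only: left_diff_distrib add_diff_cancel_left)
      hence "int p dvd int c - int c0" using cop by (simp add: coprime_dvd_mult_left_iff)
      hence "int c mod int p = int c0 mod int p" by (simp add: mod_eq_dvd_iff)
      thus False using c c0 by (simp flip: zmod_int)
    qed
    hence "coprime (1 + int c * int M') (int p)"
      using p by (metis coprime_commute prime_imp_coprime prime_nat_int_transfer)
    ultimately show "coprime (1 + int c * int M') (int M)" using M by simp
  qed
  have "of_nat p * (\<Sum>x\<leftarrow>filter (\<lambda>x. int p dvd x) xs. rt M x) =
      (\<Sum>c<p. \<Sum>x\<leftarrow>xs. rt M ((1 + int c * int M') * x))"
    by (rule sum_rt_average[OF p M(1,2), symmetric])
  also have "\<dots> = (\<Sum>x\<leftarrow>xs. rt M ((1 + int c0 * int M') * x)) +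
      (\<Sum>c\<in>{..<p} - {c0}. \<Sum>x\<leftarrow>xs. rt M ((1 + int c * int M') * x))"
    using c0 by (intro sum.remove) auto
  also have "(\<Sum>c\<in>{..<p} - {c0}. \<Sum>x\<leftarrow>xs. rt M ((1 + int c * int M') * x)) = 0"
    using other by (intro sum.neutral) auto
  also have "(\<Sum>x\<leftarrow>xs. rt M ((1 + int c0 * int M') * x)) = (\<Sum>x\<leftarrow>xs. rt M (w * x))"
  proof -
    have "rt M ((1 + int c0 * int M') * x) = rt M (w * x)" for x
      by (rule rt_cong[OF M0]) (use wc in \<open>metis dvd_mult2 left_diff_distrib\<close>)
    thus ?thesis by simp
  qed
  finally show ?thesis by simp
qed

text \<open>The right-hand side does not mention \<open>r\<close>: all classes have the same
  projected sum, so one empty class makes all of them vanish. The shift \<open>y\<close> is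
  \<open>r\<close> modulo \<open>p\<close> and 0 modulo \<open>M'\<close>; it moves the class of
  \<open>r\<close> to 0 and leaves the projected exponents alone.\<close>

lemma class_sum_prime:
  assumes p: "prime p" and M: "M = p * M'" "M' > 0" "coprime p M'"
    and xs: "(\<Sum>x\<leftarrow>xs. rt M x) = 0"
    and w: "int M' dvd w - 1" "int p dvd w"
  shows "of_nat p * (\<Sum>x\<leftarrow>filter (\<lambda>x. int p dvd x - r) xs. rt M (w * x)) = (\<Sum>x\<leftarrow>xs. rt M (w * x))"
proof -
  have M0: "M > 0" using M p prime_gt_0_nat by simp
  define y where "y = r * (1 - w)"
  define ys where "ys = map (\<lambda>x. x - y) xs"
  have ys: "(\<Sum>x\<leftarrow>ys. rt M x) = 0"
    using xs by (simp add: ys_def o_def rt_diff sum_list_mult_const)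
  have M'w: "int M' dvd 1 - w" using w(1) by (simp add: dvd_diff_commute)
  have dvd_iff: "int p dvd x - y \<longleftrightarrow> int p dvd x - r" for x
  proof -
    have "x - y = (x - r) + r * w" by (simp add: y_def algebra_simps)
    thus ?thesis using w(2) by (metis dvd_add_left_iff dvd_mult)
  qed
  have 1: "rt M (x - y) = rt M (w * x)" if "int p dvd x - r" for x
  proof (rule rt_cong[OF M0])
    have "x - y - w * x = (x - r) * (1 - w)" by (simp add: y_def algebra_simps)
    thus "int M dvd x - y - w * x" using that M'w M(1) by (simp add: mult_dvd_mono)
  qed
  have 2: "rt M (w * (x - y)) = rt M (w * x)" for x
  proof (rule rt_cong[OF M0])
    have "w * (x - y) - w * x = - (r * (w * (1 - w)))" by (simp add: y_def algebra_simps)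
    moreover have "int M dvd w * (1 - w)" using w(2) M'w M(1) by (simp add: mult_dvd_mono)
    ultimately show "int M dvd w * (x - y) - w * x" by simp
  qed
  have "of_nat p * (\<Sum>x\<leftarrow>filter (\<lambda>x. int p dvd x) ys. rt M x) = (\<Sum>x\<leftarrow>ys. rt M (w * x))"
    by (rule class_sum_prime_0[OF p M ys w])
  also have "(\<Sum>x\<leftarrow>ys. rt M (w * x)) = (\<Sum>x\<leftarrow>xs. rt M (w * x))"
    by (simp add: ys_def o_def 2)
  also have "(\<Sum>x\<leftarrow>filter (\<lambda>x. int p dvd x) ys. rt M x) = (\<Sum>x\<leftarrow>filter (\<lambda>x. int p dvd x - r) xs. rt M (w * x))"
    unfolding ys_def filter_map map_map o_def
    by (rule sum_list_eq_filter_cong) (use dvd_iff 1 in auto)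
  finally show ?thesis .
qed

lemma class_sums_vanish:
  assumes p: "prime p" "p dvd M" and M0: "M > 0" and xs: "(\<Sum>x\<leftarrow>xs. rt M x) = 0"
    and sp: "p * p dvd M \<or> (\<exists>r0. \<forall>x\<in>set xs. \<not> int p dvd x - r0)"
  shows "(\<Sum>x\<leftarrow>filter (\<lambda>x. int p dvd x - r) xs. rt M x) = 0"
proof (cases "p * p dvd M")
  case True
  then obtain n where "M = p * (p * n)" by (metis dvdE mult.assoc)
  thus ?thesis using class_sum_prime_square[OF p(1) _ _ _ xs, of "p * n"] M0 by simp
next
  case False
  obtain M' where M': "M = p * M'" using p(2) by auto
  have M'0: "M' > 0" using M0 M' by simp
  have cop: "coprime p M'" using False M' p(1) by (metis prime_imp_coprime mult_dvd_mono dvd_refl)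
  have "coprime (int p) (int M')" using cop by simp
  \<comment> \<open>Bezout supplies the idempotent \<open>w\<close>, which is 1 modulo
    \<open>M'\<close> and 0 modulo \<open>p\<close>.\<close>
  then obtain u v where "u * int p + v * int M' = 1" by (metis bezout_int coprime_imp_gcd_eq_1)
  hence uv: "u * int p - 1 = - (v * int M')" by simp
  define w where "w = u * int p"
  have w: "int M' dvd w - 1" "int p dvd w" unfolding w_def uv by simp_all
  note cl = class_sum_prime[OF p(1) M' M'0 cop xs w]
  obtain r0 where r0: "\<forall>x\<in>set xs. \<not> int p dvd x - r0" using sp False by auto
  have "filter (\<lambda>x. int p dvd x - r0) xs = []" using r0 by (simp add: filter_empty_conv)
  hence "(\<Sum>x\<leftarrow>xs. rt M (w * x)) = 0" using cl[of r0] by simp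
  hence 0: "(\<Sum>x\<leftarrow>filter (\<lambda>x. int p dvd x - r) xs. rt M (w * x)) = 0"
    using cl[of r] p(1) by (auto simp: prime_gt_0_nat)
  \<comment> \<open>Within one class the projection shifts all exponents by the same constant modulo
    \<open>M\<close>, so it only multiplies the class sum by a unit.\<close>
  have "rt M x = rt M (w * x) * rt M (r * (1 - w))" if "int p dvd x - r" for x
    unfolding rt_add[symmetric]
  proof (rule rt_cong[OF M0])
    have "x - (w * x + r * (1 - w)) = (x - r) * - (w - 1)" by (simp add: algebra_simps)
    thus "int M dvd x - (w * x + r * (1 - w))" using that w(1) M' by (metis dvd_minus_iff mult_dvd_mono of_nat_mult)
  qed
  hence "(\<Sum>x\<leftarrow>filter (\<lambda>x. int p dvd x - r) xs. rt M x) =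
      (\<Sum>x\<leftarrow>filter (\<lambda>x. int p dvd x - r) xs. rt M (w * x) * rt M (r * (1 - w)))"
    by (intro sum_list_eq_filter_cong) auto
  thus ?thesis using 0 by (simp add: sum_list_mult_const)
qed

section \<open>Vanishing sums of four cosines\<close>

text \<open>Conjugates of unit numbers are inverses, so the conjugated equation says that
  \<open>y * z + x * z + x * y\<close> vanishes too. Eliminating \<open>z\<close> leaves a quadratic
  whose roots are \<open>x\<close> times the primitive cube roots of unity.\<close>

lemma unit_sum3:
  fixes x y z :: complex
  assumes "norm x = 1" "norm y = 1" "norm z = 1" "x + y + z = 0"
  shows "(y = x * cis (2 * pi / 3) \<and> z = x * cis (- (2 * pi / 3))) \<or>
         (y = x * cis (- (2 * pi / 3)) \<and> z = x * cis (2 * pi / 3))"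
proof -
  have c: "cnj w = 1 / w" if "norm w = 1" for w :: complex
    using that by (metis complex_cnj_cnj complex_mod_mult_cnj complex_norm_square divide_eq_1_iff mult.commute nonzero_eq_divide_eq norm_zero of_real_1 one_power2 zero_neq_one)
  have nz: "x \<noteq> 0" "y \<noteq> 0" "z \<noteq> 0" using assms by auto
  have "cnj x + cnj y + cnj z = 0" using assms(4) by (metis complex_cnj_add complex_cnj_zero)
  hence "1 / x + 1 / y + 1 / z = 0" using assms c by simp
  hence "y * z + x * z + x * y = 0" using nz by (simp add: field_simps)
  moreover have z: "z = - x - y" using assms(4) by (metis add.commute add_diff_cancel_left' diff_0 diff_diff_add)
  ultimately have "- (x\<^sup>2 + x * y + y\<^sup>2) = 0" by (simp add: algebra_simps power2_eq_square)
  hence eq: "x\<^sup>2 + x * y + y\<^sup>2 = 0" by (simp only: neg_equal_0_iff_equal)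
  define o1 where "o1 = cis (2 * pi / 3)"
  define o2 where "o2 = cis (- (2 * pi / 3))"
  have s: "o1 + o2 = -1" "o1 * o2 = 1"
    unfolding o1_def o2_def by (simp_all add: complex_eq_iff cis_mult cos_120)
  have "(y - x * o1) * (y - x * o2) = y\<^sup>2 - x * y * (o1 + o2) + x\<^sup>2 * (o1 * o2)"
    by (simp add: algebra_simps power2_eq_square)
  also have "\<dots> = x\<^sup>2 + x * y + y\<^sup>2" unfolding s by simp
  also have "\<dots> = 0" by (rule eq)
  finally have "y = x * o1 \<or> y = x * o2" by simp
  moreover have "z = x * o2" if "y = x * o1" 
  proof -
    have "z = x * (- 1 - o1)" using z that by (simp add: algebra_simps)
    thus ?thesis using s by (metis add_diff_cancel_left')
  qed
  moreover have "z = x * o1" if "y = x * o2" 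
  proof -
    have "z = x * (- 1 - o2)" using z that by (simp add: algebra_simps)
    thus ?thesis using s by (metis add_diff_cancel_right')
  qed
  ultimately show ?thesis unfolding o1_def o2_def by blast
qed

text \<open>Conjugation gives a second symmetric equation; eliminating \<open>w\<close> turns it
  into \<open>(x + y) * (x + z) * (x + w) = 0\<close>.\<close>

lemma unit_sum4:
  fixes x y z w :: complex
  assumes "norm x = 1" "norm y = 1" "norm z = 1" "norm w = 1" "x + y + z + w = 0"
  shows "y = - x \<or> z = - x \<or> w = - x"
proof -
  have c: "cnj w = 1 / w" if "norm w = 1" for w :: complex
    using that by (metis complex_cnj_cnj complex_mod_mult_cnj complex_norm_square divide_eq_1_iff mult.commute nonzero_eq_divide_eq norm_zero of_real_1 one_power2 zero_neq_one)
  have nz: "x \<noteq> 0" "y \<noteq> 0" "z \<noteq> 0" "w \<noteq> 0" using assms by auto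
  have "cnj x + cnj y + cnj z + cnj w = 0" using assms(5) by (metis complex_cnj_add complex_cnj_zero)
  hence "1 / x + 1 / y + 1 / z + 1 / w = 0" using assms c by simp
  hence *: "(x + y) * (z * w) + (z + w) * (x * y) = 0" using nz by (simp add: field_simps)
  have w: "w = - x - y - z" using assms(5) by (simp add: algebra_simps eq_neg_iff_add_eq_0)
  have "(x + y) * ((x + z) * (x + w)) = 0"
    using * unfolding w by (simp add: algebra_simps)
  thus ?thesis by (auto simp: eq_neg_iff_add_eq_0 add.commute)
qed

definition cs :: "nat \<Rightarrow> int \<Rightarrow> real" where
  "cs M a = Re (rt M a)"

text \<open>The classification concerns multisets of cosine values, not of exponents, because a
  cosine determines its angle only up to sign and full turns.\<close>

definition balanced :: "real multiset \<Rightarrow> bool" where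
  "balanced C \<longleftrightarrow> (\<exists>x y. C = {#x, - x, y, - y#})"

text \<open>The three shifted cosines are the real parts of an equilateral triangle and cancel,
  which leaves 0 as the fourth value.\<close>

definition threefold :: "real multiset \<Rightarrow> bool" where
  "threefold C \<longleftrightarrow> (\<exists>f. C = {#0, cos f, cos (f + 2 * pi / 3), cos (f - 2 * pi / 3)#})"

text \<open>The angles are multiples of \<open>pi\<close>; each of the five quadruples has vanishing cosine sum.\<close>

definition sporadic_angles :: "real list set" where
  "sporadic_angles = {[1/3, 2/7, 4/7, 6/7], [1/2, 1/3, 2/5, 4/5], [0, 2/3, 2/5, 4/5],
     [1/3, 4/5, 11/15, 1/15], [1/3, 2/5, 13/15, 7/15]}"

text \<open>The sign \<open>v\<close> accounts for negating all four cosines at once.\<close>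

definition sporadic :: "real multiset \<Rightarrow> bool" where
  "sporadic C \<longleftrightarrow> (\<exists>v\<in>{1, -1}. \<exists>as\<in>sporadic_angles. C = mset (map (\<lambda>a. v * cos (pi * a)) as))"

definition classified :: "real multiset \<Rightarrow> bool" where
  "classified C \<longleftrightarrow> balanced C \<or> threefold C \<or> sporadic C"

lemma classified_balancedI:
  assumes "a + b + c + d = 0"
    and "b = - a \<or> c = - a \<or> d = - a \<or> c = - b \<or> d = - b \<or> d = - c"
  shows "classified {#a, b, c, d#}"
proof -
  have *: "classified {#x, y, z, w#}" if "y = - x" "x + y + z + w = 0" for x y z w
  proof -
    have "w = - z" using that by simp
    hence "balanced {#x, y, z, w#}" unfolding balanced_def that by blast
    thus ?thesis by (simp add: classified_def)
  qed
  have "{#a, b, c, d#} = {#a, c, b, d#}" "{#a, b, c, d#} = {#a, d, b, c#}"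
      "{#a, b, c, d#} = {#b, c, a, d#}" "{#a, b, c, d#} = {#b, d, a, c#}"
      "{#a, b, c, d#} = {#c, d, a, b#}"
    by simp_all
  thus ?thesis
    using assms(2) *[of b a c d] *[of c a b d] *[of d a b c] *[of c b a d] *[of d b a c] *[of d c a b] assms(1)
    by (smt (verit, del_insts) * add.commute)
qed

lemma cs_minus [simp]: "cs M (- a) = cs M a"
  by (simp add: cs_def rt_minus)

lemma cs_cong: "M > 0 \<Longrightarrow> int M dvd x - y \<Longrightarrow> cs M x = cs M y"
  unfolding cs_def by (metis rt_cong)

lemma cs_cancel: "d > 0 \<Longrightarrow> cs (d * M) (int d * x) = cs M x"
  by (simp add: cs_def rt_mult_cancel)

lemma rt_plus_rt_minus: "rt M a + rt M (- a) = of_real (2 * cs M a)"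
  by (simp add: rt_minus cs_def complex_eq_iff)

section \<open>Residue classes modulo an odd prime\<close>

definition symm :: "int list \<Rightarrow> int list" where
  "symm as = concat (map (\<lambda>a. [a, - a]) as)"

lemma sum_rt_symm: "(\<Sum>x\<leftarrow>symm as. rt M x) = of_real (2 * (\<Sum>a\<leftarrow>as. cs M a))"
  by (induction as) (simp_all add: symm_def rt_plus_rt_minus algebra_simps flip: add.assoc)

lemma unit_sum3_threefold:
  assumes "rt M a + rt M b + rt M c = 0" "cs M a + cs M b + cs M c + w = 0"
  shows "classified {#cs M a, cs M b, cs M c, w#}"
proof -
  have "Re (rt M a + rt M b + rt M c) = 0" using assms(1) by simp
  hence w: "w = 0" using assms(2) by (simp add: cs_def)
  define f where "f = 2 * pi * of_int a / of_nat M"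
  have a: "rt M a = cis f" by (simp add: rt_def f_def)
  have f: "cs M a = cos f" by (simp add: cs_def a)
  have "cs M b = cos (f + 2 * pi / 3) \<and> cs M c = cos (f - 2 * pi / 3) \<or>
        cs M b = cos (f - 2 * pi / 3) \<and> cs M c = cos (f + 2 * pi / 3)"
    using unit_sum3[OF _ _ _ assms(1)] unfolding a cis_mult cs_def by auto
  hence "threefold {#cs M a, cs M b, cs M c, w#}"
    unfolding threefold_def w f by (intro exI[of _ f]) auto
  thus ?thesis by (simp add: classified_def)
qed

lemma unit_sum2_balanced:
  assumes "rt M a + rt M b = 0" "cs M a + cs M b + z + w = 0"
  shows "classified {#cs M a, cs M b, z, w#}"
proof (rule classified_balancedI[OF assms(2)])
  have "Re (rt M a + rt M b) = 0" using assms(1) by simp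
  thus "cs M b = - cs M a \<or> z = - cs M a \<or> w = - cs M a \<or> z = - cs M b \<or> w = - cs M b \<or> w = - z"
    by (simp add: cs_def)
qed

lemma unit_sum4_balanced:
  assumes "rt M a + rt M b + rt M c + rt M d = 0"
  shows "classified {#cs M a, cs M b, cs M c, cs M d#}"
proof (rule classified_balancedI)
  have "Re (rt M a + rt M b + rt M c + rt M d) = 0" using assms by simp
  thus "cs M a + cs M b + cs M c + cs M d = 0" by (simp add: cs_def)
  show "cs M b = - cs M a \<or> cs M c = - cs M a \<or> cs M d = - cs M a \<or> cs M c = - cs M b \<or>
      cs M d = - cs M b \<or> cs M d = - cs M c"
    using unit_sum4[OF _ _ _ _ assms] by (auto simp: cs_def)
qed

text \<open>The assumption on signs, together with \<open>p\<close> odd and \<open>a\<close> not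
  divisible by \<open>p\<close>, keeps all of \<open>- a\<close>, \<open>- b\<close>,
  \<open>- c\<close>, \<open>- d\<close> out of the class of \<open>a\<close>. Hence the class sum
  consists of \<open>rt M a\<close> and some of the other three: a single unit cannot vanish, and
  two, three or four fall under the short-sum lemmas.\<close>

lemma class_sum_classified_aux:
  assumes p: "prime p" "odd p" and a: "\<not> int p dvd a"
    and sg: "\<And>x. x \<in> {b, c, d} \<Longrightarrow> int p dvd x + a \<Longrightarrow> int p dvd x - a"
    and cl: "(\<Sum>x\<leftarrow>filter (\<lambda>x. int p dvd x - a) (symm [a, b, c, d]). rt M x) = 0"
    and sum: "cs M a + cs M b + cs M c + cs M d = 0"
  shows "classified {#cs M a, cs M b, cs M c, cs M d#}"
proof -
  have p2: "\<not> int p dvd 2 * a"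
  proof
    assume "int p dvd 2 * a"
    hence "int p dvd 2 \<or> int p dvd a" using p(1) by (simp add: prime_dvd_mult_iff)
    hence "p dvd 2" using a by (metis int_dvd_int_iff of_nat_numeral)
    thus False using p by (metis dvd_refl primes_dvd_imp_eq two_is_prime_nat)
  qed
  have neg: "\<not> int p dvd - x - a" if "x \<in> {b, c, d}" for x
  proof
    assume "int p dvd - x - a"
    hence 1: "int p dvd x + a" by (metis add.commute dvd_minus_iff minus_add_distrib uminus_add_conv_diff diff_minus_eq_add minus_diff_eq)
    have "int p dvd (x + a) - (x - a)" using 1 sg[OF that 1] by (rule dvd_diff)
    thus False using p2 by simp
  qed
  have nega: "\<not> int p dvd - a - a" using p2 by (metis dvd_minus_iff minus_add_distrib mult_2 uminus_add_conv_diff add.commute diff_conv_add_uminus)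
  have neg': "\<not> int p dvd - b - a" "\<not> int p dvd - c - a" "\<not> int p dvd - d - a" using neg by auto
  consider "\<not> int p dvd b - a" "\<not> int p dvd c - a" "\<not> int p dvd d - a"
    | "int p dvd b - a" "\<not> int p dvd c - a" "\<not> int p dvd d - a"
    | "\<not> int p dvd b - a" "int p dvd c - a" "\<not> int p dvd d - a"
    | "\<not> int p dvd b - a" "\<not> int p dvd c - a" "int p dvd d - a"
    | "int p dvd b - a" "int p dvd c - a" "\<not> int p dvd d - a"
    | "int p dvd b - a" "\<not> int p dvd c - a" "int p dvd d - a"
    | "\<not> int p dvd b - a" "int p dvd c - a" "int p dvd d - a"
    | "int p dvd b - a" "int p dvd c - a" "int p dvd d - a" by blast
  thus ?thesis
  proof cases
    case 1
    thus ?thesis using cl neg' nega by (simp add: symm_def add.assoc)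
  next
    case 2
    hence "rt M a + rt M b = 0" using cl neg' nega by (simp add: symm_def add.assoc)
    thus ?thesis using unit_sum2_balanced[of M a b "cs M c" "cs M d"] sum by simp
  next
    case 3
    hence "rt M a + rt M c = 0" using cl neg' nega by (simp add: symm_def add.assoc)
    thus ?thesis using unit_sum2_balanced[of M a c "cs M b" "cs M d"] sum by (simp add: add_ac add_mset_commute)
  next
    case 4
    hence "rt M a + rt M d = 0" using cl neg' nega by (simp add: symm_def add.assoc)
    thus ?thesis using unit_sum2_balanced[of M a d "cs M b" "cs M c"] sum by (simp add: add_ac add_mset_commute)
  next
    case 5
    hence "rt M a + rt M b + rt M c = 0" using cl neg' nega by (simp add: symm_def add.assoc)
    thus ?thesis using unit_sum3_threefold sum by simp
  next
    case 6
    hence "rt M a + rt M b + rt M d = 0" using cl neg' nega by (simp add: symm_def add.assoc)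
    thus ?thesis using unit_sum3_threefold[of M a b d "cs M c"] sum by (simp add: add_ac add_mset_commute)
  next
    case 7
    hence "rt M a + rt M c + rt M d = 0" using cl neg' nega by (simp add: symm_def add.assoc)
    thus ?thesis using unit_sum3_threefold[of M a c d "cs M b"] sum by (simp add: add_ac add_mset_commute)
  next
    case 8
    hence "rt M a + rt M b + rt M c + rt M d = 0" using cl neg' nega by (simp add: symm_def add.assoc)
    thus ?thesis by (rule unit_sum4_balanced)
  qed
qed

text \<open>Replacing an exponent by its negative changes neither its cosine nor its contribution to
  the class sum. So each exponent whose negative alone meets the class of \<open>a\<close> is
  flipped into it.\<close>

lemma class_sum_classified:
  assumes p: "prime p" "odd p" and a: "\<not> int p dvd a"
    and cl: "(\<Sum>x\<leftarrow>filter (\<lambda>x. int p dvd x - a) (symm [a, b, c, d]). rt M x) = 0"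
    and sum: "cs M a + cs M b + cs M c + cs M d = 0"
  shows "classified {#cs M a, cs M b, cs M c, cs M d#}"
proof -
  define sg where "sg = (\<lambda>x. if int p dvd x + a \<and> \<not> int p dvd x - a then - x else x)"
  have sgc: "sg x = x \<or> sg x = - x" for x by (simp add: sg_def)
  have sgp: "int p dvd sg x - a" if "int p dvd sg x + a" for x
  proof (cases "int p dvd x + a \<and> \<not> int p dvd x - a")
    case True
    hence "sg x + a = - (x - a)" by (simp add: sg_def)
    thus ?thesis using that True by (metis dvd_minus_iff)
  next
    case False
    hence "sg x = x" by (auto simp: sg_def)
    thus ?thesis using that False by metis
  qed
  have 1: "int p dvd x - a" if x: "x \<in> {sg b, sg c, sg d}" "int p dvd x + a" for x
  proof -
    obtain y where "x = sg y" using x(1) by blast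
    thus ?thesis using sgp x(2) by blast
  qed
  have sgs: "f (sg x) + f (- sg x) = f x + f (- x)" for f :: "int \<Rightarrow> complex" and x
    using sgc[of x] by auto
  have sgs': "f (sg x) + (f (- sg x) + y) = f x + (f (- x) + y)" for f :: "int \<Rightarrow> complex" and x y
    using sgs[of f x] by (metis add.assoc)
  define f where "f = (\<lambda>x. if int p dvd x - a then rt M x else 0)"
  have "(\<Sum>x\<leftarrow>filter (\<lambda>x. int p dvd x - a) (symm [a, sg b, sg c, sg d]). rt M x) =
      (\<Sum>x\<leftarrow>filter (\<lambda>x. int p dvd x - a) (symm [a, b, c, d]). rt M x)"
    unfolding sum_list_filter_if f_def[symmetric] symm_def by (simp add: sgs sgs')
  hence 2: "\<dots> = 0 \<Longrightarrow> (\<Sum>x\<leftarrow>filter (\<lambda>x. int p dvd x - a) (symm [a, sg b, sg c, sg d]). rt M x) = 0" by simp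
  have cssg: "cs M (sg x) = cs M x" for x using sgc[of x] by auto
  show ?thesis
    using class_sum_classified_aux[OF p a 1 2[OF cl]] sum by (simp add: cssg)
qed

text \<open>The class of an exponent not divisible by the odd prime \<open>p\<close> is used
  because, unlike class 0, it is not closed under negation.\<close>

lemma class_sums_classified:
  assumes M: "M > 0" and p: "prime p" "odd p" "p dvd M"
    and sp: "p * p dvd M \<or> (\<exists>r0. \<forall>x\<in>set (symm as). \<not> int p dvd x - r0)"
    and len: "length as = 4" and sum: "(\<Sum>a\<leftarrow>as. cs M a) = 0"
    and nd: "\<exists>a\<in>set as. \<not> int p dvd a"
  shows "classified (mset (map (cs M) as))"
proof -
  have s0: "(\<Sum>x\<leftarrow>symm as. rt M x) = 0" using sum by (simp add: sum_rt_symm)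
  note van = class_sums_vanish[OF p(1,3) M s0 sp]
  obtain a where a: "a \<in> set as" "\<not> int p dvd a" using nd by auto
  then obtain bs where bs: "mset as = mset (a # bs)"
    by (metis ex_mset mset.simps(2) multi_member_split set_mset_mset)
  hence "length (a # bs) = 4" using len by (metis mset_eq_length)
  then obtain b c d where b: "bs = [b, c, d]"
    by (auto simp: length_Suc_conv numeral_eq_Suc)
  have m: "mset (map (cs M) as) = {#cs M a, cs M b, cs M c, cs M d#}"
    using arg_cong[OF bs, of "image_mset (cs M)"] by (simp add: b)
  have "sum_list (map (cs M) as) = sum_mset (mset (map (cs M) as))" by (simp only: sum_mset_sum_list)
  hence sum': "cs M a + cs M b + cs M c + cs M d = 0" using sum unfolding m by (simp add: add_ac)
  have ms: "mset (symm as) = mset (symm [a, b, c, d])"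
  proof -
    have "mset (symm xs) = (\<Sum>x\<in>#mset xs. {#x, - x#})" for xs
      by (induction xs) (simp_all add: symm_def)
    thus ?thesis using bs b by simp
  qed
  have "(\<Sum>x\<leftarrow>filter (\<lambda>x. int p dvd x - a) (symm [a, b, c, d]). rt M x) = 
      (\<Sum>x\<leftarrow>filter (\<lambda>x. int p dvd x - a) (symm as). rt M x)"
    by (metis (no_types, lifting) ms mset_filter mset_map sum_mset_sum_list)
  also have "\<dots> = 0" by (rule van)
  finally show ?thesis using class_sum_classified[OF p(1,2) a(2) _ sum'] m by simp
qed

lemma set_symm: "set (symm as) = set as \<union> uminus ` set as"
  by (induction as) (auto simp: symm_def)

lemma cs_cong_dvd_mult:
  assumes "M > 0" "int M dvd n * m" "m dvd x"
  shows "cs M ((n + 1) * x) = cs M x"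
proof (rule cs_cong[OF assms(1)])
  have "(n + 1) * x - x = n * x" by (simp add: algebra_simps)
  thus "int M dvd (n + 1) * x - x" using assms(2,3) by (metis dvd_refl dvd_trans mult_dvd_mono)
qed

lemma in_set_symm: "x \<in> set (symm as) \<longleftrightarrow> x \<in> set as \<or> (\<exists>y\<in>set as. x = - y)"
  by (simp add: set_symm image_iff)

text \<open>Classes up to sign modulo an odd number are represented by \<open>0..h\<close>; used
  with \<open>h = 3\<close> for 7 and \<open>h = 2\<close> for 5.\<close>

lemma fold_mod_eq:
  fixes y r h :: int
  assumes "0 \<le> r" "r \<le> h" "2 * h + 1 dvd y - r \<or> 2 * h + 1 dvd - y - r"
  shows "(if y mod (2 * h + 1) \<le> h then y else - y) mod (2 * h + 1) = r"
proof -
  have r: "r mod (2 * h + 1) = r" using assms(1,2) by simp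
  from assms(3) show ?thesis
  proof
    assume "2 * h + 1 dvd y - r"
    hence "y mod (2 * h + 1) = r" using r by (simp add: mod_eq_dvd_iff[symmetric])
    thus ?thesis using assms(2) by simp
  next
    assume "2 * h + 1 dvd - y - r"
    hence *: "- y mod (2 * h + 1) = r" using r by (simp add: mod_eq_dvd_iff[symmetric])
    show ?thesis
    proof (cases "y mod (2 * h + 1) = 0")
      case True
      thus ?thesis using * assms by (simp add: zmod_zminus1_eq_if)
    next
      case False
      hence "y mod (2 * h + 1) = 2 * h + 1 - r" using * by (simp add: zmod_zminus1_eq_if)
      thus ?thesis using * assms(2) by simp
    qed
  qed
qed

lemma fold_mod_le:
  fixes y h :: int
  assumes "h \<ge> 0"
  shows "(if y mod (2 * h + 1) \<le> h then y else - y) mod (2 * h + 1) \<le> h"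
  using assms by (auto simp: zmod_zminus1_eq_if)

lemma sort4_by_key:
  fixes f :: "'a \<Rightarrow> 'b::linorder"
  assumes "length as = 4"
  obtains a b c d where "mset as = {#a, b, c, d#}" "f a \<le> f b" "f b \<le> f c" "f c \<le> f d"
proof -
  have "length (sort_key f as) = 4" using assms by simp
  moreover obtain bs where bs: "bs = sort_key f as" by simp
  ultimately have "length bs = 4" by simp
  then obtain a b c d where "bs = [a, b, c, d]"
    by (auto simp: length_Suc_conv numeral_eq_Suc)
  hence s: "sort_key f as = [a, b, c, d]" using bs by simp
  have "mset as = mset (sort_key f as)" by simp
  hence "mset as = {#a, b, c, d#}" by (simp add: s)
  moreover have "sorted (map f (sort_key f as))" by simp
  ultimately show ?thesis using that by (simp add: s)
qed

text \<open>
  For \<open>8 dvd M\<close> the conjugation \<open>x \<mapsto> (1 + M div 4) * x\<close> multiplies odd powers by \<open>\<i>\<close> or \<open>- \<i>\<close>, according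
  to the exponent modulo 4.
\<close>

lemma sum_odd_class_mod_4:
  assumes M: "M > 0" "8 dvd M" and xs: "(\<Sum>x\<leftarrow>xs. rt M x) = 0" "\<And>x. x \<in> set xs \<Longrightarrow> odd x"
  shows "(\<Sum>x\<leftarrow>filter (\<lambda>x. 4 dvd x - 1) xs. rt M x) = 0"
proof -
  obtain n where n: "M = 8 * n" using M(2) by auto
  define m where "m = 1 + 2 * int n"
  have "coprime m (int n)" unfolding m_def
    by (rule coprimeI) (metis dvd_add_left_iff dvd_mult)
  moreover have "coprime m (2 ^ 3)" unfolding m_def by (subst coprime_power_right_iff) simp
  ultimately have "coprime m (int M)" unfolding n by simp
  hence 1: "(\<Sum>x\<leftarrow>xs. rt M (m * x)) = 0" by (rule sum_rt_conjugate[OF M(1) _ xs(1)])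
  have n0: "n > 0" using M n by simp
  have i: "rt 4 1 = \<i>" by (simp add: rt_def)
  have "rt M (m * x) = rt M x * (if 4 dvd x - 1 then \<i> else - \<i>)" if "odd x" for x
  proof -
    have "rt M (m * x) = rt M x * rt (2 * n * 4) (int (2 * n) * x)"
      by (simp add: m_def n algebra_simps flip: rt_add)
    also have "rt (2 * n * 4) (int (2 * n) * x) = rt 4 x"
      by (rule rt_mult_cancel) (use n0 in simp)
    also have "rt 4 x = (if 4 dvd x - 1 then \<i> else - \<i>)"
    proof (cases "4 dvd x - 1")
      case True
      thus ?thesis using rt_cong[of 4 x 1] i by simp
    next
      case False
      hence "4 dvd x - (-1)" using that by presburger
      thus ?thesis using rt_cong[of 4 x "-1"] i False by (simp add: rt_minus)
    qed
    finally show ?thesis .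
  qed
  hence "(\<Sum>x\<leftarrow>xs. rt M (m * x)) = (\<Sum>x\<leftarrow>xs. rt M x * (if 4 dvd x - 1 then \<i> else - \<i>))"
    by (intro arg_cong[of _ _ sum_list] map_cong) (use xs(2) in auto)
  \<comment> \<open>The factor is \<open>- \<i>\<close> on the total, corrected by
    \<open>2 * \<i>\<close> on the class of 1.\<close>
  also have "\<dots> = 2 * \<i> * (\<Sum>x\<leftarrow>filter (\<lambda>x. 4 dvd x - 1) xs. rt M x) - \<i> * (\<Sum>x\<leftarrow>xs. rt M x)"
    by (induction xs) (simp_all add: algebra_simps)
  finally show ?thesis using 1 xs(1) by simp
qed

text \<open>As 4 divides \<open>M\<close>, the odd exponents already have vanishing sum. Splitting
  them modulo 4 picks one from each pair \<open>x\<close>, \<open>- x\<close>, which leaves as many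
  unit numbers as there are odd exponents among the four.\<close>

lemma classified_dvd_8:
  assumes M: "M > 0" "8 dvd M" and len: "length as = 4" and sum: "(\<Sum>a\<leftarrow>as. cs M a) = 0"
    and odd: "\<exists>a\<in>set as. odd a"
  shows "classified (mset (map (cs M) as))"
proof -
  obtain a b c d where as: "mset as = {#a, b, c, d#}"
    and sorted: "of_bool (even a) \<le> (of_bool (even b) :: nat)" "of_bool (even b) \<le> (of_bool (even c) :: nat)"
      "of_bool (even c) \<le> (of_bool (even d) :: nat)"
    using sort4_by_key[OF len, of "\<lambda>x. of_bool (even x) :: nat"] by blast
  have m: "mset (map (cs M) as) = {#cs M a, cs M b, cs M c, cs M d#}" using as by simp
  have sum': "cs M a + cs M b + cs M c + cs M d = 0"
    using sum sum_mset_sum_list[of "map (cs M) as"] unfolding m by (simp add: add_ac)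
  have "set as = {a, b, c, d}" using arg_cong[OF as, of set_mset] by simp
  moreover have mono: "even a \<Longrightarrow> even b" "even b \<Longrightarrow> even c" "even c \<Longrightarrow> even d"
    using sorted by (simp_all add: of_bool_def split: if_splits)
  ultimately have a: "odd a" using odd by (metis empty_iff insert_iff)
  have s0: "(\<Sum>x\<leftarrow>symm [a, b, c, d]. rt M x) = 0"
    unfolding sum_rt_symm using sum' by (simp add: add_ac)
  have "2 * 2 dvd M" using M(2) by presburger
  hence van: "(\<Sum>x\<leftarrow>filter (\<lambda>x. int 2 dvd x - 1) (symm [a, b, c, d]). rt M x) = 0"
    using M by (intro class_sums_vanish[OF _ _ M(1) s0]) auto
  define sg where "sg = (\<lambda>x::int. if 4 dvd x - 1 then x else - x)"
  have cssg: "cs M (sg x) = cs M x" for x by (simp add: sg_def)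
  have fil: "filter (\<lambda>x. 4 dvd x - 1) [x, - x] = [sg x]" if "odd x" for x
  proof (cases "4 dvd x - 1")
    case True
    hence "\<not> 4 dvd - x - 1" using that by presburger
    thus ?thesis using True by (simp add: sg_def)
  next
    case False
    hence "4 dvd - x - 1" using that by presburger
    thus ?thesis using False by (simp add: sg_def)
  qed
  have fil4: "filter (\<lambda>x. 4 dvd x - 1) (symm xs) = map sg xs" if "\<forall>x\<in>set xs. odd x" for xs
    using that
  proof (induction xs)
    case (Cons x xs)
    have "filter (\<lambda>x. 4 dvd x - 1) (symm (x # xs)) =
        filter (\<lambda>x. 4 dvd x - 1) [x, - x] @ filter (\<lambda>x. 4 dvd x - 1) (symm xs)"
      by (simp add: symm_def)
    thus ?case using Cons fil by simp
  qed (simp add: symm_def)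
  have odd_symm: "odd x" if "\<forall>x\<in>set xs. odd x" "x \<in> set (symm xs)" for x xs
    using that by (metis Un_iff even_minus imageE set_symm)
  consider "odd b" "odd c" "odd d" | "odd b" "odd c" "even d" | "odd b" "even c" "even d"
    | "even b" "even c" "even d"
    using mono a by blast
  thus ?thesis
  proof cases
    case 1
    hence "rt M (sg a) + rt M (sg b) + rt M (sg c) + rt M (sg d) = 0"
      using sum_odd_class_mod_4[OF M s0 odd_symm[of "[a, b, c, d]"]] a by (simp add: fil4 add.assoc)
    hence "classified {#cs M (sg a), cs M (sg b), cs M (sg c), cs M (sg d)#}"
      by (rule unit_sum4_balanced)
    thus ?thesis unfolding m by (simp add: cssg)
  next
    case 2
    hence "(\<Sum>x\<leftarrow>symm [a, b, c]. rt M x) = 0" using van a by (simp add: symm_def)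
    from sum_odd_class_mod_4[OF M this odd_symm[of "[a, b, c]"]]
    have "rt M (sg a) + rt M (sg b) + rt M (sg c) = 0"
      using 2 a by (simp add: fil4 add.assoc)
    hence "classified {#cs M (sg a), cs M (sg b), cs M (sg c), cs M d#}"
      by (rule unit_sum3_threefold) (use sum' in \<open>simp add: cssg\<close>)
    thus ?thesis unfolding m by (simp add: cssg)
  next
    case 3
    hence "(\<Sum>x\<leftarrow>symm [a, b]. rt M x) = 0" using van a by (simp add: symm_def)
    hence "cs M a + cs M b = 0" unfolding sum_rt_symm by (simp flip: of_real_add)
    thus ?thesis unfolding m by (intro classified_balancedI[OF sum']) auto
  next
    case 4
    hence "rt M a + rt M (- a) = 0" using van a by (simp add: symm_def)
    hence r: "rt M (- a) = - rt M a" by (simp add: eq_neg_iff_add_eq_0 add.commute)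
    \<comment> \<open>A lone odd exponent would make \<open>rt M a\<close> a fourth root of unity;
      then \<open>8 dvd 4 * a\<close>, which contradicts \<open>odd a\<close>.\<close>
    have "rt M a ^ 4 = rt M a ^ 2 * rt M a ^ 2" by (simp flip: power_add)
    also have "\<dots> = (rt M a * rt M (- a)) * (rt M a * rt M (- a))"
      unfolding r by (simp add: power2_eq_square)
    also have "\<dots> = 1" by (simp flip: rt_add)
    finally have "rt M (4 * a) = 1" by (simp add: rt_power)
    hence "int M dvd 4 * a" by (rule rt_eq_1_imp_dvd[OF M(1)])
    moreover have "8 dvd int M" using M(2) by presburger
    ultimately have "8 dvd 4 * a" by (rule dvd_trans[rotated])
    thus ?thesis using a by presburger
  qed
qed

section \<open>The remaining moduli 420, 12 and 60\<close>

lemma unit_eq_cnj: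
  assumes "norm z = 1" "z = cnj z"
  shows "z = 1 \<or> z = -1"
proof -
  have "Im z = 0" using assms(2) by (metis complex_cnj_cancel_iff complex_cnj cancel_comm_monoid_add_class.diff_cancel complex.sel(2) complex_eq_iff cnj.sel(2) equal_neg_zero)
  hence "\<bar>Re z\<bar> = 1" using assms(1) by (simp add: cmod_eq_Re)
  thus ?thesis using \<open>Im z = 0\<close> by (auto simp: complex_eq_iff)
qed

lemma sorted_cover_0_3:
  fixes a b c d :: int
  assumes "a \<le> b" "b \<le> c" "c \<le> d" "d \<le> 3" "\<And>r. r \<in> {0, 1, 2, 3} \<Longrightarrow> r \<in> {a, b, c, d}"
  shows "a = 0 \<and> b = 1 \<and> c = 2 \<and> d = 3"
proof -
  have "0 \<in> {a, b, c, d}" "1 \<in> {a, b, c, d}" "2 \<in> {a, b, c, d}" "3 \<in> {a, b, c, d}"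
    by (rule assms(5), simp)+
  thus ?thesis using assms(1-4) unfolding insert_iff empty_iff by (smt (verit))
qed

text \<open>Four exponents cover the four classes modulo 7 up to sign, so each folded residue 0, 1,
  2, 3 occurs once. Class 0 then contributes a conjugate pair and every other class a single root.
  Equality of the projected sums makes the common value \<open>v\<close> equal to its conjugate,
  hence 1 or -1, and this fixes all four cosines.\<close>

lemma classified_420:
  assumes len: "length as = 4" and sum: "(\<Sum>a\<leftarrow>as. cs 420 a) = 0"
    and cov: "\<And>r. \<exists>x\<in>set (symm as). 7 dvd x - r"
  shows "classified (mset (map (cs 420) as))"
proof -
  define nrm where "nrm = (\<lambda>x::int. if x mod 7 \<le> 3 then x else - x)"
  have nrm: "cs 420 (nrm x) = cs 420 x" for x by (simp add: nrm_def)
  have len': "length (map nrm as) = 4" using len by simp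
  obtain a b c d where as: "mset (map nrm as) = {#a, b, c, d#}"
    and sorted: "a mod 7 \<le> b mod 7" "b mod 7 \<le> c mod 7" "c mod 7 \<le> d mod 7"
    using sort4_by_key[OF len', of "\<lambda>x. x mod 7"] by blast
  have m: "mset (map (cs 420) as) = {#cs 420 a, cs 420 b, cs 420 c, cs 420 d#}"
    using arg_cong[OF as, of "image_mset (cs 420)"] by (simp add: multiset.map_comp o_def nrm)
  have sum': "cs 420 a + cs 420 b + cs 420 c + cs 420 d = 0"
    using sum sum_mset_sum_list[of "map (cs 420) as"] unfolding m by (simp add: add_ac)
  have st: "nrm ` set as = {a, b, c, d}" using arg_cong[OF as, of set_mset] by simp
  have le3: "x mod 7 \<le> 3" if x: "x \<in> {a, b, c, d}" for x
  proof -
    obtain y where "x = nrm y" using x unfolding st[symmetric] by blast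
    thus ?thesis using fold_mod_le[of 3 y] unfolding nrm_def by simp
  qed
  have cov': "\<exists>x\<in>{a, b, c, d}. x mod 7 = r" if "r \<in> {0, 1, 2, 3}" for r
  proof -
    obtain x where x: "x \<in> set (symm as)" "7 dvd x - r" using cov by blast
    then obtain y where y: "y \<in> set as" "x = y \<or> x = - y" unfolding in_set_symm by blast
    have "0 \<le> r \<and> r \<le> 3" using that by auto
    hence "nrm y mod 7 = r" using fold_mod_eq[of r 3 y] y(2) x(2) unfolding nrm_def by auto
    thus ?thesis using y(1) unfolding st[symmetric] by blast
  qed
  have "a mod 7 = 0 \<and> b mod 7 = 1 \<and> c mod 7 = 2 \<and> d mod 7 = 3"
  proof (rule sorted_cover_0_3[OF sorted])
    show "d mod 7 \<le> 3" by (rule le3) simp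
    show "r \<in> {a mod 7, b mod 7, c mod 7, d mod 7}" if "r \<in> {0, 1, 2, 3}" for r
      using cov'[OF that] by blast
  qed
  hence md: "a mod 7 = 0" "b mod 7 = 1" "c mod 7 = 2" "d mod 7 = 3" by simp_all
  hence md': "- a mod 7 = 0" "- b mod 7 = 6" "- c mod 7 = 5" "- d mod 7 = 4" by (simp_all add: zmod_zminus1_eq_if)
  have s0: "(\<Sum>x\<leftarrow>symm [a, b, c, d]. rt 420 x) = 0"
    unfolding sum_rt_symm using sum' by (simp add: add_ac)
  have p7: "prime (7::nat)" by (simp add: prime_nat_numeral_eq)
  have "coprime 7 (60::nat)" by (rule prime_imp_coprime[OF p7]) simp
  \<comment> \<open>301 = 7 * 43 = 5 * 60 + 1 is the idempotent that is 0 modulo 7 and 1 modulo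
    60.\<close>
  from class_sum_prime[OF p7 _ _ this s0, of 301]
  have "7 * (\<Sum>x\<leftarrow>filter (\<lambda>x. x mod 7 = r mod 7) (symm [a, b, c, d]). rt 420 (301 * x)) =
      (\<Sum>x\<leftarrow>symm [a, b, c, d]. rt 420 (301 * x))" for r
    by (simp add: mod_eq_dvd_iff)
  then obtain S where S: "(\<Sum>x\<leftarrow>filter (\<lambda>x. x mod 7 = r mod 7) (symm [a, b, c, d]). rt 420 (301 * x)) = S" for r
    by (metis nonzero_mult_div_cancel_left zero_neq_numeral)
  define v where "v = rt 420 (301 * b)"
  note * = S[unfolded symm_def]
  have v: "v = S" "cnj v = S" using *[of 1] *[of 6] by (simp_all add: md md' v_def rt_minus)
  have "norm v = 1" by (simp add: v_def)
  with v have v1: "v = 1 \<or> v = -1" using unit_eq_cnj by metis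
  have rc: "rt 420 (301 * c) = v" "rt 420 (301 * d) = v" using *[of 2] *[of 3] v by (simp_all add: md md')
  have "rt 420 (301 * a) + rt 420 (301 * (- a)) = S" using *[of 0] by (simp add: md md')
  hence "rt 420 (301 * a) + rt 420 (- (301 * a)) = v" using v by simp
  hence "of_real (2 * cs 420 (301 * a)) = v" by (simp only: rt_plus_rt_minus)
  moreover have "cs 420 (301 * a) = cs 420 a" using cs_cong_dvd_mult[of 420 300 7 a] md by auto
  ultimately have a: "of_real (2 * cs 420 a) = v" by simp
  have dec: "cs 420 x = Re (rt 420 (301 * x) * rt 7 (2 * r))" if "x mod 7 = r mod 7" for x r
  proof -
    \<comment> \<open>421 is 1 modulo 420. The summand \<open>301 * x\<close> is the projected
      exponent; \<open>120 * x\<close> gives the seventh root, as 120 / 420 = 2 / 7.\<close>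
    have "rt 420 x = rt 420 (301 * x + 120 * x)" by (rule rt_cong) (simp, rule dvdI[of _ _ "- x"], simp)
    also have "\<dots> = rt 420 (301 * x) * rt (60 * 7) (int 60 * (2 * x))" unfolding rt_add by simp
    also have "rt (60 * 7) (int 60 * (2 * x)) = rt 7 (2 * x)" by (rule rt_mult_cancel) simp
    also have "rt 7 (2 * x) = rt 7 (2 * r)"
    proof (rule rt_cong)
      have "7 dvd x - r" using that by (simp add: mod_eq_dvd_iff)
      from dvd_mult[OF this, of 2] show "int 7 dvd 2 * x - 2 * r" by simp
    qed simp
    finally show ?thesis by (simp add: cs_def)
  qed
  obtain u :: real where u: "u \<in> {1, -1}" "v = of_real u" using v1 by (metis insertI1 insertI2 of_real_1 of_real_minus)
  have cos7: "cos (8 * pi / 7) = cos (6 * pi / 7)" "cos (12 * pi / 7) = cos (2 * pi / 7)"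
    using cos_2pi_minus[of "6 * pi / 7"] cos_2pi_minus[of "2 * pi / 7"] by simp_all
  have "cs 420 a = u / 2" using a u(2) by (metis of_real_eq_iff nonzero_mult_div_cancel_left zero_neq_numeral)
  hence 1: "cs 420 a = u * cos (pi * (1/3))" by (simp add: cos_60)
  have 2: "cs 420 b = u * cos (pi * (4/7))" using dec[of b 1] md
    unfolding v_def[symmetric] u by (simp add: rt_def mult.commute)
  have 3: "cs 420 c = u * cos (pi * (6/7))" using dec[of c 2] md cos7
    unfolding rc u by (simp add: rt_def mult.commute)
  have 4: "cs 420 d = u * cos (pi * (2/7))" using dec[of d 3] md cos7
    unfolding rc u by (simp add: rt_def mult.commute)
  have "sporadic (mset (map (cs 420) as))"
    unfolding sporadic_def m 1 2 3 4 by (intro bexI[OF _ u(1)] bexI[of _ "[1/3, 2/7, 4/7, 6/7]"])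
      (simp_all add: sporadic_angles_def add_mset_commute)
  thus ?thesis by (simp add: classified_def)
qed

text \<open>The pair \<open>(a, b)\<close> encodes \<open>(a + b * sqrt 3) / 2\<close>; the list covers all cosines of multiples of \<open>pi / 6\<close>.\<close>

definition half_surds :: "(int \<times> int) list" where
  "half_surds = [(2, 0), (0, 1), (1, 0), (0, 0), (-1, 0), (0, -1), (-2, 0)]"

definition half_surd :: "int \<times> int \<Rightarrow> real" where
  "half_surd z = (of_int (fst z) + of_int (snd z) * sqrt 3) / 2"

lemma cs_12_half_surd: "\<exists>z\<in>set half_surds. cs 12 a = half_surd z"
proof -
  have cos150: "cos (5 * pi / 6) = - (sqrt 3 / 2)"
    using cos_pi_minus[of "pi / 6"] cos_30 by simp
  have c: "cs 12 0 = half_surd (2, 0)" "cs 12 1 = half_surd (0, 1)" "cs 12 2 = half_surd (1, 0)"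
      "cs 12 3 = half_surd (0, 0)" "cs 12 4 = half_surd (-1, 0)" "cs 12 5 = half_surd (0, -1)"
      "cs 12 6 = half_surd (-2, 0)"
    using cos_30 cos_60 cos_120' cos150 by (simp_all add: cs_def rt_def half_surd_def mult.commute)
  have "\<exists>n\<in>{0, 1, 2, 3, 4, 5, 6}. 12 dvd a - n \<or> 12 dvd - a - n"
  proof (cases "a mod 12 \<le> 6")
    case True
    hence "a mod 12 \<in> {0, 1, 2, 3, 4, 5, 6}" using pos_mod_sign[of 12 a] by (simp, linarith)
    thus ?thesis by (intro bexI[of _ "a mod 12"]) (simp_all add: minus_mod_eq_mult_div)
  next
    case False
    hence "12 - a mod 12 \<in> {0, 1, 2, 3, 4, 5, 6}" using pos_mod_bound[of 12 a] by (simp, linarith)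
    moreover have "- a - (12 - a mod 12) = 12 * - (a div 12 + 1)"
      using minus_mod_eq_mult_div[of a 12] by (simp add: algebra_simps)
    ultimately show ?thesis by (metis dvd_triv_left)
  qed
  then obtain n where n: "n \<in> {0, 1, 2, 3, 4, 5, 6}" "12 dvd a - n \<or> 12 dvd - a - n" by blast
  have "cs 12 a = cs 12 n"
    using n(2) cs_cong[of 12 a n] cs_cong[of 12 "- a" n] by auto
  thus ?thesis using n(1) c by (auto simp: half_surds_def)
qed

text \<open>Irrationality of \<open>sqrt 3\<close> as a finite check. The bound 4 comes from adding
  four coefficients of size at most 1; with it \<open>p ^ 2\<close> is at most 48, so
  \<open>\<bar>p\<bar>\<close> is at most 7.\<close>

lemma half_surd_unique:
  assumes "of_int p + of_int q * sqrt 3 = 0" "\<bar>q\<bar> \<le> 4"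
  shows "p = 0 \<and> q = 0"
proof -
  have p: "of_int p = - (of_int q * sqrt 3 :: real)" using assms(1) by linarith
  hence "(of_int p :: real)\<^sup>2 = of_int q ^ 2 * 3" by (simp add: power_mult_distrib)
  hence "(of_int (p\<^sup>2) :: real) = of_int (3 * q\<^sup>2)" by simp
  hence sq: "p\<^sup>2 = 3 * q\<^sup>2" by (simp only: of_int_eq_iff)
  have "q\<^sup>2 \<le> 4\<^sup>2" using assms(2) abs_le_square_iff[of q 4] by simp
  hence "p\<^sup>2 \<le> 7\<^sup>2" using sq by simp
  hence p7: "\<bar>p\<bar> \<le> 7" using abs_le_square_iff[of p 7] by simp
  have key: "m = 0 \<and> n = 0"
    if "m * m = 3 * (n * n)" "m \<in> {0, 1, 2, 3, 4, 5, 6, 7}" "n \<in> {0, 1, 2, 3, 4}" for m n :: int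
    using that by auto
  from p7 have "\<bar>p\<bar> \<in> {0, 1, 2, 3, 4, 5, 6, 7}" by auto
  moreover have "\<bar>q\<bar> \<in> {0, 1, 2, 3, 4}" using assms(2) by auto
  moreover have "\<bar>p\<bar> * \<bar>p\<bar> = 3 * (\<bar>q\<bar> * \<bar>q\<bar>)" using sq by (simp add: power2_eq_square)
  ultimately have "\<bar>p\<bar> = 0 \<and> \<bar>q\<bar> = 0" by (intro key)
  thus ?thesis by simp
qed

text \<open>Exhaustive evaluation over integer pairs. The two exceptional lists are the doubled
  values of \<open>threefold\<close> at the angles 0 and \<open>pi\<close>.\<close>

lemma half_surds_sum_zero_check:
  "\<forall>x\<in>set half_surds. \<forall>y\<in>set half_surds. \<forall>z\<in>set half_surds. \<forall>w\<in>set half_surds.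
     fst x + fst y + fst z + fst w = 0 \<longrightarrow> snd x + snd y + snd z + snd w = 0 \<longrightarrow>
     fst x = - fst y \<and> snd x = - snd y \<or> fst x = - fst z \<and> snd x = - snd z \<or>
     fst x = - fst w \<and> snd x = - snd w \<or> fst y = - fst z \<and> snd y = - snd z \<or>
     fst y = - fst w \<and> snd y = - snd w \<or> fst z = - fst w \<and> snd z = - snd w \<or>
     snd x = 0 \<and> snd y = 0 \<and> snd z = 0 \<and> snd w = 0 \<and>
     sort [fst x, fst y, fst z, fst w] \<in> {[-1, -1, 0, 2], [-2, 0, 1, 1]}"
  unfolding half_surds_def by code_simp
lemma classified_12:
  assumes sum: "cs 12 a + cs 12 b + cs 12 c + cs 12 d = 0"
  shows "classified {#cs 12 a, cs 12 b, cs 12 c, cs 12 d#}"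
proof -
  obtain x where x: "x \<in> set half_surds" "cs 12 a = half_surd x" using cs_12_half_surd by blast
  obtain y where y: "y \<in> set half_surds" "cs 12 b = half_surd y" using cs_12_half_surd by blast
  obtain z where z: "z \<in> set half_surds" "cs 12 c = half_surd z" using cs_12_half_surd by blast
  obtain w where w: "w \<in> set half_surds" "cs 12 d = half_surd w" using cs_12_half_surd by blast
  have le1: "\<bar>snd x\<bar> \<le> 1" if "x \<in> set half_surds" for x using that by (auto simp: half_surds_def)
  have "of_int (fst x + fst y + fst z + fst w) + of_int (snd x + snd y + snd z + snd w) * sqrt 3 = 0"
    using sum unfolding x y z w half_surd_def by (simp add: field_simps)
  moreover have "\<bar>snd x + snd y + snd z + snd w\<bar> \<le> 4"
    using le1[OF x(1)] le1[OF y(1)] le1[OF z(1)] le1[OF w(1)] by linarith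
  ultimately have s0: "fst x + fst y + fst z + fst w = 0" "snd x + snd y + snd z + snd w = 0"
    using half_surd_unique by blast+
  have neg: "half_surd p = - half_surd q" if "fst p = - fst q \<and> snd p = - snd q" for p q
    using that by (simp add: half_surd_def algebra_simps)
  have three: "threefold {#half_surd x, half_surd y, half_surd z, half_surd w#}"
    if "snd x = 0 \<and> snd y = 0 \<and> snd z = 0 \<and> snd w = 0"
      "sort [fst x, fst y, fst z, fst w] \<in> {[-1, -1, 0, 2], [-2, 0, 1, 1]}"
  proof -
    have eq: "{#half_surd x, half_surd y, half_surd z, half_surd w#} =
        image_mset (\<lambda>n. of_int n / 2) (mset (sort [fst x, fst y, fst z, fst w]))"
      using that(1) unfolding mset_sort by (simp add: half_surd_def)
    have c: "cos (4 * pi / 3) = - (1 / 2)" "cos (5 * pi / 3) = 1 / 2"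
      using cos_2pi_minus[of "2 * pi / 3"] cos_120 cos_2pi_minus[of "pi / 3"] cos_60 by simp_all
    from that(2) show ?thesis
    proof (elim insertE emptyE)
      assume s: "sort [fst x, fst y, fst z, fst w] = [-1, -1, 0, 2]"
      show ?thesis unfolding threefold_def eq s
        by (rule exI[of _ 0]) (simp add: cos_120 add_mset_commute)
    next
      assume s: "sort [fst x, fst y, fst z, fst w] = [-2, 0, 1, 1]"
      show ?thesis unfolding threefold_def eq s
        by (rule exI[of _ pi]) (use c in \<open>simp add: cos_60 add_mset_commute field_simps\<close>)
    qed
  qed
  from half_surds_sum_zero_check[rule_format, OF x(1) y(1) z(1) w(1) s0]
  consider "half_surd x = - half_surd y \<or> half_surd x = - half_surd z \<or> half_surd x = - half_surd w \<or>
      half_surd y = - half_surd z \<or> half_surd y = - half_surd w \<or> half_surd z = - half_surd w"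
    | "snd x = 0 \<and> snd y = 0 \<and> snd z = 0 \<and> snd w = 0"
      "sort [fst x, fst y, fst z, fst w] \<in> {[-1, -1, 0, 2], [-2, 0, 1, 1]}"
    using neg by blast
  thus ?thesis
  proof cases
    case 1
    thus ?thesis using sum unfolding x y z w by (intro classified_balancedI) auto
  next
    case 2
    from three[OF this] show ?thesis unfolding x y z w classified_def by blast
  qed
qed

text \<open>For the case of two exponents divisible by 5, whose doubled cosines add up to
  \<open>v\<close>. The solutions are the angle pairs 1/2, 1/3 and 0, 2/3 of the sporadic lists, up
  to sign.\<close>

lemma half_surds_pair_check:
  "\<forall>v\<in>{1, -1}. \<forall>x\<in>set half_surds. \<forall>y\<in>set half_surds.
     fst x + fst y = v \<longrightarrow> snd x + snd y = 0 \<longrightarrow>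
     (x, y) \<in> {((v, 0), (0, 0)), ((0, 0), (v, 0)), ((2 * v, 0), (- v, 0)), ((- v, 0), (2 * v, 0))}"
  unfolding half_surds_def by code_simp

lemma sorted_cover_0_2:
  fixes a b c d :: int
  assumes "a \<le> b" "b \<le> c" "c \<le> d" "d \<le> 2" "0 \<le> a" "\<And>r. r \<in> {0, 1, 2} \<Longrightarrow> r \<in> {a, b, c, d}"
  shows "a = 0 \<and> d = 2 \<and> (b = 0 \<and> c = 1 \<or> b = 1 \<and> c = 1 \<or> b = 1 \<and> c = 2)"
proof -
  have "0 \<in> {a, b, c, d}" "1 \<in> {a, b, c, d}" "2 \<in> {a, b, c, d}"
    by (rule assms(6), simp)+
  thus ?thesis using assms(1-5) unfolding insert_iff empty_iff by (smt (verit))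
qed

text \<open>Four exponents cover three classes modulo 5 up to sign, so exactly one folded residue is
  repeated. A nonrepeated nonzero residue shows that the common projected sum \<open>v\<close> is 1
  or -1. A repeated residue 0 leaves two cosines at modulus 12; a repeated 1 or 2 leaves two units
  with sum \<open>v\<close>.\<close>

lemma classified_60:
  assumes len: "length as = 4" and sum: "(\<Sum>a\<leftarrow>as. cs 60 a) = 0"
    and cov: "\<And>r. \<exists>x\<in>set (symm as). 5 dvd x - r"
  shows "classified (mset (map (cs 60) as))"
proof -
  define nrm where "nrm = (\<lambda>x::int. if x mod 5 \<le> 2 then x else - x)"
  have nrm: "cs 60 (nrm x) = cs 60 x" for x by (simp add: nrm_def)
  have len': "length (map nrm as) = 4" using len by simp
  obtain a b c d where as: "mset (map nrm as) = {#a, b, c, d#}"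
    and sorted: "a mod 5 \<le> b mod 5" "b mod 5 \<le> c mod 5" "c mod 5 \<le> d mod 5"
    using sort4_by_key[OF len', of "\<lambda>x. x mod 5"] by blast
  have m: "mset (map (cs 60) as) = {#cs 60 a, cs 60 b, cs 60 c, cs 60 d#}"
    using arg_cong[OF as, of "image_mset (cs 60)"] by (simp add: multiset.map_comp o_def nrm)
  have sum': "cs 60 a + cs 60 b + cs 60 c + cs 60 d = 0"
    using sum sum_mset_sum_list[of "map (cs 60) as"] unfolding m by (simp add: add_ac)
  have st: "nrm ` set as = {a, b, c, d}" using arg_cong[OF as, of set_mset] by simp
  have le2: "x mod 5 \<le> 2" if x: "x \<in> {a, b, c, d}" for x
  proof -
    obtain y where "x = nrm y" using x unfolding st[symmetric] by blast
    thus ?thesis using fold_mod_le[of 2 y] unfolding nrm_def by simp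
  qed
  have cov': "\<exists>x\<in>{a, b, c, d}. x mod 5 = r" if "r \<in> {0, 1, 2}" for r
  proof -
    obtain x where x: "x \<in> set (symm as)" "5 dvd x - r" using cov by blast
    then obtain y where y: "y \<in> set as" "x = y \<or> x = - y" unfolding in_set_symm by blast
    have "0 \<le> r \<and> r \<le> 2" using that by auto
    hence "nrm y mod 5 = r" using fold_mod_eq[of r 2 y] y(2) x(2) unfolding nrm_def by auto
    thus ?thesis using y(1) unfolding st[symmetric] by blast
  qed
  have md: "a mod 5 = 0 \<and> d mod 5 = 2 \<and>
      (b mod 5 = 0 \<and> c mod 5 = 1 \<or> b mod 5 = 1 \<and> c mod 5 = 1 \<or> b mod 5 = 1 \<and> c mod 5 = 2)"
  proof (rule sorted_cover_0_2[OF sorted])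
    show "d mod 5 \<le> 2" by (rule le2) simp
    show "0 \<le> a mod 5" by simp
    show "r \<in> {a mod 5, b mod 5, c mod 5, d mod 5}" if "r \<in> {0, 1, 2}" for r
      using cov'[OF that] by blast
  qed
  have md0: "- x mod 5 = 0" if "x mod 5 = 0" for x :: int using that by (simp add: zmod_zminus1_eq_if)
  have md1: "- x mod 5 = 4" if "x mod 5 = 1" for x :: int using that by (simp add: zmod_zminus1_eq_if)
  have md2: "- x mod 5 = 3" if "x mod 5 = 2" for x :: int using that by (simp add: zmod_zminus1_eq_if)
  have s0: "(\<Sum>x\<leftarrow>symm [a, b, c, d]. rt 60 x) = 0"
    unfolding sum_rt_symm using sum' by (simp add: add_ac)
  have p5: "prime (5::nat)" by (simp add: prime_nat_numeral_eq)
  have "coprime 5 (12::nat)" by (rule prime_imp_coprime[OF p5]) simp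
  \<comment> \<open>25 is 0 modulo 5 and 1 modulo 12.\<close>
  from class_sum_prime[OF p5 _ _ this s0, of 25]
  have "5 * (\<Sum>x\<leftarrow>filter (\<lambda>x. x mod 5 = r mod 5) (symm [a, b, c, d]). rt 60 (25 * x)) =
      (\<Sum>x\<leftarrow>symm [a, b, c, d]. rt 60 (25 * x))" for r
    by (simp add: mod_eq_dvd_iff)
  then obtain v where S: "(\<Sum>x\<leftarrow>filter (\<lambda>x. x mod 5 = r mod 5) (symm [a, b, c, d]). rt 60 (25 * x)) = v" for r
    by (metis nonzero_mult_div_cancel_left zero_neq_numeral)
  note * = S[unfolded symm_def]
  have rl: "\<exists>u\<in>{1, -1}. v = of_real u" if "norm v = 1" "v = cnj v"
    using unit_eq_cnj[OF that] by auto
  have red: "cs 60 (25 * x) = cs 60 x" if "x mod 5 = 0" for x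
    using cs_cong_dvd_mult[of 60 24 5 x] that by auto
  have dec: "cs 60 x = Re (rt 60 (25 * x) * rt 5 (- (2 * r)))" if "x mod 5 = r mod 5" for x r
  proof -
    \<comment> \<open>Subtracting the projected part \<open>25 * x\<close> leaves
      \<open>- 24 * x\<close>, and 24 / 60 = 2 / 5 gives a fifth root.\<close>
    have "rt 60 x = rt 60 (25 * x + 12 * - (2 * x))" by (rule rt_cong) simp_all
    also have "\<dots> = rt 60 (25 * x) * rt (12 * 5) (int 12 * - (2 * x))" unfolding rt_add by simp
    also have "rt (12 * 5) (int 12 * - (2 * x)) = rt 5 (- (2 * x))" by (rule rt_mult_cancel) simp
    also have "rt 5 (- (2 * x)) = rt 5 (- (2 * r))"
    proof (rule rt_cong)
      have "5 dvd x - r" using that by (simp add: mod_eq_dvd_iff)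
      from dvd_mult[OF this, of "-2"] show "int 5 dvd - (2 * x) - - (2 * r)" by (simp add: algebra_simps)
    qed simp
    finally show ?thesis by (simp add: cs_def)
  qed
  have dec': "cs 60 x = Re (rt 60 (25 * x) * rt 5 s)" if "x mod 5 = r mod 5" "s = - (2 * r)" for x r s
    using dec[OF that(1)] that(2) by simp
  have cos5: "Re (rt 5 (- 2)) = cos (pi * (4/5))" "Re (rt 5 (- 4)) = cos (pi * (2/5))"
    using cos_2pi_minus[of "2 * pi / 5"] by (simp_all add: rt_def mult.commute)
  consider "b mod 5 = 0" "c mod 5 = 1" | "b mod 5 = 1" "c mod 5 = 1" | "b mod 5 = 1" "c mod 5 = 2"
    using md by blast
  hence "sporadic (mset (map (cs 60) as))"
  proof cases
    case 1
    note mds = 1 md[THEN conjunct1] md[THEN conjunct2, THEN conjunct1]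
    note mds' = mds mds(1)[THEN md0] mds(3)[THEN md0] mds(2)[THEN md1] mds(4)[THEN md2]
    have v: "rt 60 (25 * c) = v" "cnj (rt 60 (25 * c)) = v" "rt 60 (25 * d) = v"
        "(rt 60 (25 * a) + rt 60 (- (25 * a))) + (rt 60 (25 * b) + rt 60 (- (25 * b))) = v"
      using *[of 1] *[of 4] *[of 2] *[of 0] by (simp_all add: mds' rt_minus add.assoc)
    obtain u where u: "u \<in> {1, -1}" "v = of_real u"
      using rl v by (metis norm_rt)
    have "of_real (2 * cs 60 a + 2 * cs 60 b) = v"
      using v(4) unfolding rt_plus_rt_minus by (simp add: red mds)
    hence ab: "2 * cs 60 a + 2 * cs 60 b = u" unfolding u by (simp only: of_real_eq_iff)
    have c12: "\<exists>z\<in>set half_surds. cs 60 x = half_surd z" if "x mod 5 = 0" for x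
    proof -
      have "cs 60 x = cs (5 * 12) (int 5 * (x div 5))" using that by (simp add: minus_mod_eq_mult_div[symmetric])
      also have "\<dots> = cs 12 (x div 5)" by (rule cs_cancel) simp
      finally show ?thesis using cs_12_half_surd by metis
    qed
    obtain x where x: "x \<in> set half_surds" "cs 60 a = half_surd x" using c12[OF mds(3)] by blast
    obtain y where y: "y \<in> set half_surds" "cs 60 b = half_surd y" using c12[OF mds(1)] by blast
    have le1: "\<bar>snd x\<bar> \<le> 1" if "x \<in> set half_surds" for x using that by (auto simp: half_surds_def)
    obtain t :: int where t: "t \<in> {1, -1}" "u = of_int t" using u(1) by (metis empty_iff insert_iff of_int_1 of_int_minus)
    have "of_int (fst x + fst y - t) + of_int (snd x + snd y) * sqrt 3 = 0"
      using ab unfolding x y half_surd_def t by (simp add: field_simps)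
    moreover have "\<bar>snd x + snd y\<bar> \<le> 4" using le1[OF x(1)] le1[OF y(1)] by linarith
    ultimately have "fst x + fst y - t = 0 \<and> snd x + snd y = 0" by (rule half_surd_unique)
    hence "(x, y) \<in> {((t, 0), (0, 0)), ((0, 0), (t, 0)), ((2 * t, 0), (- t, 0)), ((- t, 0), (2 * t, 0))}"
      using half_surds_pair_check[rule_format, OF t(1) x(1) y(1)] by simp
    hence hs: "{#cs 60 a, cs 60 b#} = {#u * cos (pi * (1/2)), u * cos (pi * (1/3))#} \<or>
        {#cs 60 a, cs 60 b#} = {#u * cos (pi * 0), u * cos (pi * (2/3))#}"
      unfolding x y t half_surd_def by (auto simp: cos_60 cos_120')
    have c: "cs 60 c = u * cos (pi * (4/5))" using dec[of c 1] mds cos5 unfolding v u by simp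
    have d: "cs 60 d = u * cos (pi * (2/5))" using dec[of d 2] mds cos5 unfolding v u by simp
    have split: "{#cs 60 a, cs 60 b, cs 60 c, cs 60 d#} = {#cs 60 a, cs 60 b#} + {#cs 60 c, cs 60 d#}" by simp
    from hs show ?thesis
    proof
      assume h: "{#cs 60 a, cs 60 b#} = {#u * cos (pi * (1/2)), u * cos (pi * (1/3))#}"
      show ?thesis unfolding sporadic_def m unfolding split unfolding h c d
        by (intro bexI[OF _ u(1)] bexI[of _ "[1/2, 1/3, 2/5, 4/5]"]) (simp_all add: sporadic_angles_def add_mset_commute)
    next
      assume h: "{#cs 60 a, cs 60 b#} = {#u * cos (pi * 0), u * cos (pi * (2/3))#}"
      show ?thesis unfolding sporadic_def m unfolding split unfolding h c d
        by (intro bexI[OF _ u(1)] bexI[of _ "[0, 2/3, 2/5, 4/5]"]) (simp_all add: sporadic_angles_def add_mset_commute)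
    qed
  next
    case 2
    note mds = 2 md[THEN conjunct1] md[THEN conjunct2, THEN conjunct1]
    note mds' = mds mds(1)[THEN md1] mds(2)[THEN md1] mds(3)[THEN md0] mds(4)[THEN md2]
    have v: "rt 60 (25 * d) = v" "cnj (rt 60 (25 * d)) = v" 
        "rt 60 (25 * a) + rt 60 (- (25 * a)) = v" "rt 60 (25 * b) + rt 60 (25 * c) = v"
      using *[of 1] *[of 3] *[of 2] *[of 0] by (simp_all add: mds' rt_minus)
    obtain u where u: "u \<in> {1, -1}" "v = of_real u"
      using rl v by (metis norm_rt)
    have "of_real (2 * cs 60 a) = v"
      using v(3) unfolding rt_plus_rt_minus by (simp add: red mds)
    hence "2 * cs 60 a = u" unfolding u by (simp only: of_real_eq_iff)
    hence a: "cs 60 a = u * cos (pi * (1/3))" by (simp add: cos_60)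
    have d: "cs 60 d = u * cos (pi * (2/5))" using dec[of d 2] mds cos5 unfolding v u by simp
    have "norm (- v) = 1" using v(1) by (metis norm_minus_cancel norm_rt)
    \<comment> \<open>Two units with unit sum \<open>v\<close> form an equilateral triangle with
      \<open>- v\<close>. The turns by a third, combined with fifths, produce the angles in
      fifteenths.\<close>
    moreover have "- v + rt 60 (25 * b) + rt 60 (25 * c) = 0" unfolding v(4)[symmetric] by simp
    ultimately have bc: "rt 60 (25 * b) = - v * cis (2 * pi / 3) \<and> rt 60 (25 * c) = - v * cis (- (2 * pi / 3)) \<or>
        rt 60 (25 * b) = - v * cis (- (2 * pi / 3)) \<and> rt 60 (25 * c) = - v * cis (2 * pi / 3)"
      by (intro unit_sum3) simp_all
    have 1: "Re (- v * cis (2 * pi / 3) * rt 5 (- 2)) = u * cos (pi * (13/15))"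
      using cos_pi_minus[of "2 * pi / 15"] cos_minus[of "2 * pi / 15"]
      by (simp add: u rt_def mult.assoc cis_mult) (simp add: field_simps)
    have 2: "Re (- v * cis (- (2 * pi / 3)) * rt 5 (- 2)) = u * cos (pi * (7/15))"
      using cos_minus_pi[of "22 * pi / 15"] cos_minus[of "22 * pi / 15"]
      by (simp add: u rt_def mult.assoc cis_mult) (simp add: field_simps)
    have hs: "{#cs 60 b, cs 60 c#} = {#u * cos (pi * (13/15)), u * cos (pi * (7/15))#}"
    proof -
      have b': "cs 60 b = Re (rt 60 (25 * b) * rt 5 (- 2))" by (rule dec'[of b 1]) (simp_all add: mds)
      have c': "cs 60 c = Re (rt 60 (25 * c) * rt 5 (- 2))" by (rule dec'[of c 1]) (simp_all add: mds)
      from bc show ?thesis by (elim disjE conjE) (simp_all only: b' c' 1 2 add_mset_commute)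
    qed
    have split: "{#cs 60 a, cs 60 b, cs 60 c, cs 60 d#} = {#cs 60 b, cs 60 c#} + {#cs 60 a, cs 60 d#}" by simp
    show ?thesis unfolding sporadic_def m unfolding split unfolding hs a d
      by (intro bexI[OF _ u(1)] bexI[of _ "[1/3, 2/5, 13/15, 7/15]"]) (simp_all add: sporadic_angles_def add_mset_commute)
  next
    case 3
    note mds = 3 md[THEN conjunct1] md[THEN conjunct2, THEN conjunct1]
    note mds' = mds mds(1)[THEN md1] mds(2)[THEN md2] mds(3)[THEN md0] mds(4)[THEN md2]
    have v: "rt 60 (25 * b) = v" "cnj (rt 60 (25 * b)) = v" 
        "rt 60 (25 * a) + rt 60 (- (25 * a)) = v" "rt 60 (25 * c) + rt 60 (25 * d) = v"
      using *[of 1] *[of 4] *[of 2] *[of 0] by (simp_all add: mds' rt_minus)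
    obtain u where u: "u \<in> {1, -1}" "v = of_real u"
      using rl v by (metis norm_rt)
    have "of_real (2 * cs 60 a) = v"
      using v(3) unfolding rt_plus_rt_minus by (simp add: red mds)
    hence "2 * cs 60 a = u" unfolding u by (simp only: of_real_eq_iff)
    hence a: "cs 60 a = u * cos (pi * (1/3))" by (simp add: cos_60)
    have b: "cs 60 b = u * cos (pi * (4/5))" using dec[of b 1] mds cos5 unfolding v u by simp
    have "norm (- v) = 1" using v(1) by (metis norm_minus_cancel norm_rt)
    moreover have "- v + rt 60 (25 * c) + rt 60 (25 * d) = 0" unfolding v(4)[symmetric] by simp
    ultimately have cd: "rt 60 (25 * c) = - v * cis (2 * pi / 3) \<and> rt 60 (25 * d) = - v * cis (- (2 * pi / 3)) \<or>
        rt 60 (25 * c) = - v * cis (- (2 * pi / 3)) \<and> rt 60 (25 * d) = - v * cis (2 * pi / 3)"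
      by (intro unit_sum3) simp_all
    have 1: "Re (- v * cis (2 * pi / 3) * rt 5 (- 4)) = u * cos (pi * (1/15))"
      using cos_pi_minus[of "14 * pi / 15"] cos_minus[of "14 * pi / 15"]
      by (simp add: u rt_def mult.assoc cis_mult)
    have 2: "Re (- v * cis (- (2 * pi / 3)) * rt 5 (- 4)) = u * cos (pi * (11/15))"
      using cos_2pi_minus[of "34 * pi / 15"] cos_minus[of "34 * pi / 15"] cos_minus[of "4 * pi / 15"]
        cos_pi_minus[of "4 * pi / 15"]
      by (simp add: u rt_def mult.assoc cis_mult) (simp add: field_simps)
    have hs: "{#cs 60 c, cs 60 d#} = {#u * cos (pi * (11/15)), u * cos (pi * (1/15))#}"
    proof -
      have c': "cs 60 c = Re (rt 60 (25 * c) * rt 5 (- 4))" by (rule dec'[of c 2]) (simp_all add: mds)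
      have d': "cs 60 d = Re (rt 60 (25 * d) * rt 5 (- 4))" by (rule dec'[of d 2]) (simp_all add: mds)
      from cd show ?thesis by (elim disjE conjE) (simp_all only: c' d' 1 2 add_mset_commute)
    qed
    have split: "{#cs 60 a, cs 60 b, cs 60 c, cs 60 d#} = {#cs 60 c, cs 60 d#} + {#cs 60 a, cs 60 b#}" by simp
    show ?thesis unfolding sporadic_def m unfolding split unfolding hs a b
      by (intro bexI[OF _ u(1)] bexI[of _ "[1/3, 4/5, 11/15, 1/15]"]) (simp_all add: sporadic_angles_def add_mset_commute)
  qed
  thus ?thesis by (simp add: classified_def)
qed

section \<open>Reduction of an arbitrary modulus\<close>

lemma map_cs_scale:
  assumes "d > 0" "\<forall>a\<in>set as. int d dvd a"
  shows "map (cs (d * M)) as = map (cs M) (map (\<lambda>a. a div int d) as)"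
proof -
  have "cs (d * M) a = cs M (a div int d)" if "a \<in> set as" for a
  proof -
    have "cs (d * M) (int d * (a div int d)) = cs M (a div int d)" using assms(1) by (rule cs_cancel)
    thus ?thesis using assms(2) that by simp
  qed
  thus ?thesis by simp
qed

text \<open>Pigeonhole: \<open>symm as\<close> has eight entries, and 11 is the first prime above
  eight.\<close>

lemma exists_uncovered_class:
  assumes "length as = 4" "p \<ge> 11"
  shows "\<exists>r0. \<forall>x\<in>set (symm as). \<not> int p dvd x - r0"
proof (rule ccontr)
  assume "\<not> ?thesis"
  hence c: "\<And>r. \<exists>x\<in>set (symm as). int p dvd x - r" by blast
  have "{0..<int p} \<subseteq> (\<lambda>x. x mod int p) ` set (symm as)"
  proof
    fix r assume r: "r \<in> {0..<int p}"
    obtain x where "x \<in> set (symm as)" "int p dvd x - r" using c by blast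
    moreover from this(2) have "x mod int p = r mod int p" by (simp add: mod_eq_dvd_iff)
    ultimately show "r \<in> (\<lambda>x. x mod int p) ` set (symm as)" using r by force
  qed
  hence "card {0..<int p} \<le> card (set (symm as))"
    by (rule surj_card_le[rotated]) simp
  also have "\<dots> \<le> length (symm as)" by (rule card_length)
  also have "length (symm as) = 8" using assms(1) by (simp add: symm_def length_concat o_def sum_list_triv)
  finally show False using assms(2) by simp
qed

lemma classified_dvd_60:
  assumes len: "length as = 4" and sum: "(\<Sum>a\<leftarrow>as. cs 60 a) = 0"
  shows "classified (mset (map (cs 60) as))"
proof (cases "\<forall>a\<in>set as. int 5 dvd a")
  case True
  define bs where "bs = map (\<lambda>a. a div int 5) as"
  have eq: "map (cs 60) as = map (cs 12) bs" using map_cs_scale[of 5 as 12] True by (simp add: bs_def)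
  have "length bs = 4" using len by (simp add: bs_def)
  then obtain a b c d where bs: "bs = [a, b, c, d]" by (auto simp: length_Suc_conv numeral_eq_Suc)
  show ?thesis using sum classified_12[of a b c d] unfolding eq bs by (simp add: add.assoc)
next
  case False
  show ?thesis
  proof (cases "\<exists>r0. \<forall>x\<in>set (symm as). \<not> int 5 dvd x - r0")
    case True
    show ?thesis by (rule class_sums_classified[of 60 5]) (use True False len sum in \<open>auto simp: prime_nat_numeral_eq\<close>)
  next
    case F: False
    show ?thesis by (rule classified_60[OF len sum]) (use F in simp)
  qed
qed

lemma classified_dvd_420:
  assumes len: "length as = 4" and sum: "(\<Sum>a\<leftarrow>as. cs 420 a) = 0"
  shows "classified (mset (map (cs 420) as))"
proof (cases "\<forall>a\<in>set as. int 7 dvd a")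
  case True
  define bs where "bs = map (\<lambda>a. a div int 7) as"
  have eq: "map (cs 420) as = map (cs 60) bs" using map_cs_scale[of 7 as 60] True by (simp add: bs_def)
  show ?thesis unfolding eq by (rule classified_dvd_60) (use sum[unfolded eq] len in \<open>simp_all add: bs_def\<close>)
next
  case False
  show ?thesis
  proof (cases "\<exists>r0. \<forall>x\<in>set (symm as). \<not> int 7 dvd x - r0")
    case True
    show ?thesis by (rule class_sums_classified[of 420 7]) (use True False len sum in \<open>auto simp: prime_nat_numeral_eq\<close>)
  next
    case F: False
    show ?thesis by (rule classified_420[OF len sum]) (use F in simp)
  qed
qed

lemma dvd_420_if:
  fixes M :: nat
  assumes M: "M > 0" "\<not> 8 dvd M"
    and p: "\<And>p. prime p \<Longrightarrow> odd p \<Longrightarrow> p dvd M \<Longrightarrow> \<not> p * p dvd M \<and> p < 11"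
  shows "M dvd 420"
proof (rule multiplicity_le_imp_dvd)
  fix q :: nat assume q: "prime q"
  show "multiplicity q M \<le> multiplicity q 420"
  proof (cases "q dvd M")
    case False
    thus ?thesis by (simp add: not_dvd_imp_multiplicity_0)
  next
    case True
    show ?thesis
    proof (cases "q = 2")
      case 2: True
      have "\<not> 2 ^ 3 dvd M" using M(2) by simp
      hence "multiplicity 2 M < 3" using M(1) by (metis multiplicity_dvd' not_less)
      moreover have "multiplicity 2 (420::nat) \<ge> 2" by (rule multiplicity_geI) auto
      ultimately show ?thesis using 2 by simp
    next
      case False
      hence odd: "odd q" using q by (metis primes_dvd_imp_eq two_is_prime_nat)
      hence q11: "\<not> q ^ 2 dvd M" "q < 11" using p[OF q odd True] by (simp_all add: power2_eq_square)
      hence "multiplicity q M < 2" using M(1) by (metis multiplicity_dvd' not_less)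
      moreover have "multiplicity q 420 \<ge> 1"
      proof (rule multiplicity_geI)
        have "q = 3 \<or> q = 5 \<or> q = 7 \<or> q = 9"
          using q11(2) odd prime_gt_1_nat[OF q] by presburger
        moreover have "\<not> prime (9::nat)" by (simp add: prime_nat_numeral_eq)
        ultimately show "q ^ 1 dvd 420" using q by auto
      qed (use q in \<open>auto simp: prime_gt_1_nat\<close>)
      ultimately show ?thesis by simp
    qed
  qed
qed (use M in auto)

text \<open>Induction on the modulus: exponents with a common prime factor dividing \<open>M\<close>
  are divided by it; otherwise the class arguments apply directly.\<close>

lemma classified_cos:
  assumes "M > 0" "length as = 4" "(\<Sum>a\<leftarrow>as. cs M a) = 0"
  shows "classified (mset (map (cs M) as))"
  using assms
proof (induction M arbitrary: as rule: less_induct)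
  case (less M)
  have scale: "classified (mset (map (cs M) as))"
    if d: "d > 1" "d dvd M" "\<forall>a\<in>set as. int d dvd a" for d
  proof -
    obtain M' where M': "M = d * M'" using d(2) by auto
    have M'0: "M' > 0" "M' < M" using M' less.prems(1) d(1) by auto
    have eq: "map (cs M) as = map (cs M') (map (\<lambda>a. a div int d) as)"
      unfolding M' by (rule map_cs_scale) (use d in auto)
    show ?thesis unfolding eq
      by (rule less.IH[OF M'0(2,1)]) (use less.prems eq in simp_all)
  qed
  consider p where "prime p" "odd p" "p dvd M" "p * p dvd M \<or> 11 \<le> p" | "8 dvd M" | "M dvd 420"
    using dvd_420_if[OF less.prems(1)] by (metis not_le)
  thus ?case
  proof cases
    case (1 p)
    show ?thesis
    proof (cases "\<forall>a\<in>set as. int p dvd a")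
      case True
      thus ?thesis using scale[of p] 1 prime_gt_1_nat by blast
    next
      case False
      have "p * p dvd M \<or> (\<exists>r0. \<forall>x\<in>set (symm as). \<not> int p dvd x - r0)"
        using 1(4) exists_uncovered_class[OF less.prems(2)] by blast
      from class_sums_classified[OF less.prems(1) 1(1-3) this less.prems(2,3)] False
      show ?thesis by blast
    qed
  next
    case 2
    show ?thesis
    proof (cases "\<forall>a\<in>set as. int 2 dvd a")
      case True
      thus ?thesis using scale[of 2] 2 by (metis dvd_trans even_numeral one_less_numeral_iff semiring_norm(76))
    next
      case False
      thus ?thesis using classified_dvd_8[OF less.prems(1) 2 less.prems(2,3)] by simp
    qed
  next
    case 3
    \<comment> \<open>Scaling up instead of down puts all divisors of 420 into one case.\<close>
    then obtain d where d: "420 = d * M" by (metis dvdE mult.commute)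
    have d0: "d > 0" using d by (cases d) auto
    have "cs 420 (int d * a) = cs M a" for a unfolding d by (rule cs_cancel[OF d0])
    hence eq: "map (cs M) as = map (cs 420) (map (\<lambda>a. int d * a) as)" by simp
    show ?thesis unfolding eq
      by (rule classified_dvd_420) (use less.prems(2) less.prems(3)[unfolded eq] in simp_all)
  qed
qed

section \<open>Overlaps as sine equations\<close>

definition sn :: "nat \<Rightarrow> nat \<Rightarrow> real" where
  "sn k n = sin (pi * real n / real k)"

lemma phi_power: "phi k ^ n = rt k (int n)"
proof -
  have "phi k = rt k 1"
    by (simp add: phi_def rt_def cis_conv_exp mult_ac)
  thus ?thesis by (simp add: rt_power)
qed

lemma phi_powi: "phi k powi n = rt k n"
proof (cases "n \<ge> 0")
  case True
  thus ?thesis by (simp add: power_int_def phi_power)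
next
  case False
  have "rt k (- n) * rt k n = 1" by (simp flip: rt_add)
  hence "inverse (rt k (- n)) = rt k n" by (metis inverse_unique)
  thus ?thesis using False by (simp add: power_int_def power_inverse phi_power)
qed

lemma rt_minus_1:
  assumes "k > 0"
  shows "rt k (int n) - 1 = rt (2 * k) (int n) * (2 * \<i> * of_real (sn k n))"
proof -
  have "rt k (int n) = rt (2 * k) (int 2 * int n)" by (rule rt_mult_cancel[symmetric]) simp
  also have "\<dots> = rt (2 * k) (int n) * rt (2 * k) (int n)" by (simp flip: rt_add)
  finally have "rt k (int n) - 1 = rt (2 * k) (int n) * (rt (2 * k) (int n) - rt (2 * k) (- int n))"
    by (simp add: algebra_simps flip: rt_add)
  also have "rt (2 * k) (int n) - rt (2 * k) (- int n) = 2 * \<i> * of_real (sn k n)"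
    by (simp add: rt_minus complex_eq_iff) (simp add: rt_def sn_def)
  finally show ?thesis .
qed

lemma sn_pos: "n \<in> kset k \<Longrightarrow> sn k n > 0"
proof -
  assume "n \<in> kset k"
  hence "0 < real n" "real n < real k" by (auto simp: kset_def)
  thus ?thesis unfolding sn_def by (intro sin_gt_zero) (simp_all add: pos_divide_less_eq)
qed

lemma overlap_imp_sn_eq:
  assumes k: "k > 0" and "is_overlap k (i, j, s, t)"
  shows "sn k i * sn k t = sn k j * sn k s"
proof -
  have ks: "i \<in> kset k" "j \<in> kset k" "s \<in> kset k" "t \<in> kset k"
    using assms by (auto simp: is_overlap_def)
  obtain w where "phi k ^ w * (phi k ^ j - 1) * (phi k ^ s - 1) = (phi k ^ i - 1) * (phi k ^ t - 1)"
    using assms by (auto simp: is_overlap_def)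
  hence "norm (phi k ^ w * (phi k ^ j - 1) * (phi k ^ s - 1)) = norm ((phi k ^ i - 1) * (phi k ^ t - 1))" by simp
  hence "\<bar>sn k j * sn k s\<bar> = \<bar>sn k i * sn k t\<bar>"
    by (simp add: phi_power rt_minus_1[OF k] norm_mult abs_mult)
  thus ?thesis using ks[THEN sn_pos] by (simp add: abs_mult)
qed

text \<open>The half-angle factors of the two sides differ by \<open>rt (2 * k)\<close> at
  \<open>t + i - s - j\<close>; halving this even exponent gives the power of
  \<open>phi k\<close>.\<close>

lemma phi_sn_identity:
  assumes k: "k > 0" and sn: "sn k i * sn k t = sn k j * sn k s"
    and w: "2 * w = (int t + int i) - (int s + int j)"
  shows "phi k powi w * (phi k ^ j - 1) * (phi k ^ s - 1) = (phi k ^ i - 1) * (phi k ^ t - 1)"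
proof -
  have "rt k w = rt (2 * k) (int 2 * w)" by (rule rt_mult_cancel[symmetric]) simp
  also have "int 2 * w = (int t + int i) + (- int s + - int j)" using w by simp
  finally have rw: "rt k w = rt (2 * k) ((int t + int i) + (- int s + - int j))" .
  have c: "rt (2 * k) (- x) * rt (2 * k) x = 1" for x by (simp flip: rt_add)
  have "phi k powi w * (phi k ^ j - 1) * (phi k ^ s - 1) =
      rt (2 * k) (int t) * rt (2 * k) (int i) * (rt (2 * k) (- int s) * rt (2 * k) (int s)) *
      (rt (2 * k) (- int j) * rt (2 * k) (int j)) * (2 * \<i>)\<^sup>2 * of_real (sn k j * sn k s)"
    unfolding phi_power phi_powi rt_minus_1[OF k] rw rt_add
    by (simp only: power2_eq_square of_real_mult mult.assoc mult.commute mult.left_commute)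
  also have "\<dots> = (phi k ^ i - 1) * (phi k ^ t - 1)"
    unfolding c sn[symmetric] phi_power rt_minus_1[OF k]
    by (simp only: power2_eq_square of_real_mult mult.assoc mult.commute mult.left_commute mult_1)
  finally show ?thesis .
qed

lemma congpm_kset:
  assumes "a \<in> kset k" "b \<in> kset k"
  shows "congpm k a b \<longleftrightarrow> a = b \<or> a + b = k"
proof -
  have "(a + b) mod k = 0 \<longleftrightarrow> a + b = k"
  proof
    assume "(a + b) mod k = 0"
    then obtain c where c: "a + b = k * c" by auto
    have "0 < a + b" "a + b < k * 2" using assms by (auto simp: kset_def)
    hence "c = 1" using c by (metis One_nat_def Suc_1 less_Suc_eq less_one mult_0_right mult_less_cancel1 nat_neq_iff)
    thus "a + b = k" using c by simp
  qed simp
  thus ?thesis using assms by (auto simp: congpm_def kset_def)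
qed

definition apart :: "nat \<Rightarrow> nat \<Rightarrow> nat \<Rightarrow> bool" where
  "apart k a b \<longleftrightarrow> a \<noteq> b \<and> a + b \<noteq> k"

lemma apart_commute: "apart k a b \<longleftrightarrow> apart k b a"
  by (auto simp: apart_def)

lemma apart_compl: "a \<le> k \<Longrightarrow> apart k (k - a) b \<longleftrightarrow> apart k a b"
  unfolding apart_def by (metis add_diff_cancel_right' le_add_diff_inverse add.commute add_left_cancel)

text \<open>Nontrivial overlaps with the parity condition dropped. This is the notion that gets
  classified; \<open>i \<noteq> s\<close> is part of \<open>apart k s i\<close>.\<close>

definition sine_quad :: "nat \<Rightarrow> quad \<Rightarrow> bool" where
  "sine_quad k q = (case q of (i, j, s, t) \<Rightarrow>
     i \<in> kset k \<and> j \<in> kset k \<and> s \<in> kset k \<and> t \<in> kset k \<and>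
     apart k i j \<and> apart k j t \<and> apart k t s \<and> apart k s i \<and>
     sn k i * sn k t = sn k j * sn k s)"

lemma Ovl_imp_sine_quad:
  assumes "k > 0" "q \<in> Ovl k"
  shows "sine_quad k q"
proof -
  obtain i j s t where q: "q = (i, j, s, t)" by (cases q)
  have ov: "is_overlap k (i, j, s, t)" "\<not> is_trivial k (i, j, s, t)" using assms by (auto simp: Ovl_def q)
  hence ks: "i \<in> kset k" "j \<in> kset k" "s \<in> kset k" "t \<in> kset k"
    by (auto simp: is_overlap_def)
  show ?thesis using ov(2) ks overlap_imp_sn_eq[OF assms(1) ov(1)]
    by (simp add: sine_quad_def q is_trivial_def congpm_kset apart_def)
qed

lemma sine_quad_imp_Ovl:
  assumes k: "k > 0" and q: "sine_quad k (i, j, s, t)" and ev: "even (i + j + s + t)"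
  shows "(i, j, s, t) \<in> Ovl k"
proof -
  have ks: "i \<in> kset k" "j \<in> kset k" "s \<in> kset k" "t \<in> kset k" and sn: "sn k i * sn k t = sn k j * sn k s"
    and nt: "i \<noteq> s"
    using q by (auto simp: sine_quad_def apart_def)
  have "\<not> is_trivial k (i, j, s, t)" using q by (simp add: sine_quad_def is_trivial_def congpm_kset apart_def)
  moreover have "even ((int t + int i) - (int s + int j))"
  proof -
    have "even (int (i + j + s + t))" using ev by simp
    moreover have "(int t + int i) - (int s + int j) = int (i + j + s + t) - 2 * (int s + int j)" by simp
    ultimately show ?thesis by (metis dvd_diff dvd_triv_left)
  qed
  then obtain w where "(int t + int i) - (int s + int j) = 2 * w" by (elim evenE)
  hence w: "phi k powi w * (phi k ^ j - 1) * (phi k ^ s - 1) = (phi k ^ i - 1) * (phi k ^ t - 1)"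
    using phi_sn_identity[OF k sn, of w] by simp
  define n where "n = nat (w mod int k)"
  have n: "int n = w mod int k" "n < k" using k by (simp_all add: n_def nat_less_iff)
  have "phi k ^ n = phi k powi w"
    unfolding phi_power phi_powi n by (rule rt_cong[OF k]) (metis mod_eq_dvd_iff mod_mod_trivial)
  hence "\<exists>n\<in>{0..<k}. phi k ^ n * (phi k ^ j - 1) * (phi k ^ s - 1) = (phi k ^ i - 1) * (phi k ^ t - 1)"
    using w n(2) by (intro bexI[of _ n]) auto
  ultimately show ?thesis using ks nt by (simp add: Ovl_def is_overlap_def)
qed

lemma sn_compl: "n \<in> kset k \<Longrightarrow> sn k (k - n) = sn k n"
proof -
  assume "n \<in> kset k"
  hence "pi * real (k - n) / real k = pi - pi * real n / real k"
    by (auto simp: kset_def field_simps of_nat_diff)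
  thus ?thesis by (simp add: sn_def)
qed

lemma kset_compl: "n \<in> kset k \<Longrightarrow> k - n \<in> kset k"
  by (auto simp: kset_def)

section \<open>Invariance under the symmetry group\<close>

definition quad_sum :: "quad \<Rightarrow> nat" where
  "quad_sum q = (case q of (i, j, s, t) \<Rightarrow> i + j + s + t)"

text \<open>Parity survives because \<open>u\<close> and \<open>k - u\<close> agree modulo 2 for
  even \<open>k\<close>. Involutivity allows orbit membership to be pulled back along a
  generator.\<close>

lemma G0_gens_sine_quad:
  assumes g: "g \<in> G0_gens k" and q: "sine_quad k q" and k: "even k"
  shows "sine_quad k (g q)" "g (g q) = q" "even (quad_sum (g q)) = even (quad_sum q)"
proof -
  obtain i j s t where qeq [simp]: "q = (i, j, s, t)" by (cases q)
  have ev: "even (k - x) \<longleftrightarrow> even x" if "x < k" for x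
    using that k by (simp add: even_diff_nat)
  have ks: "i \<in> kset k" "j \<in> kset k" "s \<in> kset k" "t \<in> kset k" using q by (auto simp: sine_quad_def)
  note kc = ks[THEN kset_compl] and sc = ks[THEN sn_compl]
  have lt: "i < k" "j < k" "s < k" "t < k" using ks by (auto simp: kset_def)
  have ap: "apart k (k - x) y = apart k x y" "apart k y (k - x) = apart k y x" if "x < k" for x y
    using that apart_compl[of x k y] apart_commute by auto
  show "sine_quad k (g q)"
    using g q unfolding G0_gens_def
    by (elim insertE emptyE) (simp_all add: sine_quad_def kc sc ap lt mult.commute apart_commute)
  show "g (g q) = q"
    using g unfolding G0_gens_def by (elim insertE emptyE) (simp_all add: lt less_imp_le)
  show "even (quad_sum (g q)) = even (quad_sum q)"
    using g unfolding G0_gens_def qeq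
    by (elim insertE emptyE; cases "even i"; cases "even j"; cases "even s"; cases "even t";
        simp only: quad_sum_def split_conv even_add lt[THEN ev] simp_thms)
qed

lemma G0_sine_quad:
  assumes "f \<in> G0 k" "sine_quad k q" "even k"
  shows "sine_quad k (f q) \<and> even (quad_sum (f q)) = even (quad_sum q)"
  using assms
proof (induction f rule: G0.induct)
  case G0_id
  thus ?case by simp
next
  case (G0_step g f)
  thus ?case using G0_gens_sine_quad[of g k "f q"] by simp
qed

lemma G0_orbit_gen: "g \<in> G0_gens k \<Longrightarrow> p \<in> G0_orbit k q \<Longrightarrow> g p \<in> G0_orbit k q"
  unfolding G0_orbit_def mem_Collect_eq using G0_step by (metis comp_apply)

lemma G0_orbit_refl: "q \<in> G0_orbit k q"
  unfolding G0_orbit_def using G0_id by (metis (mono_tags, lifting) id_apply mem_Collect_eq)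

section \<open>From cosine sums back to quadruples\<close>

lemma sn_mult_sn: "sn k a * sn k b = (cs (2 * k) (int b - int a) - cs (2 * k) (int b + int a)) / 2"
proof -
  have "sn k b * sn k a = (cos (pi * real b / real k - pi * real a / real k) -
      cos (pi * real b / real k + pi * real a / real k)) / 2"
    unfolding sn_def by (rule sin_times_sin)
  also have "pi * real b / real k - pi * real a / real k = 2 * pi * of_int (int b - int a) / of_nat (2 * k)"
    by (simp add: algebra_simps diff_divide_distrib)
  also have "pi * real b / real k + pi * real a / real k = 2 * pi * of_int (int b + int a) / of_nat (2 * k)"
    by (simp add: algebra_simps add_divide_distrib)
  finally show ?thesis by (simp add: cs_def Re_rt mult.commute)
qed

lemma cs_half: "cs (2 * k) x = cos (pi * (of_int x / real k))"
  by (simp add: cs_def Re_rt)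

lemma cs_reflect: "k > 0 \<Longrightarrow> cs (2 * k) (int k - x) = - cs (2 * k) x"
proof -
  assume "k > 0"
  hence "pi * (of_int (int k - x) / real k) = pi - pi * (of_int x / real k)"
    by (simp add: diff_divide_distrib right_diff_distrib)
  thus ?thesis by (simp add: cs_half)
qed

section \<open>Recovering angles from their cosines\<close>

lemma balanced_cases:
  assumes "balanced {#a, b, c, d#}"
  shows "b = - a \<or> c = - a \<or> d = - a"
proof -
  obtain x y where eq: "{#a, b, c, d#} = {#x, - x, y, - y#}" using assms balanced_def by blast
  have neg: "- a \<in># {#x, - x, y, - y#} - {#a#}"
  proof -
    have "a \<in># {#x, - x, y, - y#}" using eq by (metis union_single_eq_member)
    hence "a = x \<or> a = - x \<or> a = y \<or> a = - y" by simp
    thus ?thesis by (elim disjE) (simp_all add: add_mset_commute)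
  qed
  have "{#x, - x, y, - y#} - {#a#} = {#b, c, d#}" unfolding eq[symmetric] by simp
  hence "- a = b \<or> - a = c \<or> - a = d" using neg by simp
  thus ?thesis by metis
qed

lemma mset4_eq_perm:
  assumes "{#a, b, c, d#} = {#w, x, y, z#}"
  shows "(a = w \<and> b = x \<and> c = y \<and> d = z) \<or> (a = w \<and> b = x \<and> c = z \<and> d = y) \<or>
    (a = w \<and> b = y \<and> c = x \<and> d = z) \<or> (a = w \<and> b = y \<and> c = z \<and> d = x) \<or>
    (a = w \<and> b = z \<and> c = x \<and> d = y) \<or> (a = w \<and> b = z \<and> c = y \<and> d = x) \<or>
    (a = x \<and> b = w \<and> c = y \<and> d = z) \<or> (a = x \<and> b = w \<and> c = z \<and> d = y) \<or>
    (a = x \<and> b = y \<and> c = w \<and> d = z) \<or> (a = x \<and> b = y \<and> c = z \<and> d = w) \<or>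
    (a = x \<and> b = z \<and> c = w \<and> d = y) \<or> (a = x \<and> b = z \<and> c = y \<and> d = w) \<or>
    (a = y \<and> b = w \<and> c = x \<and> d = z) \<or> (a = y \<and> b = w \<and> c = z \<and> d = x) \<or>
    (a = y \<and> b = x \<and> c = w \<and> d = z) \<or> (a = y \<and> b = x \<and> c = z \<and> d = w) \<or>
    (a = y \<and> b = z \<and> c = w \<and> d = x) \<or> (a = y \<and> b = z \<and> c = x \<and> d = w) \<or>
    (a = z \<and> b = w \<and> c = x \<and> d = y) \<or> (a = z \<and> b = w \<and> c = y \<and> d = x) \<or>
    (a = z \<and> b = x \<and> c = w \<and> d = y) \<or> (a = z \<and> b = x \<and> c = y \<and> d = w) \<or>
    (a = z \<and> b = y \<and> c = w \<and> d = x) \<or> (a = z \<and> b = y \<and> c = x \<and> d = w)"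
proof -
  have two: "c = p \<and> d = q \<or> c = q \<and> d = p" if "{#c, d#} = {#p, q#}" for p q
    using that by (auto simp: add_eq_conv_ex)
  have three: "(b = p \<and> {#c, d#} = {#q, r#}) \<or> (b = q \<and> {#c, d#} = {#p, r#}) \<or> (b = r \<and> {#c, d#} = {#p, q#})"
    if "{#b, c, d#} = {#p, q, r#}" for p q r
  proof -
    have "b \<in># {#p, q, r#}" using that by (metis union_single_eq_member)
    hence "b = p \<or> b = q \<or> b = r" by simp
    thus ?thesis using that by (elim disjE) (simp_all add: add_mset_commute)
  qed
  have four: "(a = w \<and> {#b, c, d#} = {#x, y, z#}) \<or> (a = x \<and> {#b, c, d#} = {#w, y, z#}) \<or>
      (a = y \<and> {#b, c, d#} = {#w, x, z#}) \<or> (a = z \<and> {#b, c, d#} = {#w, x, y#})"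
  proof -
    have "a \<in># {#w, x, y, z#}" using assms by (metis union_single_eq_member)
    hence "a = w \<or> a = x \<or> a = y \<or> a = z" by simp
    thus ?thesis using assms by (elim disjE) (simp_all add: add_mset_commute)
  qed
  have six: "(b = p \<and> c = q \<and> d = r) \<or> (b = p \<and> c = r \<and> d = q) \<or> (b = q \<and> c = p \<and> d = r) \<or>
      (b = q \<and> c = r \<and> d = p) \<or> (b = r \<and> c = p \<and> d = q) \<or> (b = r \<and> c = q \<and> d = p)"
    if "{#b, c, d#} = {#p, q, r#}" for p q r
    using three[OF that] two by metis
  consider "a = w" "{#b, c, d#} = {#x, y, z#}" | "a = x" "{#b, c, d#} = {#w, y, z#}"
    | "a = y" "{#b, c, d#} = {#w, x, z#}" | "a = z" "{#b, c, d#} = {#w, x, y#}"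
    using four by metis
  thus ?thesis
  proof cases
    case 1
    show ?thesis using six[OF 1(2)] 1(1) by (elim disjE) simp_all
  next
    case 2
    show ?thesis using six[OF 2(2)] 2(1) by (elim disjE) simp_all
  next
    case 3
    show ?thesis using six[OF 3(2)] 3(1) by (elim disjE) simp_all
  next
    case 4
    show ?thesis using six[OF 4(2)] 4(1) by (elim disjE) simp_all
  qed
qed

text \<open>Ordering inside the pairs leaves six of the 24 bijections, one for each choice of the
  values taken by \<open>a\<close> and \<open>b\<close>.\<close>

lemma mset4_eq_sorted:
  fixes a b c d w x y z :: real
  assumes "{#a, b, c, d#} = {#w, x, y, z#}" "a \<le> b" "c \<le> d" "w < x" "x < y" "y < z"
  shows "(a = w \<and> b = x \<and> c = y \<and> d = z) \<or> (a = w \<and> b = y \<and> c = x \<and> d = z) \<or>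
    (a = w \<and> b = z \<and> c = x \<and> d = y) \<or> (a = x \<and> b = y \<and> c = w \<and> d = z) \<or>
    (a = x \<and> b = z \<and> c = w \<and> d = y) \<or> (a = y \<and> b = z \<and> c = w \<and> d = x)"
  using mset4_eq_perm[OF assms(1)] assms(2-) by (elim disjE conjE) simp_all

lemma image_mset_inj_on:
  assumes "inj_on f A" "set_mset P \<subseteq> A" "set_mset Q \<subseteq> A" "image_mset f P = image_mset f Q"
  shows "P = Q"
proof -
  have "image_mset (inv_into A f) (image_mset f R) = R" if "set_mset R \<subseteq> A" for R
    using that assms(1) by (induction R) auto
  thus ?thesis using assms by metis
qed

lemma cos_pi_inj_on: "inj_on (\<lambda>x. cos (pi * x)) {0..1::real}"
proof (rule inj_onI)
  fix x y :: real
  assume "x \<in> {0..1}" "y \<in> {0..1}" "cos (pi * x) = cos (pi * y)"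
  thus "x = y" using cos_inj_pi[of "pi * x" "pi * y"] by simp
qed

lemma cos_pi_mset4_inj:
  fixes a b c d w x y z :: real
  assumes "{#cos (pi * a), cos (pi * b), cos (pi * c), cos (pi * d)#} =
      {#cos (pi * w), cos (pi * x), cos (pi * y), cos (pi * z)#}"
    and "a \<in> {0..1}" "b \<in> {0..1}" "c \<in> {0..1}" "d \<in> {0..1}"
    and "w \<in> {0..1}" "x \<in> {0..1}" "y \<in> {0..1}" "z \<in> {0..1}"
  shows "{#a, b, c, d#} = {#w, x, y, z#}"
  by (rule image_mset_inj_on[OF cos_pi_inj_on]) (use assms in simp_all)

text \<open>Folded into the half circle, the three angles of the triangle are \<open>g\<close>,
  \<open>2/3 - g\<close> and \<open>2/3 + g\<close> in units of \<open>pi\<close>, in increasing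
  order.\<close>

lemma threefold_normal:
  assumes "threefold C"
  obtains g where "g \<in> {0..1/3}" "C = {#cos (pi * (1/2)), cos (pi * g), cos (pi * (2/3 - g)), cos (pi * (2/3 + g))#}"
proof -
  obtain f where C: "C = {#0, cos f, cos (f + 2 * pi / 3), cos (f - 2 * pi / 3)#}"
    using assms threefold_def by blast
  define y where "y = arccos (cos f) / pi"
  have y: "y \<in> {0..1}" "cos (pi * y) = cos f"
    by (simp_all add: y_def arccos_lbound arccos_ubound)
  \<comment> \<open>Equal cosines leave only the sign of the sine open, and that sign merely swaps
    the other two vertices.\<close>
  have "(sin (pi * y))\<^sup>2 = (sin f)\<^sup>2" by (simp add: sin_squared_eq y)
  hence "sin (pi * y) = sin f \<or> sin (pi * y) = - sin f" by (simp add: power2_eq_iff)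
  hence "{#cos (f + 2 * pi / 3), cos (f - 2 * pi / 3)#} = {#cos (pi * y + 2 * pi / 3), cos (pi * y - 2 * pi / 3)#}"
    by (elim disjE) (simp_all add: cos_add cos_diff y add_mset_commute)
  hence C: "C = {#0, cos (pi * y), cos (pi * y + 2 * pi / 3), cos (pi * y - 2 * pi / 3)#}"
    unfolding C y by simp
  have red: "cos (pi * u) = cos (pi * (2 - u))" "cos (pi * u) = cos (pi * (- u))" for u
    using cos_2pi_minus[of "pi * u"] by (simp_all add: algebra_simps)
  have arg: "pi * y + 2 * pi / 3 = pi * (y + 2/3)" "pi * y - 2 * pi / 3 = pi * (y - 2/3)"
    by (simp_all add: algebra_simps)
  \<comment> \<open>\<open>y\<close> is the smallest, the middle or the largest of the three folded
    angles.\<close>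
  consider "y \<le> 1/3" | "1/3 \<le> y" "y \<le> 2/3" | "2/3 \<le> y" by linarith
  thus ?thesis
  proof cases
    case 1
    show ?thesis
      by (rule that[of y]) (use 1 y(1) red(2)[of "y - 2/3"] in \<open>simp_all add: C arg add_mset_commute add.commute\<close>)
  next
    case 2
    show ?thesis
    proof (rule that[of "2/3 - y"])
      show "C = {#cos (pi * (1/2)), cos (pi * (2/3 - y)), cos (pi * (2/3 - (2/3 - y))), cos (pi * (2/3 + (2/3 - y)))#}"
        using red(1)[of "y + 2/3"] red(2)[of "y - 2/3"] by (simp add: C arg add_mset_commute)
    qed (use 2 in simp)
  next
    case 3
    show ?thesis
    proof (rule that[of "y - 2/3"])
      show "C = {#cos (pi * (1/2)), cos (pi * (y - 2/3)), cos (pi * (2/3 - (y - 2/3))), cos (pi * (2/3 + (y - 2/3)))#}"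
        using red(1)[of "y + 2/3"] by (simp add: C arg add_mset_commute)
    qed (use 3 y(1) in simp)
  qed
qed

text \<open>
  The sporadic quadruples \<open>(i, j, s, t)\<close> of the list, divided by \<open>k\<close> and in units of \<open>1/60\<close> or \<open>1/42\<close>.
\<close>

definition sporadic_sixtieths :: "(real \<times> real \<times> real \<times> real) set" where
  "sporadic_sixtieths = {(2, 6, 6, 22), (6, 10, 10, 18), (14, 18, 18, 26), (2, 4, 8, 18), (4, 6, 10, 16), (16, 18, 22, 28), (4, 6, 14, 28), (6, 8, 16, 26), (8, 10, 18, 28),
     (3, 4, 16, 27), (5, 6, 18, 25), (8, 9, 21, 28)}"

definition sporadic_fortyseconds :: "(real \<times> real \<times> real \<times> real) set" where
  "sporadic_fortyseconds = {(2, 3, 9, 16), (3, 4, 10, 15), (8, 9, 15, 20)}"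

lemma listed_30: "{(m, 3 * m, 3 * m, 11 * m), (3 * m, 5 * m, 5 * m, 9 * m), (7 * m, 9 * m, 9 * m, 13 * m), (m, 2 * m, 4 * m, 9 * m), (2 * m, 3 * m, 5 * m, 8 * m), (8 * m, 9 * m, 11 * m, 14 * m), (2 * m, 3 * m, 7 * m, 14 * m), (3 * m, 4 * m, 8 * m, 13 * m), (4 * m, 5 * m, 9 * m, 14 * m)} \<subseteq> fst ` listed (30 * m)"
proof -
  have "{((m, 3 * m, 3 * m, 11 * m), int (3 * m)),
      ((3 * m, 5 * m, 5 * m, 9 * m), int m),
      ((7 * m, 9 * m, 9 * m, 13 * m), int m),
      ((m, 2 * m, 4 * m, 9 * m), int (2 * m)),
      ((2 * m, 3 * m, 5 * m, 8 * m), int m),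
      ((8 * m, 9 * m, 11 * m, 14 * m), int m),
      ((2 * m, 3 * m, 7 * m, 14 * m), int (3 * m)),
      ((3 * m, 4 * m, 8 * m, 13 * m), int (2 * m)),
      ((4 * m, 5 * m, 9 * m, 14 * m), int (2 * m))} \<subseteq> listed (30 * m)"
    by (simp add: listed_def)
  from image_mono[OF this, of fst] show ?thesis by simp
qed

lemma listed_42: "{(2 * m, 3 * m, 9 * m, 16 * m), (3 * m, 4 * m, 10 * m, 15 * m), (8 * m, 9 * m, 15 * m, 20 * m)} \<subseteq> fst ` listed (42 * m)"
proof -
  have "{((2 * m, 3 * m, 9 * m, 16 * m), int (3 * m)),
      ((3 * m, 4 * m, 10 * m, 15 * m), int (2 * m)),
      ((8 * m, 9 * m, 15 * m, 20 * m), int (2 * m))} \<subseteq> listed (42 * m)"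
    by (simp add: listed_def)
  from image_mono[OF this, of fst] show ?thesis by simp
qed

lemma listed_60: "{(3 * m, 4 * m, 16 * m, 27 * m), (5 * m, 6 * m, 18 * m, 25 * m), (8 * m, 9 * m, 21 * m, 28 * m)} \<subseteq> fst ` listed (60 * m)"
proof -
  have "{((3 * m, 4 * m, 16 * m, 27 * m), int (5 * m)),
      ((5 * m, 6 * m, 18 * m, 25 * m), int (3 * m)),
      ((8 * m, 9 * m, 21 * m, 28 * m), int (3 * m))} \<subseteq> listed (60 * m)"
    by (simp add: listed_def)
  from image_mono[OF this, of fst] show ?thesis by simp
qed

text \<open>The divisibility of \<open>k\<close> comes out of the fractions: an integer combination
  of the entries, such as \<open>j - i\<close>, equals \<open>k / 30\<close> or
  \<open>k / 60\<close> and serves as \<open>m\<close>.\<close>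

lemma sporadic_sixtieths_listed:
  assumes "(60 * I, 60 * J, 60 * S, 60 * T) \<in> sporadic_sixtieths"
    and "I = real i / real k" "J = real j / real k" "S = real s / real k" "T = real t / real k" "k > 0"
  shows "(i, j, s, t) \<in> fst ` listed k"
proof -
  have nat_eq: "60 * x = n * k" if "60 * (real x / real k) = real n" for x n
  proof -
    have "real (60 * x) = real (n * k)" using that assms(6) by (simp add: field_simps)
    thus ?thesis by (simp only: of_nat_eq_iff)
  qed
  from assms(1) show ?thesis unfolding sporadic_sixtieths_def
  proof (elim insertE emptyE)
    assume "(60 * I, 60 * J, 60 * S, 60 * T) = (2, 6, 6, 22)"
    hence "60 * i = 2 * k" "60 * j = 6 * k" "60 * s = 6 * k" "60 * t = 22 * k"
      using nat_eq[of i 2] nat_eq[of j 6] nat_eq[of s 6] nat_eq[of t 22] assms by simp_all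
    moreover define m where "m = i"
    ultimately have m: "k = 30 * m" "i = m" "j = 3 * m" "s = 3 * m" "t = 11 * m" by linarith+
    show ?thesis using listed_30[of m] unfolding m by blast
  next
    assume "(60 * I, 60 * J, 60 * S, 60 * T) = (6, 10, 10, 18)"
    hence "60 * i = 6 * k" "60 * j = 10 * k" "60 * s = 10 * k" "60 * t = 18 * k"
      using nat_eq[of i 6] nat_eq[of j 10] nat_eq[of s 10] nat_eq[of t 18] assms by simp_all
    moreover define m where "m = 2 * i - j"
    ultimately have m: "k = 30 * m" "i = 3 * m" "j = 5 * m" "s = 5 * m" "t = 9 * m" by linarith+
    show ?thesis using listed_30[of m] unfolding m by blast
  next
    assume "(60 * I, 60 * J, 60 * S, 60 * T) = (14, 18, 18, 26)"
    hence "60 * i = 14 * k" "60 * j = 18 * k" "60 * s = 18 * k" "60 * t = 26 * k"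
      using nat_eq[of i 14] nat_eq[of j 18] nat_eq[of s 18] nat_eq[of t 26] assms by simp_all
    moreover define m where "m = 4 * i - 3 * j"
    ultimately have m: "k = 30 * m" "i = 7 * m" "j = 9 * m" "s = 9 * m" "t = 13 * m" by linarith+
    show ?thesis using listed_30[of m] unfolding m by blast
  next
    assume "(60 * I, 60 * J, 60 * S, 60 * T) = (2, 4, 8, 18)"
    hence "60 * i = 2 * k" "60 * j = 4 * k" "60 * s = 8 * k" "60 * t = 18 * k"
      using nat_eq[of i 2] nat_eq[of j 4] nat_eq[of s 8] nat_eq[of t 18] assms by simp_all
    moreover define m where "m = i"
    ultimately have m: "k = 30 * m" "i = m" "j = 2 * m" "s = 4 * m" "t = 9 * m" by linarith+
    show ?thesis using listed_30[of m] unfolding m by blast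
  next
    assume "(60 * I, 60 * J, 60 * S, 60 * T) = (4, 6, 10, 16)"
    hence "60 * i = 4 * k" "60 * j = 6 * k" "60 * s = 10 * k" "60 * t = 16 * k"
      using nat_eq[of i 4] nat_eq[of j 6] nat_eq[of s 10] nat_eq[of t 16] assms by simp_all
    moreover define m where "m = j - i"
    ultimately have m: "k = 30 * m" "i = 2 * m" "j = 3 * m" "s = 5 * m" "t = 8 * m" by linarith+
    show ?thesis using listed_30[of m] unfolding m by blast
  next
    assume "(60 * I, 60 * J, 60 * S, 60 * T) = (16, 18, 22, 28)"
    hence "60 * i = 16 * k" "60 * j = 18 * k" "60 * s = 22 * k" "60 * t = 28 * k"
      using nat_eq[of i 16] nat_eq[of j 18] nat_eq[of s 22] nat_eq[of t 28] assms by simp_all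
    moreover define m where "m = j - i"
    ultimately have m: "k = 30 * m" "i = 8 * m" "j = 9 * m" "s = 11 * m" "t = 14 * m" by linarith+
    show ?thesis using listed_30[of m] unfolding m by blast
  next
    assume "(60 * I, 60 * J, 60 * S, 60 * T) = (4, 6, 14, 28)"
    hence "60 * i = 4 * k" "60 * j = 6 * k" "60 * s = 14 * k" "60 * t = 28 * k"
      using nat_eq[of i 4] nat_eq[of j 6] nat_eq[of s 14] nat_eq[of t 28] assms by simp_all
    moreover define m where "m = j - i"
    ultimately have m: "k = 30 * m" "i = 2 * m" "j = 3 * m" "s = 7 * m" "t = 14 * m" by linarith+
    show ?thesis using listed_30[of m] unfolding m by blast
  next
    assume "(60 * I, 60 * J, 60 * S, 60 * T) = (6, 8, 16, 26)"
    hence "60 * i = 6 * k" "60 * j = 8 * k" "60 * s = 16 * k" "60 * t = 26 * k"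
      using nat_eq[of i 6] nat_eq[of j 8] nat_eq[of s 16] nat_eq[of t 26] assms by simp_all
    moreover define m where "m = j - i"
    ultimately have m: "k = 30 * m" "i = 3 * m" "j = 4 * m" "s = 8 * m" "t = 13 * m" by linarith+
    show ?thesis using listed_30[of m] unfolding m by blast
  next
    assume "(60 * I, 60 * J, 60 * S, 60 * T) = (8, 10, 18, 28)"
    hence "60 * i = 8 * k" "60 * j = 10 * k" "60 * s = 18 * k" "60 * t = 28 * k"
      using nat_eq[of i 8] nat_eq[of j 10] nat_eq[of s 18] nat_eq[of t 28] assms by simp_all
    moreover define m where "m = j - i"
    ultimately have m: "k = 30 * m" "i = 4 * m" "j = 5 * m" "s = 9 * m" "t = 14 * m" by linarith+
    show ?thesis using listed_30[of m] unfolding m by blast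
  next
    assume "(60 * I, 60 * J, 60 * S, 60 * T) = (3, 4, 16, 27)"
    hence "60 * i = 3 * k" "60 * j = 4 * k" "60 * s = 16 * k" "60 * t = 27 * k"
      using nat_eq[of i 3] nat_eq[of j 4] nat_eq[of s 16] nat_eq[of t 27] assms by simp_all
    moreover define m where "m = j - i"
    ultimately have m: "k = 60 * m" "i = 3 * m" "j = 4 * m" "s = 16 * m" "t = 27 * m" by linarith+
    show ?thesis using listed_60[of m] unfolding m by blast
  next
    assume "(60 * I, 60 * J, 60 * S, 60 * T) = (5, 6, 18, 25)"
    hence "60 * i = 5 * k" "60 * j = 6 * k" "60 * s = 18 * k" "60 * t = 25 * k"
      using nat_eq[of i 5] nat_eq[of j 6] nat_eq[of s 18] nat_eq[of t 25] assms by simp_all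
    moreover define m where "m = j - i"
    ultimately have m: "k = 60 * m" "i = 5 * m" "j = 6 * m" "s = 18 * m" "t = 25 * m" by linarith+
    show ?thesis using listed_60[of m] unfolding m by blast
  next
    assume "(60 * I, 60 * J, 60 * S, 60 * T) = (8, 9, 21, 28)"
    hence "60 * i = 8 * k" "60 * j = 9 * k" "60 * s = 21 * k" "60 * t = 28 * k"
      using nat_eq[of i 8] nat_eq[of j 9] nat_eq[of s 21] nat_eq[of t 28] assms by simp_all
    moreover define m where "m = j - i"
    ultimately have m: "k = 60 * m" "i = 8 * m" "j = 9 * m" "s = 21 * m" "t = 28 * m" by linarith+
    show ?thesis using listed_60[of m] unfolding m by blast
  qed
qed

lemma sporadic_fortyseconds_listed:
  assumes "(42 * I, 42 * J, 42 * S, 42 * T) \<in> sporadic_fortyseconds"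
    and "I = real i / real k" "J = real j / real k" "S = real s / real k" "T = real t / real k" "k > 0"
  shows "(i, j, s, t) \<in> fst ` listed k"
proof -
  have nat_eq: "42 * x = n * k" if "42 * (real x / real k) = real n" for x n
  proof -
    have "real (42 * x) = real (n * k)" using that assms(6) by (simp add: field_simps)
    thus ?thesis by (simp only: of_nat_eq_iff)
  qed
  from assms(1) show ?thesis unfolding sporadic_fortyseconds_def
  proof (elim insertE emptyE)
    assume "(42 * I, 42 * J, 42 * S, 42 * T) = (2, 3, 9, 16)"
    hence "42 * i = 2 * k" "42 * j = 3 * k" "42 * s = 9 * k" "42 * t = 16 * k"
      using nat_eq[of i 2] nat_eq[of j 3] nat_eq[of s 9] nat_eq[of t 16] assms by simp_all
    moreover define m where "m = j - i"
    ultimately have m: "k = 42 * m" "i = 2 * m" "j = 3 * m" "s = 9 * m" "t = 16 * m" by linarith+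
    show ?thesis using listed_42[of m] unfolding m by blast
  next
    assume "(42 * I, 42 * J, 42 * S, 42 * T) = (3, 4, 10, 15)"
    hence "42 * i = 3 * k" "42 * j = 4 * k" "42 * s = 10 * k" "42 * t = 15 * k"
      using nat_eq[of i 3] nat_eq[of j 4] nat_eq[of s 10] nat_eq[of t 15] assms by simp_all
    moreover define m where "m = j - i"
    ultimately have m: "k = 42 * m" "i = 3 * m" "j = 4 * m" "s = 10 * m" "t = 15 * m" by linarith+
    show ?thesis using listed_42[of m] unfolding m by blast
  next
    assume "(42 * I, 42 * J, 42 * S, 42 * T) = (8, 9, 15, 20)"
    hence "42 * i = 8 * k" "42 * j = 9 * k" "42 * s = 15 * k" "42 * t = 20 * k"
      using nat_eq[of i 8] nat_eq[of j 9] nat_eq[of s 15] nat_eq[of t 20] assms by simp_all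
    moreover define m where "m = j - i"
    ultimately have m: "k = 42 * m" "i = 8 * m" "j = 9 * m" "s = 15 * m" "t = 20 * m" by linarith+
    show ?thesis using listed_42[of m] unfolding m by blast
  qed
qed

text \<open>The first five rows sort the lists of \<open>sporadic_angles\<close>; the last five are
  their complements to 1, which absorb the sign -1.\<close>

definition sorted_sporadic_angles :: "(real \<times> real \<times> real \<times> real) set" where
  "sorted_sporadic_angles = {(2/7, 1/3, 4/7, 6/7),
       (1/3, 2/5, 1/2, 4/5),
       (0, 2/5, 2/3, 4/5),
       (1/15, 1/3, 11/15, 4/5),
       (1/3, 2/5, 7/15, 13/15),
       (1/7, 3/7, 2/3, 5/7),
       (1/5, 1/2, 3/5, 2/3),
       (1/5, 1/3, 3/5, 1),
       (1/5, 4/15, 2/3, 14/15),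
       (2/15, 8/15, 3/5, 2/3)}"

text \<open>
  Here \<open>a\<close>, \<open>b\<close>, \<open>c\<close>, \<open>d\<close> stand for \<open>T - I\<close>, \<open>1 - T - I\<close>, \<open>S + J\<close>, \<open>1 - S + J\<close>, whose cosines (times \<open>pi\<close>)
  have vanishing sum.
\<close>

lemma sporadic_points_sorted:
  fixes a b c d :: real
  assumes "{#a, b, c, d#} = {#w, x, y, z#}" "a \<le> b" "c \<le> d" "a + b < 1" "c + d > 1"
    and "(w, x, y, z) \<in> sorted_sporadic_angles"
    and "I = (1 - a - b) / 2" "J = (c + d - 1) / 2" "S = (1 + c - d) / 2" "T = (1 + a - b) / 2"
  shows "(60 * I, 60 * J, 60 * S, 60 * T) \<in> sporadic_sixtieths \<or> (60 * J, 60 * I, 60 * T, 60 * S) \<in> sporadic_sixtieths \<or>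
    (42 * I, 42 * J, 42 * S, 42 * T) \<in> sporadic_fortyseconds \<or> (42 * J, 42 * I, 42 * T, 42 * S) \<in> sporadic_fortyseconds"
proof -
  have lt: "w < x" "x < y" "y < z" using assms(6) by (auto simp: sorted_sporadic_angles_def)
  have *: "(a = w \<and> b = x \<and> c = y \<and> d = z) \<or> (a = w \<and> b = y \<and> c = x \<and> d = z) \<or>
    (a = w \<and> b = z \<and> c = x \<and> d = y) \<or> (a = x \<and> b = y \<and> c = w \<and> d = z) \<or>
    (a = x \<and> b = z \<and> c = w \<and> d = y) \<or> (a = y \<and> b = z \<and> c = w \<and> d = x)"
    by (rule mset4_eq_sorted[OF assms(1-3) lt])
  \<comment> \<open>For each splitting into pairs, \<open>a + b < 1\<close> and
    \<open>c + d > 1\<close> fix which pair comes first. Complementing all angles exchanges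
    \<open>I, T\<close> with \<open>J, S\<close>, whence the swapped alternatives.\<close>
  from assms(6) show ?thesis unfolding sorted_sporadic_angles_def
  proof (elim insertE emptyE)
    assume "(w, x, y, z) = (2/7, 1/3, 4/7, 6/7)"
    thus ?thesis using * assms(4,5) unfolding prod.inject assms(7-10) sporadic_sixtieths_def sporadic_fortyseconds_def
      by (elim disjE conjE) simp_all
  next
    assume "(w, x, y, z) = (1/3, 2/5, 1/2, 4/5)"
    thus ?thesis using * assms(4,5) unfolding prod.inject assms(7-10) sporadic_sixtieths_def sporadic_fortyseconds_def
      by (elim disjE conjE) simp_all
  next
    assume "(w, x, y, z) = (0, 2/5, 2/3, 4/5)"
    thus ?thesis using * assms(4,5) unfolding prod.inject assms(7-10) sporadic_sixtieths_def sporadic_fortyseconds_def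
      by (elim disjE conjE) simp_all
  next
    assume "(w, x, y, z) = (1/15, 1/3, 11/15, 4/5)"
    thus ?thesis using * assms(4,5) unfolding prod.inject assms(7-10) sporadic_sixtieths_def sporadic_fortyseconds_def
      by (elim disjE conjE) simp_all
  next
    assume "(w, x, y, z) = (1/3, 2/5, 7/15, 13/15)"
    thus ?thesis using * assms(4,5) unfolding prod.inject assms(7-10) sporadic_sixtieths_def sporadic_fortyseconds_def
      by (elim disjE conjE) simp_all
  next
    assume "(w, x, y, z) = (1/7, 3/7, 2/3, 5/7)"
    thus ?thesis using * assms(4,5) unfolding prod.inject assms(7-10) sporadic_sixtieths_def sporadic_fortyseconds_def
      by (elim disjE conjE) simp_all
  next
    assume "(w, x, y, z) = (1/5, 1/2, 3/5, 2/3)"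
    thus ?thesis using * assms(4,5) unfolding prod.inject assms(7-10) sporadic_sixtieths_def sporadic_fortyseconds_def
      by (elim disjE conjE) simp_all
  next
    assume "(w, x, y, z) = (1/5, 1/3, 3/5, 1)"
    thus ?thesis using * assms(4,5) unfolding prod.inject assms(7-10) sporadic_sixtieths_def sporadic_fortyseconds_def
      by (elim disjE conjE) simp_all
  next
    assume "(w, x, y, z) = (1/5, 4/15, 2/3, 14/15)"
    thus ?thesis using * assms(4,5) unfolding prod.inject assms(7-10) sporadic_sixtieths_def sporadic_fortyseconds_def
      by (elim disjE conjE) simp_all
  next
    assume "(w, x, y, z) = (2/15, 8/15, 3/5, 2/3)"
    thus ?thesis using * assms(4,5) unfolding prod.inject assms(7-10) sporadic_sixtieths_def sporadic_fortyseconds_def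
      by (elim disjE conjE) simp_all
  qed
qed
text \<open>The pair containing 1/2 yields two entries with sum 1/2; the other pair yields 1/6 and
  twice the smaller of those entries. The four outcomes are the one family up to swaps.\<close>

lemma family_points:
  fixes a b c d :: real
  assumes "{#a, b, c, d#} = {#1/2, g, 2/3 - g, 2/3 + g#}" "g \<in> {0..1/3}"
    and "a \<le> b" "c \<le> d" "a + b < 1" "c + d > 1"
    and "I = (1 - a - b) / 2" "J = (c + d - 1) / 2" "S = (1 + c - d) / 2" "T = (1 + a - b) / 2"
  shows "(T = 1/2 - I \<and> J = 1/6 \<and> S = 2 * I) \<or> (T = 1/2 - I \<and> S = 1/6 \<and> J = 2 * I) \<or>
    (S = 1/2 - J \<and> I = 1/6 \<and> T = 2 * J) \<or> (S = 1/2 - J \<and> T = 1/6 \<and> I = 2 * J)"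
proof -
  have g: "0 \<le> g" "g \<le> 1/3" using assms(2) by auto
  show ?thesis
    using mset4_eq_perm[OF assms(1)] assms(3-6) g unfolding assms(7-10)
    by (elim disjE conjE) (simp_all add: field_simps)
qed

lemma sporadic_points:
  fixes a b c d :: real
  assumes "sporadic {#cos (pi * a), cos (pi * b), cos (pi * c), cos (pi * d)#}"
    and rng: "a \<in> {0..1}" "b \<in> {0..1}" "c \<in> {0..1}" "d \<in> {0..1}"
    and ord: "a \<le> b" "c \<le> d" "a + b < 1" "c + d > 1"
    and IJST: "I = (1 - a - b) / 2" "J = (c + d - 1) / 2" "S = (1 + c - d) / 2" "T = (1 + a - b) / 2"
  shows "(60 * I, 60 * J, 60 * S, 60 * T) \<in> sporadic_sixtieths \<or> (60 * J, 60 * I, 60 * T, 60 * S) \<in> sporadic_sixtieths \<or>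
    (42 * I, 42 * J, 42 * S, 42 * T) \<in> sporadic_fortyseconds \<or> (42 * J, 42 * I, 42 * T, 42 * S) \<in> sporadic_fortyseconds"
proof -
  obtain v as where v: "v \<in> {1, -1}" and as: "as \<in> sporadic_angles"
    and eq: "{#cos (pi * a), cos (pi * b), cos (pi * c), cos (pi * d)#} = mset (map (\<lambda>x. v * cos (pi * x)) as)"
    using assms(1) unfolding sporadic_def by blast
  define bs where "bs = (if v = 1 then as else map (\<lambda>x. 1 - x) as)"
  have neg: "- cos (pi * x) = cos (pi * (1 - x))" for x
    by (simp add: right_diff_distrib)
  have bs: "mset (map (\<lambda>x. v * cos (pi * x)) as) = image_mset (\<lambda>x. cos (pi * x)) (mset bs)"
    using v by (auto simp: bs_def neg multiset.map_comp o_def)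
  have sub: "set bs \<subseteq> {0..1}" using v as by (auto simp: bs_def sporadic_angles_def)
  have ms: "{#a, b, c, d#} = mset bs"
    by (rule image_mset_inj_on[OF cos_pi_inj_on]) (use rng sub eq bs in auto)
  have *: ?thesis if m: "mset bs = {#w, x, y, z#}" and w: "(w, x, y, z) \<in> sorted_sporadic_angles" for w x y z
    by (rule sporadic_points_sorted[OF ms[unfolded m] ord w IJST])
  show ?thesis
  proof (cases "v = 1")
    case True
    hence bs: "bs = as" by (simp add: bs_def)
    from as show ?thesis unfolding sporadic_angles_def
    proof (elim insertE emptyE)
      assume "as = [1/3, 2/7, 4/7, 6/7]"
      thus ?thesis by (intro *[of "2/7" "1/3" "4/7" "6/7"]) (simp_all add: bs add_mset_commute sorted_sporadic_angles_def)
    next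
      assume "as = [1/2, 1/3, 2/5, 4/5]"
      thus ?thesis by (intro *[of "1/3" "2/5" "1/2" "4/5"]) (simp_all add: bs add_mset_commute sorted_sporadic_angles_def)
    next
      assume "as = [0, 2/3, 2/5, 4/5]"
      thus ?thesis by (intro *[of "0" "2/5" "2/3" "4/5"]) (simp_all add: bs add_mset_commute sorted_sporadic_angles_def)
    next
      assume "as = [1/3, 4/5, 11/15, 1/15]"
      thus ?thesis by (intro *[of "1/15" "1/3" "11/15" "4/5"]) (simp_all add: bs add_mset_commute sorted_sporadic_angles_def)
    next
      assume "as = [1/3, 2/5, 13/15, 7/15]"
      thus ?thesis by (intro *[of "1/3" "2/5" "7/15" "13/15"]) (simp_all add: bs add_mset_commute sorted_sporadic_angles_def)
    qed
  next
    case False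
    hence bs: "bs = map (\<lambda>x. 1 - x) as" by (simp add: bs_def)
    from as show ?thesis unfolding sporadic_angles_def
    proof (elim insertE emptyE)
      assume "as = [1/3, 2/7, 4/7, 6/7]"
      thus ?thesis by (intro *[of "1/7" "3/7" "2/3" "5/7"]) (simp_all add: bs add_mset_commute sorted_sporadic_angles_def)
    next
      assume "as = [1/2, 1/3, 2/5, 4/5]"
      thus ?thesis by (intro *[of "1/5" "1/2" "3/5" "2/3"]) (simp_all add: bs add_mset_commute sorted_sporadic_angles_def)
    next
      assume "as = [0, 2/3, 2/5, 4/5]"
      thus ?thesis by (intro *[of "1/5" "1/3" "3/5" "1"]) (simp_all add: bs add_mset_commute sorted_sporadic_angles_def)
    next
      assume "as = [1/3, 4/5, 11/15, 1/15]"
      thus ?thesis by (intro *[of "1/5" "4/15" "2/3" "14/15"]) (simp_all add: bs add_mset_commute sorted_sporadic_angles_def)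
    next
      assume "as = [1/3, 2/5, 13/15, 7/15]"
      thus ?thesis by (intro *[of "2/15" "8/15" "3/5" "2/3"]) (simp_all add: bs add_mset_commute sorted_sporadic_angles_def)
    qed
  qed
qed

section \<open>From the sine equation to the listed orbits\<close>

definition listed_orbits :: "nat \<Rightarrow> quad set" where
  "listed_orbits k = (\<Union>(q, w)\<in>listed k. G0_orbit k q)"

lemma listed_orbits_iff: "q \<in> listed_orbits k \<longleftrightarrow> (\<exists>p\<in>fst ` listed k. q \<in> G0_orbit k p)"
  by (simp add: listed_orbits_def case_prod_beta)

lemma listed_orbitsI: "q \<in> fst ` listed k \<Longrightarrow> q \<in> listed_orbits k"
  unfolding listed_orbits_iff using G0_orbit_refl by blast

lemma listed_orbits_gen: "g \<in> G0_gens k \<Longrightarrow> q \<in> listed_orbits k \<Longrightarrow> g q \<in> listed_orbits k"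
  unfolding listed_orbits_iff using G0_orbit_gen by blast

lemma listed_orbits_swap:
  assumes "(i, j, s, t) \<in> listed_orbits k"
  shows "(t, j, s, i) \<in> listed_orbits k" "(i, s, j, t) \<in> listed_orbits k" "(j, i, t, s) \<in> listed_orbits k"
proof -
  have "(\<lambda>(i, j, s, t). (t, j, s, i)) \<in> G0_gens k" "(\<lambda>(i, j, s, t). (i, s, j, t)) \<in> G0_gens k"
    "(\<lambda>(i, j, s, t). (j, i, t, s)) \<in> G0_gens k" by (simp_all add: G0_gens_def)
  from this[THEN listed_orbits_gen, OF assms]
  show "(t, j, s, i) \<in> listed_orbits k" "(i, s, j, t) \<in> listed_orbits k" "(j, i, t, s) \<in> listed_orbits k"
    by simp_all
qed

lemma family_listed:
  assumes "k = 6 * l" "1 \<le> u" "4 * u \<le> k" "u \<noteq> l" "2 * t + 2 * u = k"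
  shows "(u, l, 2 * u, t) \<in> listed_orbits k"
proof (rule listed_orbitsI)
  have "((u, l, 2 * u, t), int l - int u) \<in> listed k" 
  proof -
    have "u \<le> k div 4" "t = 3 * l - u" using assms by linarith+
    thus ?thesis unfolding listed_def using assms(1,2,4) by blast
  qed
  thus "(u, l, 2 * u, t) \<in> fst ` listed k" by force
qed

text \<open>The order assumptions select a fundamental domain in which all four angles lie between 0
  and \<open>pi\<close>, so the cosines determine them.\<close>

lemma sine_quad_normal_listed:
  assumes k: "k > 0" and q: "sine_quad k (i, j, s, t)"
    and ord: "i \<le> t" "2 * t \<le> k" "j \<le> s" "2 * s \<le> k"
  shows "(i, j, s, t) \<in> listed_orbits k"
proof -
  have pos: "i > 0" "j > 0" "s > 0" "t > 0" and neq: "i \<noteq> j" "j \<noteq> t" "t \<noteq> s" "s \<noteq> i"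
    and sn: "sn k i * sn k t = sn k j * sn k s"
    using q by (auto simp: sine_quad_def kset_def apart_def)
  define I J S T where "I = real i / real k" and "J = real j / real k" and "S = real s / real k" and "T = real t / real k"
  note defs = I_def J_def S_def T_def
  \<comment> \<open>Angles from the product formula; the complements in \<open>b\<close> and
    \<open>d\<close> turn the differences of cosines into one sum.\<close>
  define a b c d where "a = T - I" and "b = 1 - T - I" and "c = S + J" and "d = 1 - S + J"
  note abcd = a_def b_def c_def d_def
  have IT: "0 < I" "0 < J" "I \<le> T" "J \<le> S" "T \<le> 1/2" "S \<le> 1/2"
    using k pos ord by (simp_all add: defs field_simps)
  have rng: "a \<in> {0..1}" "b \<in> {0..1}" "c \<in> {0..1}" "d \<in> {0..1}"
    and or: "a \<le> b" "c \<le> d" "a + b < 1" "c + d > 1"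
    using IT by (simp_all add: abcd)
  have IJST: "I = (1 - a - b) / 2" "J = (c + d - 1) / 2" "S = (1 + c - d) / 2" "T = (1 + a - b) / 2"
    by (simp_all add: abcd field_simps)
  let ?as = "[int t - int i, int k - int t - int i, int s + int j, int k - int s + int j]"
  have cos: "cs (2 * k) (int t - int i) = cos (pi * a)" "cs (2 * k) (int k - int t - int i) = cos (pi * b)"
    "cs (2 * k) (int s + int j) = cos (pi * c)" "cs (2 * k) (int k - int s + int j) = cos (pi * d)"
    using k by (simp_all add: cs_half abcd defs add_divide_distrib diff_divide_distrib)
  have "(\<Sum>a\<leftarrow>?as. cs (2 * k) a) = 0"
  proof -
    have "cs (2 * k) (int t - int i) - cs (2 * k) (int t + int i) =
        cs (2 * k) (int s - int j) - cs (2 * k) (int s + int j)"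
      using sn unfolding sn_mult_sn by simp
    moreover have "cs (2 * k) (int k - int t - int i) = - cs (2 * k) (int t + int i)"
      by (metis diff_diff_add cs_reflect k)
    moreover have "int k - int s + int j = int k - (int s - int j)" by simp
    hence "cs (2 * k) (int k - int s + int j) = - cs (2 * k) (int s - int j)" by (metis cs_reflect k)
    ultimately show ?thesis by simp
  qed
  hence "classified (mset (map (cs (2 * k)) ?as))"
    by (intro classified_cos) (use k in simp_all)
  hence "classified {#cos (pi * a), cos (pi * b), cos (pi * c), cos (pi * d)#}" by (simp add: cos)
  then consider (bal) "balanced {#cos (pi * a), cos (pi * b), cos (pi * c), cos (pi * d)#}"
    | (three) "threefold {#cos (pi * a), cos (pi * b), cos (pi * c), cos (pi * d)#}"
    | (spor) "sporadic {#cos (pi * a), cos (pi * b), cos (pi * c), cos (pi * d)#}"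
    unfolding classified_def by blast
  thus ?thesis
  proof cases
    case bal
    have neg: "- cos (pi * a) = cos (pi * (1 - a))" by (simp add: right_diff_distrib)
    have eq: "x = 1 - a" if "cos (pi * x) = - cos (pi * a)" "x \<in> {0..1}" for x
      by (rule inj_onD[OF cos_pi_inj_on]) (use that neg rng in auto)
    have sum0: "cos (pi * a) + cos (pi * b) + cos (pi * c) + cos (pi * d) = 0"
      using \<open>(\<Sum>a\<leftarrow>?as. cs (2 * k) a) = 0\<close> by (simp add: cos)
    have neg': "- cos (pi * b) = cos (pi * (1 - b))" by (simp add: right_diff_distrib)
    have eq': "x = 1 - b" if "cos (pi * x) = - cos (pi * b)" "x \<in> {0..1}" for x
      by (rule inj_onD[OF cos_pi_inj_on]) (use that neg' rng in auto)
    \<comment> \<open>The first alternative contradicts \<open>a + b < 1\<close>; the other two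
      force a coincidence of entries that \<open>apart\<close> excludes.\<close>
    have "b = 1 - a \<or> (c = 1 - a \<and> d = 1 - b) \<or> (d = 1 - a \<and> c = 1 - b)"
      using balanced_cases[OF bal]
    proof (elim disjE)
      assume h: "cos (pi * c) = - cos (pi * a)"
      hence "cos (pi * d) = - cos (pi * b)" using sum0 by simp
      thus ?thesis using eq[OF h] eq' rng by blast
    next
      assume h: "cos (pi * d) = - cos (pi * a)"
      hence "cos (pi * c) = - cos (pi * b)" using sum0 by simp
      thus ?thesis using eq[OF h] eq' rng by blast
    qed (use eq rng in blast)
    hence "I = J \<or> S = T" using or unfolding abcd by auto
    hence "real i = real j \<or> real s = real t" using k unfolding defs by auto
    thus ?thesis using neq by auto
  next
    case three
    obtain g where g: "g \<in> {0..1/3}" "{#cos (pi * a), cos (pi * b), cos (pi * c), cos (pi * d)#} =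
        {#cos (pi * (1/2)), cos (pi * g), cos (pi * (2/3 - g)), cos (pi * (2/3 + g))#}"
      using threefold_normal[OF three] by metis
    have "{#a, b, c, d#} = {#1/2, g, 2/3 - g, 2/3 + g#}"
      by (rule cos_pi_mset4_inj[OF g(2) rng]) (use g(1) in auto)
    from family_points[OF this g(1) or IJST]
    consider "T = 1/2 - I" "J = 1/6" "S = 2 * I" | "T = 1/2 - I" "S = 1/6" "J = 2 * I"
      | "S = 1/2 - J" "I = 1/6" "T = 2 * J" | "S = 1/2 - J" "T = 1/6" "I = 2 * J" by blast
    thus ?thesis
    proof cases
      case 1
      hence e: "k = 6 * j" "s = 2 * i" "2 * t + 2 * i = k" using k by (auto simp: defs field_simps)
      hence "(i, j, 2 * i, t) \<in> listed_orbits k" using e neq ord pos by (intro family_listed) linarith+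
      thus ?thesis using e(2) by simp
    next
      case 2
      hence e: "k = 6 * s" "j = 2 * i" "2 * t + 2 * i = k" using k by (auto simp: defs field_simps)
      hence "(i, s, 2 * i, t) \<in> listed_orbits k" using e neq ord pos by (intro family_listed) linarith+
      hence "(i, s, j, t) \<in> listed_orbits k" using e(2) by simp
      thus ?thesis by (rule listed_orbits_swap)
    next
      case 3
      hence e: "k = 6 * i" "t = 2 * j" "2 * s + 2 * j = k" using k by (auto simp: defs field_simps)
      hence "(j, i, 2 * j, s) \<in> listed_orbits k" using e neq ord pos by (intro family_listed) linarith+
      hence "(j, i, t, s) \<in> listed_orbits k" using e(2) by simp
      thus ?thesis by (rule listed_orbits_swap)
    next
      case 4
      hence e: "k = 6 * t" "i = 2 * j" "2 * s + 2 * j = k" using k by (auto simp: defs field_simps)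
      hence "(j, t, 2 * j, s) \<in> listed_orbits k" using e neq ord pos by (intro family_listed) linarith+
      hence "(j, t, i, s) \<in> listed_orbits k" using e(2) by simp
      hence "(j, i, t, s) \<in> listed_orbits k" by (rule listed_orbits_swap)
      thus ?thesis by (rule listed_orbits_swap)
    qed
  next
    case spor
    from sporadic_points[OF spor rng or IJST]
    have "(i, j, s, t) \<in> fst ` listed k \<or> (j, i, t, s) \<in> fst ` listed k"
      using sporadic_sixtieths_listed[of I J S T i k j s t] sporadic_sixtieths_listed[of J I T S j k i t s]
        sporadic_fortyseconds_listed[of I J S T i k j s t] sporadic_fortyseconds_listed[of J I T S j k i t s] k
      unfolding defs by blast
    thus ?thesis using listed_orbitsI listed_orbits_swap(3) by blast
  qed
qed

text \<open>Entries above \<open>k / 2\<close> are complemented one at a time, then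
  \<open>i, t\<close> and \<open>j, s\<close> are ordered by swaps; each move is undone by its own
  generator.\<close>

lemma sine_quad_listed:
  assumes k: "k > 0" "even k" and q: "sine_quad k q"
  shows "q \<in> listed_orbits k"
proof -
  have pull: "p \<in> listed_orbits k" if "sine_quad k p" "g \<in> G0_gens k" "g p \<in> listed_orbits k" for g p
    using listed_orbits_gen[OF that(2,3)] G0_gens_sine_quad(2)[OF that(2,1) k(2)] by simp
  have gens: "(\<lambda>(i, j, s, t). (k - i, j, s, t)) \<in> G0_gens k" "(\<lambda>(i, j, s, t). (i, k - j, s, t)) \<in> G0_gens k"
    "(\<lambda>(i, j, s, t). (i, j, k - s, t)) \<in> G0_gens k" "(\<lambda>(i, j, s, t). (i, j, s, k - t)) \<in> G0_gens k"
    "(\<lambda>(i, j, s, t). (t, j, s, i)) \<in> G0_gens k" "(\<lambda>(i, j, s, t). (i, s, j, t)) \<in> G0_gens k"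
    by (simp_all add: G0_gens_def)
  have step: "(i, j, s, t) \<in> listed_orbits k"
    if "sine_quad k (i, j, s, t)" "2 * i \<le> k" "2 * j \<le> k" "2 * s \<le> k" "2 * t \<le> k" "i \<le> t" for i j s t
  proof (cases "j \<le> s")
    case True
    thus ?thesis using sine_quad_normal_listed[OF k(1)] that by simp
  next
    case False
    hence "(i, s, j, t) \<in> listed_orbits k"
      using sine_quad_normal_listed[OF k(1), of i s j t] G0_gens_sine_quad(1)[OF gens(6) that(1) k(2)] that by simp
    thus ?thesis by (rule listed_orbits_swap)
  qed
  have s0: "(i, j, s, t) \<in> listed_orbits k"
    if "sine_quad k (i, j, s, t)" "2 * i \<le> k" "2 * j \<le> k" "2 * s \<le> k" "2 * t \<le> k" for i j s t
  proof (cases "i \<le> t")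
    case True
    thus ?thesis using step that by blast
  next
    case False
    hence "(t, j, s, i) \<in> listed_orbits k"
      using step[of t j s i] G0_gens_sine_quad(1)[OF gens(5) that(1) k(2)] that by simp
    thus ?thesis by (rule listed_orbits_swap)
  qed
  have s1: "(i, j, s, t) \<in> listed_orbits k"
    if "sine_quad k (i, j, s, t)" "2 * j \<le> k" "2 * s \<le> k" "2 * t \<le> k" for i j s t
  proof (cases "2 * i \<le> k")
    case False
    thus ?thesis using s0[of "k - i" j s t] G0_gens_sine_quad(1)[OF gens(1) that(1) k(2)] that pull[OF that(1) gens(1)] by simp
  qed (use s0 that in blast)
  have s2: "(i, j, s, t) \<in> listed_orbits k"
    if "sine_quad k (i, j, s, t)" "2 * s \<le> k" "2 * t \<le> k" for i j s t
  proof (cases "2 * j \<le> k")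
    case False
    thus ?thesis using s1[of i "k - j" s t] G0_gens_sine_quad(1)[OF gens(2) that(1) k(2)] that pull[OF that(1) gens(2)] by simp
  qed (use s1 that in blast)
  have s3: "(i, j, s, t) \<in> listed_orbits k"
    if "sine_quad k (i, j, s, t)" "2 * t \<le> k" for i j s t
  proof (cases "2 * s \<le> k")
    case False
    thus ?thesis using s2[of i j "k - s" t] G0_gens_sine_quad(1)[OF gens(3) that(1) k(2)] that pull[OF that(1) gens(3)] by simp
  qed (use s2 that in blast)
  have s4: "(i, j, s, t) \<in> listed_orbits k" if "sine_quad k (i, j, s, t)" for i j s t
  proof (cases "2 * t \<le> k")
    case False
    thus ?thesis using s3[of i j s "k - t"] G0_gens_sine_quad(1)[OF gens(4) that(1) k(2)] that pull[OF that(1) gens(4)] by simp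
  qed (use s3 that in blast)
  show ?thesis using s4 q by (cases q) simp
qed

section \<open>The listed quadruples are overlaps\<close>

lemma sn_scale: "m > 0 \<Longrightarrow> sn (N * m) (a * m) = sn N a"
  by (simp add: sn_def)

lemma kset_scale: "m > 0 \<Longrightarrow> a * m \<in> kset (N * m) \<longleftrightarrow> a \<in> kset N"
proof -
  have "x \<in> kset n \<longleftrightarrow> 0 < x \<and> x < n" for x n by (auto simp: kset_def)
  thus "m > 0 \<Longrightarrow> ?thesis" by simp
qed

lemma apart_scale: "m > 0 \<Longrightarrow> apart (N * m) (a * m) (b * m) \<longleftrightarrow> apart N a b"
  by (simp add: apart_def flip: add_mult_distrib)

lemma sine_quad_scale:
  "m > 0 \<Longrightarrow> sine_quad N (a, b, c, d) \<Longrightarrow> sine_quad (N * m) (a * m, b * m, c * m, d * m)"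
  by (simp add: sine_quad_def sn_scale kset_scale apart_scale)

lemma sum_cs_prime:
  assumes "prime p"
  shows "(\<Sum>c<p. cs p (int c)) = 0"
proof -
  have "\<not> int p dvd 1" using assms by (metis int_dvd_int_iff not_prime_unit of_nat_1)
  hence "Re (\<Sum>c<p. rt p (int c)) = 0" using sum_rt_prime[OF assms, of 1] by simp
  thus ?thesis by (simp add: cs_def Re_sum)
qed

lemma cs_5: "2 * cs 5 1 + 2 * cs 5 2 = -1"
proof -
  have "(\<Sum>c<5. cs 5 (int c)) = 0" by (rule sum_cs_prime) (simp add: prime_nat_numeral_eq)
  moreover have "cs 5 4 = cs 5 1" "cs 5 3 = cs 5 2"
    using cs_cong[of 5 4 "-1"] cs_cong[of 5 3 "-2"] by simp_all
  ultimately show ?thesis by (simp add: eval_nat_numeral lessThan_Suc cs_def)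
qed

lemma cs_7: "2 * cs 7 1 + 2 * cs 7 2 + 2 * cs 7 3 = -1"
proof -
  have "(\<Sum>c<7. cs 7 (int c)) = 0" by (rule sum_cs_prime) (simp add: prime_nat_numeral_eq)
  moreover have "cs 7 6 = cs 7 1" "cs 7 5 = cs 7 2" "cs 7 4 = cs 7 3"
    using cs_cong[of 7 6 "-1"] cs_cong[of 7 5 "-2"] cs_cong[of 7 4 "-3"] by simp_all
  ultimately show ?thesis by (simp add: eval_nat_numeral lessThan_Suc cs_def)
qed

lemma cs_6: "cs 6 0 = 1" "cs 6 1 = 1 / 2"
  using cos_60 by (simp_all add: cs_def rt_def)

text \<open>After product-to-sum the listed sine equations for 30 are linear in these cosines. The
  relations come from the fifth roots of unity and from products with the sine of
  \<open>pi / 6\<close>, which is 1/2.\<close>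

lemma cs_60_relations:
  "cs 60 0 = 1" "cs 60 10 = 1 / 2" "cs 60 20 = - 1 / 2" "cs 60 6 = cs 60 12 + 1 / 2"
  "cs 60 2 = cs 60 8 + cs 60 12" "cs 60 4 = cs 60 14 + cs 60 6"
proof -
  show 0: "cs 60 0 = 1" using cs_cancel[of 10 6 0] cs_6 by simp
  show 10: "cs 60 10 = 1 / 2" using cs_cancel[of 10 6 1] cs_6 by simp
  show "cs 60 20 = - 1 / 2" using cs_reflect[of 30 10] 10 by simp
  have "cs 60 12 = cs 5 1" "cs 60 24 = cs 5 2" using cs_cancel[of 12 5 1] cs_cancel[of 12 5 2] by simp_all
  thus "cs 60 6 = cs 60 12 + 1 / 2" using cs_reflect[of 30 24] cs_5 by simp
  have sin: "sn 30 a = cs 60 (15 - int a)" for a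
  proof -
    have "sn 30 a = cos (pi / 2 - pi * real a / 30)" by (simp add: sn_def sin_cos_eq)
    also have "pi / 2 - pi * real a / 30 = pi * (of_int (15 - int a) / real 30)" by (simp add: field_simps)
    finally show ?thesis using cs_half[of 30 "15 - int a"] by simp
  qed
  show "cs 60 2 = cs 60 8 + cs 60 12"
    using sn_mult_sn[of 30 3 5] sin[of 3] sin[of 5] 10 by simp
  show "cs 60 4 = cs 60 14 + cs 60 6"
    using sn_mult_sn[of 30 5 9] sin[of 9] sin[of 5] 10 by simp
qed

lemma cs_60_reflect:
  "cs 60 16 = - cs 60 14" "cs 60 18 = - cs 60 12" "cs 60 22 = - cs 60 8" "cs 60 24 = - cs 60 6"
  "cs 60 26 = - cs 60 4" "cs 60 28 = - cs 60 2"
  using cs_reflect[of 30 14] cs_reflect[of 30 12] cs_reflect[of 30 8] cs_reflect[of 30 6]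
    cs_reflect[of 30 4] cs_reflect[of 30 2] by simp_all

lemmas sine_quad_simps = sine_quad_def kset_def apart_def sn_mult_sn

lemma sine_quad_30:
  "q \<in> {(1, 3, 3, 11), (3, 5, 5, 9), (7, 9, 9, 13), (1, 2, 4, 9), (2, 3, 5, 8), (8, 9, 11, 14),
     (2, 3, 7, 14), (3, 4, 8, 13), (4, 5, 9, 14)} \<Longrightarrow> sine_quad 30 q"
  using cs_60_relations cs_60_reflect by (elim insertE emptyE) (simp_all add: sine_quad_simps)

lemma cs_84_relations:
  "cs 84 14 = 1 / 2" "cs 84 28 = - 1 / 2" "cs 84 18 = cs 84 12 + 1 / 2 - cs 84 6" 
  "cs 84 24 = - cs 84 18"
proof -
  show 14: "cs 84 14 = 1 / 2" using cs_cancel[of 14 6 1] cs_6 by simp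
  show "cs 84 28 = - 1 / 2" using cs_reflect[of 42 14] 14 by simp
  have c: "cs 84 12 = cs 7 1" "cs 84 24 = cs 7 2" "cs 84 36 = cs 7 3"
    using cs_cancel[of 12 7 1] cs_cancel[of 12 7 2] cs_cancel[of 12 7 3] by simp_all
  show 24: "cs 84 24 = - cs 84 18" using cs_reflect[of 42 18] by simp
  have "cs 84 36 = - cs 84 6" using cs_reflect[of 42 6] by simp
  thus "cs 84 18 = cs 84 12 + 1 / 2 - cs 84 6" using c 24 cs_7 by simp
qed

lemma sine_quad_42:
  "q \<in> {(2, 3, 9, 16), (3, 4, 10, 15), (8, 9, 15, 20)} \<Longrightarrow> sine_quad 42 q"
  using cs_84_relations by (elim insertE emptyE) (simp_all add: sine_quad_simps)

lemma cs_120_relations: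
  "cs 120 20 = 1 / 2" "cs 120 30 = 0" "cs 120 12 = cs 120 24 + 1 / 2" "cs 120 36 = - cs 120 24"
proof -
  show "cs 120 20 = 1 / 2" using cs_cancel[of 2 60 10] cs_60_relations by simp
  show "cs 120 30 = 0" using cs_reflect[of 60 30] by simp
  show "cs 120 12 = cs 120 24 + 1 / 2"
    using cs_cancel[of 2 60 12] cs_cancel[of 2 60 6] cs_60_relations by simp
  show "cs 120 36 = - cs 120 24" using cs_reflect[of 60 24] by simp
qed

lemma sine_quad_60:
  "q \<in> {(3, 4, 16, 27), (5, 6, 18, 25), (8, 9, 21, 28)} \<Longrightarrow> sine_quad 60 q"
  using cs_120_relations by (elim insertE emptyE) (simp_all add: sine_quad_simps)

text \<open>The double-angle formula, with the factor 1/2 supplied by the sine of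
  \<open>pi / 6\<close>. The condition \<open>u \<noteq> l\<close> rules out both coincidences
  \<open>u = l\<close> and \<open>3 * l - u = 2 * u\<close>.\<close>

lemma sine_quad_family:
  assumes "k = 6 * l" "1 \<le> u" "u \<le> k div 4" "u \<noteq> l"
  shows "sine_quad k (u, l, 2 * u, 3 * l - u)"
proof -
  have u: "4 * u \<le> 6 * l" "u < 3 * l" "0 < l" using assms by linarith+
  define x where "x = pi * real u / real k"
  have "real (3 * l - u) = 3 * real l - real u" using u by simp
  hence "pi * real (3 * l - u) / real k = pi / 2 - x"
    using u by (simp add: x_def assms(1) field_simps)
  hence 1: "sn k (3 * l - u) = cos x" by (simp add: sn_def cos_sin_eq)
  have 2: "sn k (2 * u) = 2 * sin x * cos x"
    using sin_double[of x] by (simp add: sn_def x_def mult_ac)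
  have 3: "sn k l = 1 / 2" using u sin_30 by (simp add: sn_def assms(1))
  have "sn k u * sn k (3 * l - u) = sn k l * sn k (2 * u)"
    unfolding 1 2 3 by (simp add: sn_def x_def)
  moreover have "u \<in> kset k" "l \<in> kset k" "2 * u \<in> kset k" "3 * l - u \<in> kset k"
    using u assms by (auto simp: kset_def)
  moreover have "apart k u l" "apart k l (3 * l - u)" "apart k (3 * l - u) (2 * u)" "apart k (2 * u) u"
    unfolding apart_def using u assms by (intro conjI notI; linarith)+
  ultimately show ?thesis by (simp add: sine_quad_def)
qed

lemma listed_sound:
  assumes k: "k \<ge> 4" and q: "((i, j, s, t), w) \<in> listed k"
  shows "sine_quad k (i, j, s, t) \<and> even (i + j + s + t) \<and> 2 * w = (int t + int i) - (int s + int j) \<and> 6 dvd k"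
proof -
  have scaled: "sine_quad k (a * m, b * m, c * m, d * m)" if "k = N * m" "sine_quad N (a, b, c, d)" for N m a b c d
  proof -
    have "m > 0" using that(1) k by (cases m) auto
    thus ?thesis using sine_quad_scale[of m N a b c d] that by simp
  qed
  from q show ?thesis unfolding listed_def
  proof (elim UnE UN_E CollectE exE conjE)
    fix u l
    assume u: "k = 6 * l" "1 \<le> u" "u \<le> k div 4" "u \<noteq> l"
      and eq: "((i, j, s, t), w) = ((u, l, 2 * u, 3 * l - u), int l - int u)"
    have "u \<le> 3 * l" using u by linarith
    moreover from this have "u + l + 2 * u + (3 * l - u) = 2 * (2 * l + u)" by simp
    hence "even (u + l + 2 * u + (3 * l - u))" by (metis dvd_triv_left)
    ultimately show ?thesis using sine_quad_family[OF u] eq u(1) by (simp add: of_nat_diff)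
  next
    fix m
    assume km: "k = 30 * m" and "((i, j, s, t), w) \<in> {((m, 3 * m, 3 * m, 11 * m), int (3 * m)),
        ((3 * m, 5 * m, 5 * m, 9 * m), int m),
        ((7 * m, 9 * m, 9 * m, 13 * m), int m),
        ((m, 2 * m, 4 * m, 9 * m), int (2 * m)),
        ((2 * m, 3 * m, 5 * m, 8 * m), int m),
        ((8 * m, 9 * m, 11 * m, 14 * m), int m),
        ((2 * m, 3 * m, 7 * m, 14 * m), int (3 * m)),
        ((3 * m, 4 * m, 8 * m, 13 * m), int (2 * m)),
        ((4 * m, 5 * m, 9 * m, 14 * m), int (2 * m))}"
    thus ?thesis
      using scaled[OF km sine_quad_30, of 1 3 3 11]
        scaled[OF km sine_quad_30, of 3 5 5 9]
        scaled[OF km sine_quad_30, of 7 9 9 13]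
        scaled[OF km sine_quad_30, of 1 2 4 9]
        scaled[OF km sine_quad_30, of 2 3 5 8]
        scaled[OF km sine_quad_30, of 8 9 11 14]
        scaled[OF km sine_quad_30, of 2 3 7 14]
        scaled[OF km sine_quad_30, of 3 4 8 13]
        scaled[OF km sine_quad_30, of 4 5 9 14]
      by (elim insertE emptyE) simp_all
  next
    fix m
    assume km: "k = 42 * m" and "((i, j, s, t), w) \<in> {((2 * m, 3 * m, 9 * m, 16 * m), int (3 * m)),
        ((3 * m, 4 * m, 10 * m, 15 * m), int (2 * m)),
        ((8 * m, 9 * m, 15 * m, 20 * m), int (2 * m))}"
    thus ?thesis
      using scaled[OF km sine_quad_42, of 2 3 9 16]
        scaled[OF km sine_quad_42, of 3 4 10 15]
        scaled[OF km sine_quad_42, of 8 9 15 20]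
      by (elim insertE emptyE) simp_all
  next
    fix m
    assume km: "k = 60 * m" and "((i, j, s, t), w) \<in> {((3 * m, 4 * m, 16 * m, 27 * m), int (5 * m)),
        ((5 * m, 6 * m, 18 * m, 25 * m), int (3 * m)),
        ((8 * m, 9 * m, 21 * m, 28 * m), int (3 * m))}"
    thus ?thesis
      using scaled[OF km sine_quad_60, of 3 4 16 27]
        scaled[OF km sine_quad_60, of 5 6 18 25]
        scaled[OF km sine_quad_60, of 8 9 21 28]
      by (elim insertE emptyE) simp_all
  qed
qed

lemma phi_quotient_identity:
  assumes k: "k > 0" and q: "sine_quad k (i, j, s, t)" and w: "2 * w = (int t + int i) - (int s + int j)"
  shows "phi k powi w * ((phi k ^ j - 1) / (phi k ^ i - 1)) = (phi k ^ t - 1) / (phi k ^ s - 1)"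
proof -
  have nz: "phi k ^ n - 1 \<noteq> 0" if "n \<in> kset k" for n
    unfolding phi_power rt_minus_1[OF k] using sn_pos[OF that] by simp
  have "phi k ^ i - 1 \<noteq> 0" "phi k ^ s - 1 \<noteq> 0" using q nz by (auto simp: sine_quad_def)
  moreover have "phi k powi w * (phi k ^ j - 1) * (phi k ^ s - 1) = (phi k ^ i - 1) * (phi k ^ t - 1)"
    using q by (intro phi_sn_identity[OF k _ w]) (simp add: sine_quad_def)
  ultimately show ?thesis by (simp add: divide_simps)
qed

theorem theorem26:
  fixes k :: nat
  assumes "k \<ge> 4" and "even k"
  shows "(Ovl k \<noteq> {} \<longrightarrow> 6 dvd k)
    \<and> Ovl k = (\<Union>(q, \<omega>)\<in>listed k. G0_orbit k q)
    \<and> (\<forall>((i, j, s, t), \<omega>)\<in>listed k.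
          (i, j, s, t) \<in> Ovl k
        \<and> phi k powi \<omega> * ((phi k ^ j - 1) / (phi k ^ i - 1)) = (phi k ^ t - 1) / (phi k ^ s - 1)
        \<and> 2 * \<omega> = (int t + int i) - (int s + int j))"
proof -
  have k: "k > 0" using assms(1) by simp
  have sound: "sine_quad k p \<and> even (quad_sum p) \<and> 6 dvd k" if p: "p \<in> fst ` listed k" for p
  proof -
    obtain i j s t w where "p = (i, j, s, t)" "((i, j, s, t), w) \<in> listed k"
      using p by force
    thus ?thesis using listed_sound[OF assms(1)] by (simp add: quad_sum_def)
  qed
  have sub: "Ovl k \<subseteq> listed_orbits k"
    using Ovl_imp_sine_quad[OF k] sine_quad_listed[OF k assms(2)] by blast
  have "q \<in> Ovl k" if "q \<in> listed_orbits k" for q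
  proof -
    obtain p where p: "p \<in> fst ` listed k" "q \<in> G0_orbit k p"
      using \<open>q \<in> listed_orbits k\<close> unfolding listed_orbits_iff by blast
    then obtain g where "g \<in> G0 k" "q = g p" by (auto simp: G0_orbit_def)
    \<comment> \<open>The parity of the listed representative carries over to its orbit and turns
      the sine equation back into an overlap.\<close>
    hence "sine_quad k q" "even (quad_sum q)" using G0_sine_quad[OF _ _ assms(2)] sound[OF p(1)] by blast+
    thus ?thesis using sine_quad_imp_Ovl[OF k] by (cases q) (simp add: quad_sum_def)
  qed
  hence eq: "Ovl k = listed_orbits k" using sub by blast
  have "6 dvd k" if "Ovl k \<noteq> {}"
    using that sound unfolding eq by (metis ex_in_conv listed_orbits_iff)
  moreover have "(i, j, s, t) \<in> Ovl k
        \<and> phi k powi w * ((phi k ^ j - 1) / (phi k ^ i - 1)) = (phi k ^ t - 1) / (phi k ^ s - 1)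
        \<and> 2 * w = (int t + int i) - (int s + int j)" if "((i, j, s, t), w) \<in> listed k" for i j s t w
    using listed_sound[OF assms(1) that] sine_quad_imp_Ovl[OF k] phi_quotient_identity[OF k] by blast
  ultimately show ?thesis using eq unfolding listed_orbits_def by blast
qed

end
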